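(* Every smooth right (respectively, left) action $H:M\times\mathcal G_2\to M$ (resp., $H:\mathcal G_2\times M\to M$) of the monoid $\mathcal G_2$ on a smooth manifold $M$ provides $M$ with: (1) a canonical graded bundle structure $\pi:M\to M_0:=H_{(0,0)}(M)$ induced by the action of the submonoid $(\mathbb R,\cdot)\simeq\{(a,0)\}\subset\mathcal G_2$; (2) a complete vector field $X\in\mathfrak X(M)$ of weight $-1$ (resp., $Y\in\mathfrak X(M)$ of weight $+1$) with respect to this graded bundle structure, namely the infinitesimal generator of the flow $s\mapsto H_{(1,s)}$ given by the action of the additive group $(\mathbb R,+)\simeq\{(1,s)\}\subset\mathcal G_2$. In other words, any such $\mathcal G_2$-action provides $M$ with two complete vector fields, the weight vector field $\Delta$ and another vector field $X$ (resp., $Y$), whose Lie bracket satisfies $[\Delta,X]=-X$ (resp., $[\Delta,Y]=Y$).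
   Context: $\mathcal G_2$ is the monoid of second jets at $0$ of maps $\phi:(\mathbb R,0)\to(\mathbb R,0)$ under composition; it is identified with $\mathbb R^2=\{(a,b)\}$ (the class of $\phi(t)=at+\frac12bt^2$), with multiplication $(a,b)(A,B)=(aA,\,aB+bA^2)$ and unit $(1,0)$. A left action satisfies $g.(g'.p)=(gg').p$, a right action satisfies $(p.g).g'=p.(gg')$, and the unit acts as the identity. $H_g:M\to M$ denotes the action of $g\in\mathcal G_2$. A (real) graded space of rank $\mathbf d=(d_1,\dots,d_k)$ is a manifold diffeomorphic to $\mathbb R^{d_1+\dots+d_k}$ with an equivalence class of global coordinate systems $(y^\alpha)$ with positive integer weights $w^\alpha$ ($d_i$ coordinates of weight $i$), two systems being equivalent if each new coordinate of weight $w$ is a real polynomial in the old ones all of whose monomials $y^{\alpha_1}\cdots y^{\alpha_j}$, $j\ge1$, satisfy $w^{\alpha_1}+\dots+w^{\alpha_j}=w$. A graded bundle is a smooth fiber bundle with typical fiber a graded space and with transition maps that are isomorphisms of graded spaces on fibers (rank allowed to differ on different connected components of $M$). A graded bundle $E$ has the action by homotheties of $(\mathbb R,\cdot)$, $h_t(x,(y^\alpha))=(x,(t^{w^\alpha}y^\alpha))$. The graded bundle structure "induced by" an action $h$ of $(\mathbb R,\cdot)$ is the one on $h_0:M\to h_0(M)$ whose homotheties are $h$; here $h_a=H_{(a,0)}$. The weight vector field is $\Delta(p)=\frac{d}{dt}|_{t=1}h_t(p)$, with flow $t\mapsto h_{e^t}$. A vector field $Z$ on $M$ has weight $w$ if $(h_t)_*Z(p)=t^{-w}Z(h_t(p))$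 for all $p\in M$ and $t>0$; equivalently $[\Delta,Z]=wZ$. *)

theory Defs
  imports "HOL-Analysis.Analysis"
begin

primrec C_k_on :: "nat \<Rightarrow> 'a::real_normed_vector set \<Rightarrow> ('a \<Rightarrow> 'b::real_normed_vector) \<Rightarrow> bool" where
  "C_k_on 0 S f \<longleftrightarrow> continuous_on S f"
| "C_k_on (Suc k) S f \<longleftrightarrow>
     (\<forall>x\<in>S. f differentiable (at x)) \<and> (\<forall>v. C_k_on k S (\<lambda>x. frechet_derivative f (at x) v))"

text \<open>\<^const>\<open>C_k_on\<close> is only meaningful on open sets. On an arbitrary set, smoothness means
  existence of local smooth extensions. On a relatively open subset of a linear
  subspace this is smoothness in the linear coordinates of that subspace.\<close>

definition smooth_on :: "'a::real_normed_vector set \<Rightarrow> ('a \<Rightarrow> 'b::real_normed_vector) \<Rightarrow> bool" where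
  "smooth_on S f \<longleftrightarrow>
     (\<forall>x\<in>S. \<exists>N g. open N \<and> x \<in> N \<and> (\<forall>k. C_k_on k N g) \<and> (\<forall>y\<in>N \<inter> S. g y = f y))"

text \<open>A manifold is a subset \<open>M\<close> of a Hausdorff second countable type, with its subspace topology.
  A chart takes values in a relatively open subset of a coordinate subspace \<open>span B\<close> of
  \<open>'e\<close>, where \<open>B \<subseteq> Basis\<close>, so that \<open>\<real>\<^sup>n\<close> is available as a model for every
  \<open>n \<le> DIM('e)\<close>, including \<open>n = 0\<close>. Connected components may have different dimensions: this is
  needed for the base of a graded bundle even if the total space has pure dimension.
  The values of a chart outside its domain are irrelevant.\<close>

type_synonym ('m, 'e) chart = "'m set \<times> ('m \<Rightarrow> 'e)"

definition is_chart ::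
  "'m::topological_space set \<Rightarrow> ('m, 'e::euclidean_space) chart \<Rightarrow> bool" where
  "is_chart M = (\<lambda>(U, \<phi>).
     openin (top_of_set M) U \<and>
     (\<exists>B\<subseteq>Basis. openin (top_of_set (span B)) (\<phi> ` U)) \<and>
     homeomorphism U (\<phi> ` U) \<phi> (inv_into U \<phi>))"

definition smooth_manifold ::
  "'m::{t2_space,second_countable_topology} set \<Rightarrow> ('m, 'e::euclidean_space) chart set \<Rightarrow> bool" where
  "smooth_manifold M A \<longleftrightarrow>
     (\<forall>c\<in>A. is_chart M c) \<and>
     (\<Union>(U, \<phi>)\<in>A. U) = M \<and>
     (\<forall>(U, \<phi>)\<in>A. \<forall>(V, \<psi>)\<in>A. smooth_on (\<phi> ` (U \<inter> V)) (\<psi> \<circ> inv_into U \<phi>))"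

text \<open>Atlases are not assumed maximal in \<^const>\<open>smooth_manifold\<close>. A smooth structure is a maximal
  atlas, so that two of them are equal as soon as they are equivalent.\<close>

definition smooth_structure ::
  "'m::{t2_space,second_countable_topology} set \<Rightarrow> ('m, 'e::euclidean_space) chart set \<Rightarrow> bool" where
  "smooth_structure M A \<longleftrightarrow>
     smooth_manifold M A \<and> (\<forall>A'. smooth_manifold M A' \<and> A \<subseteq> A' \<longrightarrow> A' = A)"

definition smooth_map ::
  "'m::topological_space set \<Rightarrow> ('m, 'e::euclidean_space) chart set \<Rightarrow>
   'n::topological_space set \<Rightarrow> ('n, 'f::euclidean_space) chart set \<Rightarrow> ('m \<Rightarrow> 'n) \<Rightarrow> bool" where
  "smooth_map M A N A' F \<longleftrightarrow>
     F ` M \<subseteq> N \<and> continuous_on M F \<and>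
     (\<forall>(U, \<phi>)\<in>A. \<forall>(V, \<psi>)\<in>A'. smooth_on (\<phi> ` (U \<inter> F -` V)) (\<psi> \<circ> F \<circ> inv_into U \<phi>))"

definition diffeomorphism ::
  "'m::topological_space set \<Rightarrow> ('m, 'e::euclidean_space) chart set \<Rightarrow>
   'n::topological_space set \<Rightarrow> ('n, 'f::euclidean_space) chart set \<Rightarrow> ('m \<Rightarrow> 'n) \<Rightarrow> bool" where
  "diffeomorphism M A N A' F \<longleftrightarrow>
     bij_betw F M N \<and> smooth_map M A N A' F \<and> smooth_map N A' M A (inv_into M F)"

definition euclidean_atlas :: "'e::euclidean_space set \<Rightarrow> ('e, 'e) chart set" where
  "euclidean_atlas S = {(S, \<lambda>x. x)}"

definition restrict_atlas :: "('m, 'e) chart set \<Rightarrow> 'm set \<Rightarrow> ('m, 'e) chart set" where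
  "restrict_atlas A W = {(U \<inter> W, \<phi>) | U \<phi>. (U, \<phi>) \<in> A}"

definition prod_atlas ::
  "('m, 'e) chart set \<Rightarrow> ('n, 'f) chart set \<Rightarrow> ('m \<times> 'n, 'e \<times> 'f) chart set" where
  "prod_atlas A A' = {(U \<times> V, map_prod \<phi> \<psi>) | U \<phi> V \<psi>. (U, \<phi>) \<in> A \<and> (V, \<psi>) \<in> A'}"

definition smooth_functions ::
  "'m::topological_space set \<Rightarrow> ('m, 'e::euclidean_space) chart set \<Rightarrow> ('m \<Rightarrow> real) set" where
  "smooth_functions M A = {f. smooth_map M A UNIV (euclidean_atlas UNIV) f}"

text \<open>Tangent vectors are derivations of the algebra of smooth functions, extended by zero to
  the remaining functions. Vector fields are extended by zero outside of \<open>M\<close>. Hence both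
  can be compared by equality.\<close>

type_synonym 'm tangent_vector = "('m \<Rightarrow> real) \<Rightarrow> real"

definition tangent_space ::
  "'m::topological_space set \<Rightarrow> ('m, 'e::euclidean_space) chart set \<Rightarrow> 'm \<Rightarrow> 'm tangent_vector set" where
  "tangent_space M A p = {v.
     (\<forall>f\<in>smooth_functions M A. \<forall>g\<in>smooth_functions M A. v (\<lambda>x. f x + g x) = v f + v g) \<and>
     (\<forall>c. \<forall>f\<in>smooth_functions M A. v (\<lambda>x. c * f x) = c * v f) \<and>
     (\<forall>f\<in>smooth_functions M A. \<forall>g\<in>smooth_functions M A.
        v (\<lambda>x. f x * g x) = f p * v g + g p * v f) \<and>
     (\<forall>f. f \<notin> smooth_functions M A \<longrightarrow> v f = 0)}"

definition vector_field ::
  "'m::topological_space set \<Rightarrow> ('m, 'e::euclidean_space) chart set \<Rightarrow> ('m \<Rightarrow> 'm tangent_vector) \<Rightarrow> bool" where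
  "vector_field M A X \<longleftrightarrow>
     (\<forall>p\<in>M. X p \<in> tangent_space M A p) \<and>
     (\<forall>p. p \<notin> M \<longrightarrow> X p = (\<lambda>f. 0)) \<and>
     (\<forall>f\<in>smooth_functions M A. (\<lambda>p. X p f) \<in> smooth_functions M A)"

definition lie_bracket ::
  "('m \<Rightarrow> 'm tangent_vector) \<Rightarrow> ('m \<Rightarrow> 'm tangent_vector) \<Rightarrow> ('m \<Rightarrow> 'm tangent_vector)" where
  "lie_bracket X Y = (\<lambda>p f. X p (\<lambda>q. Y q f) - Y p (\<lambda>q. X q f))"

definition pushforward ::
  "'n::topological_space set \<Rightarrow> ('n, 'f::euclidean_space) chart set \<Rightarrow>
   ('m \<Rightarrow> 'n) \<Rightarrow> 'm tangent_vector \<Rightarrow> 'n tangent_vector" where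
  "pushforward N A' F v = (\<lambda>f. if f \<in> smooth_functions N A' then v (f \<circ> F) else 0)"

definition velocity ::
  "'m::topological_space set \<Rightarrow> ('m, 'e::euclidean_space) chart set \<Rightarrow> (real \<Rightarrow> 'm) \<Rightarrow> real \<Rightarrow> 'm tangent_vector" where
  "velocity M A \<gamma> t = (\<lambda>f. if f \<in> smooth_functions M A then deriv (f \<circ> \<gamma>) t else 0)"

definition integral_curve ::
  "'m::topological_space set \<Rightarrow> ('m, 'e::euclidean_space) chart set \<Rightarrow>
   ('m \<Rightarrow> 'm tangent_vector) \<Rightarrow> (real \<Rightarrow> 'm) \<Rightarrow> bool" where
  "integral_curve M A X \<gamma> \<longleftrightarrow>
     smooth_map UNIV (euclidean_atlas UNIV) M A \<gamma> \<and> (\<forall>t. velocity M A \<gamma> t = X (\<gamma> t))"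

definition complete_vector_field ::
  "'m::topological_space set \<Rightarrow> ('m, 'e::euclidean_space) chart set \<Rightarrow> ('m \<Rightarrow> 'm tangent_vector) \<Rightarrow> bool" where
  "complete_vector_field M A X \<longleftrightarrow>
     vector_field M A X \<and> (\<forall>p\<in>M. \<exists>\<gamma>. integral_curve M A X \<gamma> \<and> \<gamma> 0 = p)"

definition global_flow ::
  "'m::topological_space set \<Rightarrow> ('m, 'e::euclidean_space) chart set \<Rightarrow> (real \<Rightarrow> 'm \<Rightarrow> 'm) \<Rightarrow> bool" where
  "global_flow M A \<Phi> \<longleftrightarrow>
     smooth_map (UNIV \<times> M) (prod_atlas (euclidean_atlas UNIV) A) M A (\<lambda>(s, p). \<Phi> s p) \<and>
     (\<forall>p\<in>M. \<Phi> 0 p = p) \<and>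
     (\<forall>p\<in>M. \<forall>s t. \<Phi> s (\<Phi> t p) = \<Phi> (s + t) p)"

definition infinitesimal_generator ::
  "'m::topological_space set \<Rightarrow> ('m, 'e::euclidean_space) chart set \<Rightarrow>
   (real \<Rightarrow> 'm \<Rightarrow> 'm) \<Rightarrow> ('m \<Rightarrow> 'm tangent_vector)" where
  "infinitesimal_generator M A \<Phi> =
     (\<lambda>p. if p \<in> M then velocity M A (\<lambda>s. \<Phi> s p) 0 else (\<lambda>f. 0))"

text \<open>A graded space is presented in a global coordinate system: it is \<open>span B\<close> for some
  \<open>B \<subseteq> Basis\<close>, with coordinates \<open>y \<bullet> b\<close> of weight \<open>w b > 0\<close> for \<open>b \<in> B\<close>. The components
  of the rank are \<open>d i = card {b \<in> B. w b = i}\<close>.\<close>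

definition weighted_exponents :: "'f set \<Rightarrow> ('f \<Rightarrow> nat) \<Rightarrow> nat \<Rightarrow> ('f \<Rightarrow> nat) set" where
  "weighted_exponents B w k = {m. (\<forall>b. b \<notin> B \<longrightarrow> m b = 0) \<and> (\<Sum>b\<in>B. m b * w b) = k}"

text \<open>Since the weights are positive, the set of exponents is finite, and for \<open>k > 0\<close>
  it does not contain the zero exponent.\<close>

definition weighted_polynomial ::
  "'f::euclidean_space set \<Rightarrow> ('f \<Rightarrow> nat) \<Rightarrow> nat \<Rightarrow> ('f \<Rightarrow> real) \<Rightarrow> bool" where
  "weighted_polynomial B w k P \<longleftrightarrow>
     (\<exists>c :: ('f \<Rightarrow> nat) \<Rightarrow> real. \<forall>y\<in>span B.
        P y = (\<Sum>m\<in>weighted_exponents B w k. c m * (\<Prod>b\<in>B. (y \<bullet> b) ^ m b)))"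

definition graded_space_iso ::
  "'f::euclidean_space set \<Rightarrow> ('f \<Rightarrow> nat) \<Rightarrow> 'f set \<Rightarrow> ('f \<Rightarrow> nat) \<Rightarrow> ('f \<Rightarrow> 'f) \<Rightarrow> bool" where
  "graded_space_iso B w B' w' F \<longleftrightarrow>
     bij_betw F (span B) (span B') \<and>
     (\<forall>b'\<in>B'. weighted_polynomial B w (w' b') (\<lambda>y. F y \<bullet> b')) \<and>
     (\<forall>b\<in>B. weighted_polynomial B' w' (w b) (\<lambda>y'. inv_into (span B) F y' \<bullet> b))"

text \<open>A local trivialization \<open>(U, B, w, y)\<close> over \<open>U\<close> with fiber \<open>span B\<close> is given by its
  second component \<open>y\<close>: it is the diffeomorphism \<open>p \<mapsto> (\<pi> p, y p)\<close>.\<close>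

type_synonym ('m, 'n, 'f) trivialization = "'n set \<times> 'f set \<times> ('f \<Rightarrow> nat) \<times> ('m \<Rightarrow> 'f)"

definition is_graded_trivialization ::
  "'m::topological_space set \<Rightarrow> ('m, 'e::euclidean_space) chart set \<Rightarrow>
   'n::topological_space set \<Rightarrow> ('n, 'd::euclidean_space) chart set \<Rightarrow> ('m \<Rightarrow> 'n) \<Rightarrow>
   ('m, 'n, 'f::euclidean_space) trivialization \<Rightarrow> bool" where
  "is_graded_trivialization M A N A' \<pi> = (\<lambda>(U, B, w, y).
     openin (top_of_set N) U \<and> B \<subseteq> Basis \<and> (\<forall>b\<in>B. w b > 0) \<and>
     diffeomorphism
       (M \<inter> \<pi> -` U) (restrict_atlas A (M \<inter> \<pi> -` U))
       (U \<times> span B) (prod_atlas (restrict_atlas A' U) (euclidean_atlas (span B)))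
       (\<lambda>p. (\<pi> p, y p)))"

definition graded_bundle_atlas ::
  "'m::topological_space set \<Rightarrow> ('m, 'e::euclidean_space) chart set \<Rightarrow>
   'n::topological_space set \<Rightarrow> ('n, 'd::euclidean_space) chart set \<Rightarrow> ('m \<Rightarrow> 'n) \<Rightarrow>
   ('m, 'n, 'f::euclidean_space) trivialization set \<Rightarrow> bool" where
  "graded_bundle_atlas M A N A' \<pi> \<T> \<longleftrightarrow>
     smooth_map M A N A' \<pi> \<and> \<pi> ` M = N \<and>
     (\<forall>T\<in>\<T>. is_graded_trivialization M A N A' \<pi> T) \<and>
     (\<Union>(U, B, w, y)\<in>\<T>. U) = N \<and>
     (\<forall>(U, B, w, y)\<in>\<T>. \<forall>(U', B', w', y')\<in>\<T>. \<forall>x\<in>U \<inter> U'.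
        graded_space_iso B w B' w' (y' \<circ> inv_into (M \<inter> \<pi> -` {x}) y))"

text \<open>As for smooth structures, a graded bundle structure is a maximal atlas. Since the
  transition maps are isomorphisms of graded spaces, the rank is locally constant on the base.\<close>

definition graded_bundle ::
  "'m::topological_space set \<Rightarrow> ('m, 'e::euclidean_space) chart set \<Rightarrow>
   'n::topological_space set \<Rightarrow> ('n, 'd::euclidean_space) chart set \<Rightarrow> ('m \<Rightarrow> 'n) \<Rightarrow>
   ('m, 'n, 'f::euclidean_space) trivialization set \<Rightarrow> bool" where
  "graded_bundle M A N A' \<pi> \<T> \<longleftrightarrow>
     graded_bundle_atlas M A N A' \<pi> \<T> \<and>
     (\<forall>\<T>'. graded_bundle_atlas M A N A' \<pi> \<T>' \<and> \<T> \<subseteq> \<T>' \<longrightarrow> \<T>' = \<T>)"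

definition has_homotheties ::
  "'m set \<Rightarrow> ('m \<Rightarrow> 'n) \<Rightarrow> ('m, 'n, 'f::euclidean_space) trivialization set \<Rightarrow>
   (real \<Rightarrow> 'm \<Rightarrow> 'm) \<Rightarrow> bool" where
  "has_homotheties M \<pi> \<T> h \<longleftrightarrow>
     (\<forall>(U, B, w, y)\<in>\<T>. \<forall>p\<in>M \<inter> \<pi> -` U. \<forall>t.
        h t p \<in> M \<and> \<pi> (h t p) = \<pi> p \<and> (\<forall>b\<in>B. y (h t p) \<bullet> b = t ^ w b * (y p \<bullet> b)))"

definition weight_vector_field ::
  "'m::topological_space set \<Rightarrow> ('m, 'e::euclidean_space) chart set \<Rightarrow>
   (real \<Rightarrow> 'm \<Rightarrow> 'm) \<Rightarrow> ('m \<Rightarrow> 'm tangent_vector)" where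
  "weight_vector_field M A h =
     (\<lambda>p. if p \<in> M then velocity M A (\<lambda>t. h t p) 1 else (\<lambda>f. 0))"

definition has_weight ::
  "'m::topological_space set \<Rightarrow> ('m, 'e::euclidean_space) chart set \<Rightarrow>
   (real \<Rightarrow> 'm \<Rightarrow> 'm) \<Rightarrow> ('m \<Rightarrow> 'm tangent_vector) \<Rightarrow> int \<Rightarrow> bool" where
  "has_weight M A h Z w \<longleftrightarrow>
     (\<forall>p\<in>M. \<forall>t>0. pushforward M A (h t) (Z p) = (\<lambda>f. t powi (- w) * Z (h t p) f))"

type_synonym G2 = "real \<times> real"

text \<open>The pair \<open>(a, b)\<close> is the second jet at \<open>0\<close> of \<open>t \<mapsto> a * t + b * t\<^sup>2 / 2\<close>, and
  \<open>G2_mult g g'\<close> is the jet of the composition of \<open>g\<close> after \<open>g'\<close>.\<close>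

definition G2_mult :: "G2 \<Rightarrow> G2 \<Rightarrow> G2" where
  "G2_mult = (\<lambda>(a, b) (a', b'). (a * a', a * b' + b * a'^2))"

definition G2_one :: G2 where
  "G2_one = (1, 0)"

definition smooth_right_G2_action ::
  "'m::topological_space set \<Rightarrow> ('m, 'e::euclidean_space) chart set \<Rightarrow> ('m \<times> G2 \<Rightarrow> 'm) \<Rightarrow> bool" where
  "smooth_right_G2_action M A H \<longleftrightarrow>
     smooth_map (M \<times> UNIV) (prod_atlas A (euclidean_atlas UNIV)) M A H \<and>
     (\<forall>p\<in>M. H (p, G2_one) = p) \<and>
     (\<forall>p\<in>M. \<forall>g g'. H (H (p, g), g') = H (p, G2_mult g g'))"

definition smooth_left_G2_action ::
  "'m::topological_space set \<Rightarrow> ('m, 'e::euclidean_space) chart set \<Rightarrow> (G2 \<times> 'm \<Rightarrow> 'm) \<Rightarrow> bool" where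
  "smooth_left_G2_action M A H \<longleftrightarrow>
     smooth_map (UNIV \<times> M) (prod_atlas (euclidean_atlas UNIV) A) M A H \<and>
     (\<forall>p\<in>M. H (G2_one, p) = p) \<and>
     (\<forall>p\<in>M. \<forall>g g'. H (g, H (g', p)) = H (G2_mult g g', p))"

end

theory Submission
  imports Defs
begin

text \<open>Differentiating \<open>h\<close> at a fixed point \<open>x0\<close> of the homotheties gives a smooth representation \<open>D\<close> of
  the monoid \<open>(\<real>, \<cdot>)\<close>. Its Taylor coefficients at \<open>t = 0\<close> are orthogonal projections that sum up to the
  identity, hence \<open>D t\<close> is diagonal with entries \<open>t ^ w\<close>. If \<open>g\<close> is a coordinate of weight \<open>w\<close> in this
  diagonalization, then \<open>p \<mapsto> (d/dt)\<^sup>w g (h t p) / w!\<close> at \<open>t = 0\<close> is homogeneous of weight \<open>w\<close> with the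
  same differential at \<open>x0\<close>. By the inverse function theorem these functions are coordinates
  near \<open>x0\<close>, and since \<open>h (1/t)\<close> spreads any neighbourhood of \<open>x0\<close> along the fibers, they are global on the
  fibers. Two such systems differ by smooth homogeneous maps, which are weighted polynomials by
  Euler's identity. This also yields uniqueness. The statements on the vector fields follow from
  \<open>(1, s) (t, 0) = (t, s t\<^sup>2)\<close>, \<open>(t, 0) (1, s) = (t, s t)\<close> and the symmetry of second derivatives.\<close>

section \<open>Smooth functions on open subsets of normed spaces\<close>

text \<open>Smoothness at t = 0 is what forces the weights to be natural numbers: the group of
  positive reals alone would admit arbitrary real exponents and representations that are not
  diagonalizable. Since the action is only smooth and not analytic, vectors with vanishing Taylor
  coefficients have to be excluded by a growth argument. A chart takes values in a coordinate
  subspace \<open>span B\<close>, whereas derivatives are taken on open sets of the whole space;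
  local formulas are therefore precomposed with the projection onto \<open>span B\<close>, and the
  identity on the complement is added before the inverse function theorem is applied. Coordinates of
  weight 0 become charts of the base, the others become fiber coordinates. The smooth structure of
  the base is unique because a trivialization has a smooth zero section, which factors the identity
  of the base through M. Right and left actions differ only in the power of t that a homothety puts
  on the flow parameter, depending on which of the two acts first. \<open>G2_flow\<close> keeps the
  two exponents m and n as parameters, and the generator has weight n - m.\<close>

abbreviation dird :: "'a::real_normed_vector \<Rightarrow> ('a \<Rightarrow> 'b::real_normed_vector) \<Rightarrow> 'a \<Rightarrow> 'b" where
  "dird v f \<equiv> \<lambda>x. frechet_derivative f (at x) v"

text \<open>Also true at points without a derivative: \<open>frechet_derivative\<close> chooses from
  the same set of candidates for both functions.\<close>

lemma frechet_derivative_cong_open: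
  assumes "open N" "x \<in> N" "\<And>y. y \<in> N \<Longrightarrow> f y = g y"
  shows "frechet_derivative f (at x) = frechet_derivative g (at x)"
proof -
  have "(f has_derivative D) (at x) \<longleftrightarrow> (g has_derivative D) (at x)" for D
    using has_derivative_transform_within_open[OF _ assms(1,2)] assms(3) by metis
  then show ?thesis by (simp add: frechet_derivative_def)
qed

lemma differentiable_cong_open:
  assumes "open N" "x \<in> N" "\<And>y. y \<in> N \<Longrightarrow> f y = g y"
  shows "f differentiable (at x) \<longleftrightarrow> g differentiable (at x)"
  using has_derivative_transform_within_open[OF _ assms(1,2)] assms(3)
  unfolding differentiable_def by metis

lemma C_k_on_cong:
  assumes "open N" "\<And>y. y \<in> N \<Longrightarrow> f y = g y"
  shows "C_k_on k N f \<longleftrightarrow> C_k_on k N g"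
  using assms(2)
proof (induction k arbitrary: f g)
  case 0
  then show ?case by (auto intro: continuous_on_cong)
next
  case (Suc k)
  have 1: "f differentiable (at x) \<longleftrightarrow> g differentiable (at x)" if "x \<in> N" for x
    using differentiable_cong_open[OF assms(1) that] Suc.prems by blast
  have 2: "C_k_on k N (dird v f) \<longleftrightarrow> C_k_on k N (dird v g)" for v
    by (rule Suc.IH) (simp add: frechet_derivative_cong_open[OF assms(1) _ Suc.prems])
  show ?case by (simp add: 1 2)
qed

lemma C_k_on_subset: "C_k_on k N f \<Longrightarrow> N' \<subseteq> N \<Longrightarrow> C_k_on k N' f"
  by (induction k arbitrary: f) (auto intro: continuous_on_subset)

lemma C_k_on_Suc_imp: "C_k_on (Suc k) N f \<Longrightarrow> C_k_on k N f"
proof (induction k arbitrary: f)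
  case 0
  then show ?case
    by (auto simp: continuous_on_eq_continuous_within
        intro: differentiable_imp_continuous_within differentiable_at_withinI)
next
  case (Suc k)
  from Suc.prems show ?case by (subst C_k_on.simps) (auto intro!: Suc.IH)
qed

lemma C_k_on_const: "C_k_on k N (\<lambda>x. c)"
  by (induction k arbitrary: c) auto

lemma C_k_on_bounded_linear:
  assumes "bounded_linear f" shows "C_k_on k N f"
proof (cases k)
  case 0
  then show ?thesis using assms by (simp add: linear_continuous_on)
next
  case (Suc k)
  have "f differentiable (at x)" for x
    using assms bounded_linear_imp_differentiable by blast
  moreover have "dird v f = (\<lambda>x. f v)" for v
    using frechet_derivative_at[OF bounded_linear_imp_has_derivative[OF assms]] by metis
  ultimately show ?thesis by (simp add: Suc C_k_on_const)
qed

lemma C_k_on_add: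
  assumes "open N" "C_k_on k N f" "C_k_on k N g"
  shows "C_k_on k N (\<lambda>x. f x + g x)"
  using assms(2,3)
proof (induction k arbitrary: f g)
  case (Suc k)
  have d: "((\<lambda>x. f x + g x) has_derivative (\<lambda>v. dird v f x + dird v g x)) (at x)" if "x \<in> N" for x
    using that Suc.prems by (intro Deriv.has_derivative_add iffD1[OF frechet_derivative_works]) simp_all
  have "C_k_on k N (dird v (\<lambda>x. f x + g x)) \<longleftrightarrow> C_k_on k N (\<lambda>x. dird v f x + dird v g x)" for v 
    by (intro C_k_on_cong[OF assms(1)]) (simp flip: frechet_derivative_at[OF d])
  with Suc d show ?case by (auto simp: differentiable_def)
qed (auto intro: continuous_on_add)

lemma C_k_on_bounded_bilinear:
  assumes "bounded_bilinear B" "open N" "C_k_on k N f" "C_k_on k N g"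
  shows "C_k_on k N (\<lambda>x. B (f x) (g x))"
  using assms(3,4)
proof (induction k arbitrary: f g)
  case 0
  then show ?case by (auto intro: bounded_bilinear.continuous_on[OF assms(1)])
next
  case (Suc k)
  have d: "((\<lambda>x. B (f x) (g x)) has_derivative
      (\<lambda>v. B (f x) (dird v g x) + B (dird v f x) (g x))) (at x)" if "x \<in> N" for x
    using that Suc.prems
    by (intro bounded_bilinear.FDERIV[OF assms(1)]) (auto simp flip: frechet_derivative_works)
  have "dird v (\<lambda>x. B (f x) (g x)) x = B (f x) (dird v g x) + B (dird v f x) (g x)" if "x \<in> N" for x v
    by (simp flip: frechet_derivative_at[OF d[OF that]])
  then have "C_k_on k N (dird v (\<lambda>x. B (f x) (g x))) \<longleftrightarrow>
      C_k_on k N (\<lambda>x. B (f x) (dird v g x) + B (dird v f x) (g x))" for v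
    by (intro C_k_on_cong[OF assms(2)])
  moreover have "C_k_on k N (\<lambda>x. B (f x) (dird v g x) + B (dird v f x) (g x))" for v
    using Suc.prems C_k_on_Suc_imp[OF Suc.prems(1)] C_k_on_Suc_imp[OF Suc.prems(2)]
    by (intro C_k_on_add[OF assms(2)] Suc.IH) auto
  ultimately show ?case using d by (auto simp: differentiable_def)
qed

lemma C_k_on_linear_comp:
  assumes "bounded_linear L" "open N" "C_k_on k N f"
  shows "C_k_on k N (\<lambda>x. L (f x))"
  using assms(3)
proof (induction k arbitrary: f)
  case 0
  then show ?case by (auto intro: bounded_linear.continuous_on[OF assms(1)])
next
  case (Suc k)
  have d: "((\<lambda>x. L (f x)) has_derivative (\<lambda>v. L (dird v f x))) (at x)" if "x \<in> N" for x
    using that Suc.prems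
    by (intro bounded_linear.has_derivative[OF assms(1)]) (auto simp flip: frechet_derivative_works)
  have "C_k_on k N (dird v (\<lambda>x. L (f x))) \<longleftrightarrow> C_k_on k N (\<lambda>x. L (dird v f x))" for v
    by (intro C_k_on_cong[OF assms(2)]) (simp flip: frechet_derivative_at[OF d])
  with Suc d show ?case by (auto simp: differentiable_def)
qed

lemma C_k_on_sum:
  assumes "open N" "\<And>i. i \<in> I \<Longrightarrow> C_k_on k N (f i)"
  shows "C_k_on k N (\<lambda>x. \<Sum>i\<in>I. f i x)"
  using assms(2)
proof (induction I rule: infinite_finite_induct)
  case (insert i I)
  then show ?case by (simp add: C_k_on_add[OF assms(1)])
qed (simp_all add: C_k_on_const)

text \<open>By the chain rule \<open>g\<close> is differentiated in the direction
  \<open>dird v f x\<close>, which varies with x, whereas \<open>C_k_on\<close> controls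
  \<open>g\<close> along fixed directions. Expanding this direction in \<open>Basis\<close> leaves
  fixed directions with C^k coefficients, which is why the intermediate space is Euclidean.\<close>

lemma C_k_on_compose:
  fixes f :: "'a::real_normed_vector \<Rightarrow> 'b::euclidean_space"
  assumes "open N" "open N'" "C_k_on k N f" "C_k_on k N' g" "f ` N \<subseteq> N'"
  shows "C_k_on k N (\<lambda>x. g (f x))"
  using assms(3,4)
proof (induction k arbitrary: g)
  case 0
  then show ?case using assms(5) continuous_on_compose2 by auto
next
  case (Suc k)
  have fN: "f x \<in> N'" if "x \<in> N" for x using assms(5) that by blast
  have d: "((\<lambda>x. g (f x)) has_derivative (\<lambda>v. frechet_derivative g (at (f x)) (dird v f x))) (at x)"
    if "x \<in> N" for x
    using that Suc.prems fN
    by (intro has_derivative_compose[of f _ x UNIV g] iffD1[OF frechet_derivative_works]) auto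
  have "dird v (\<lambda>x. g (f x)) x = (\<Sum>b\<in>Basis. (dird v f x \<bullet> b) *\<^sub>R dird b g (f x))" if "x \<in> N" for x v
  proof -
    have l: "linear (frechet_derivative g (at (f x)))"
      using Suc.prems fN that by (simp add: linear_frechet_derivative)
    have "dird v (\<lambda>x. g (f x)) x = frechet_derivative g (at (f x)) (dird v f x)"
      by (simp flip: frechet_derivative_at[OF d[OF that]])
    also have "\<dots> = (\<Sum>b\<in>Basis. (dird v f x \<bullet> b) *\<^sub>R dird b g (f x))"
      by (subst euclidean_representation[symmetric, of "dird v f x"])
         (simp only: linear_sum[OF l] linear_scale[OF l])
    finally show ?thesis .
  qed
  then have "C_k_on k N (dird v (\<lambda>x. g (f x))) \<longleftrightarrow>
      C_k_on k N (\<lambda>x. \<Sum>b\<in>Basis. (dird v f x \<bullet> b) *\<^sub>R dird b g (f x))" for v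
    by (intro C_k_on_cong[OF assms(1)])
  moreover have "C_k_on k N (\<lambda>x. \<Sum>b\<in>Basis. (dird v f x \<bullet> b) *\<^sub>R dird b g (f x))" for v
  proof (intro C_k_on_sum[OF assms(1)] C_k_on_bounded_bilinear[OF bounded_bilinear_scaleR assms(1)])
    fix b :: 'b
    show "C_k_on k N (\<lambda>x. dird v f x \<bullet> b)"
      using Suc.prems by (intro C_k_on_linear_comp[OF bounded_linear_inner_left assms(1)]) auto
    show "C_k_on k N (\<lambda>x. dird b g (f x))"
      using Suc.prems C_k_on_Suc_imp by (intro Suc.IH) auto
  qed
  ultimately show ?case using d by (auto simp: differentiable_def)
qed

definition C_inf_on :: "'a::real_normed_vector set \<Rightarrow> ('a \<Rightarrow> 'b::real_normed_vector) \<Rightarrow> bool" where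
  "C_inf_on N f \<longleftrightarrow> (\<forall>k. C_k_on k N f)"

lemma C_inf_on_differentiable: "C_inf_on N f \<Longrightarrow> x \<in> N \<Longrightarrow> f differentiable (at x)"
  unfolding C_inf_on_def by (metis C_k_on.simps(2))

lemma C_inf_on_has_derivative:
  "C_inf_on N f \<Longrightarrow> x \<in> N \<Longrightarrow> (f has_derivative frechet_derivative f (at x)) (at x)"
  using C_inf_on_differentiable frechet_derivative_works by blast

lemma C_inf_on_dird: "C_inf_on N f \<Longrightarrow> C_inf_on N (dird v f)"
  unfolding C_inf_on_def by (metis C_k_on.simps(2))

lemma C_inf_on_continuous: "C_inf_on N f \<Longrightarrow> continuous_on N f"
  unfolding C_inf_on_def by (metis C_k_on.simps(1))

lemma C_inf_on_cong:
  "open N \<Longrightarrow> (\<And>y. y \<in> N \<Longrightarrow> f y = g y) \<Longrightarrow> C_inf_on N f \<longleftrightarrow> C_inf_on N g"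
  unfolding C_inf_on_def using C_k_on_cong by metis

lemma C_inf_on_subset: "C_inf_on N f \<Longrightarrow> N' \<subseteq> N \<Longrightarrow> C_inf_on N' f"
  unfolding C_inf_on_def using C_k_on_subset by metis

lemma C_inf_on_bounded_linear: "bounded_linear f \<Longrightarrow> C_inf_on N f"
  by (simp add: C_inf_on_def C_k_on_bounded_linear)

lemma C_inf_on_const: "C_inf_on N (\<lambda>x. c)"
  by (simp add: C_inf_on_def C_k_on_const)

lemma C_inf_on_add:
  "open N \<Longrightarrow> C_inf_on N f \<Longrightarrow> C_inf_on N g \<Longrightarrow> C_inf_on N (\<lambda>x. f x + g x)"
  by (simp add: C_inf_on_def C_k_on_add)

lemma C_inf_on_bounded_bilinear:
  "bounded_bilinear B \<Longrightarrow> open N \<Longrightarrow> C_inf_on N f \<Longrightarrow> C_inf_on N g \<Longrightarrow> C_inf_on N (\<lambda>x. B (f x) (g x))"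
  by (simp add: C_inf_on_def C_k_on_bounded_bilinear)

lemma C_inf_on_compose:
  fixes f :: "'a::real_normed_vector \<Rightarrow> 'b::euclidean_space"
  shows "open N \<Longrightarrow> open N' \<Longrightarrow> C_inf_on N f \<Longrightarrow> C_inf_on N' g \<Longrightarrow> f ` N \<subseteq> N' \<Longrightarrow> C_inf_on N (\<lambda>x. g (f x))"
  by (simp add: C_inf_on_def C_k_on_compose)

lemma C_inf_on_local:
  assumes "\<And>x. x \<in> S \<Longrightarrow> \<exists>N. open N \<and> x \<in> N \<and> C_inf_on N f"
  shows "C_inf_on S f"
proof -
  have "C_k_on k S f" if "\<And>x. x \<in> S \<Longrightarrow> \<exists>N. open N \<and> x \<in> N \<and> C_k_on k N f" for k
    using that
  proof (induction k arbitrary: f)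
    case 0
    then have "\<And>x. x \<in> S \<Longrightarrow> \<exists>N. open N \<and> x \<in> N \<and> continuous_on N f" by simp
    then have "continuous (at x) f" if "x \<in> S" for x
      using that continuous_on_eq_continuous_at by blast
    then show ?case by (simp add: continuous_at_imp_continuous_on)
  next
    case (Suc k)
    then show ?case by simp (metis Suc.IH)
  qed
  then show ?thesis using assms unfolding C_inf_on_def by blast
qed

lemma has_vector_derivative_line:
  assumes "f differentiable (at (w + s *\<^sub>R u))"
  shows "((\<lambda>s. f (w + s *\<^sub>R u)) has_vector_derivative dird u f (w + s *\<^sub>R u)) (at s)"
proof -
  have "((\<lambda>s. w + s *\<^sub>R u) has_derivative (\<lambda>s. s *\<^sub>R u)) (at s)"
    by (auto intro!: derivative_eq_intros)
  then have "((\<lambda>s. f (w + s *\<^sub>R u)) has_derivative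
      (\<lambda>t. frechet_derivative f (at (w + s *\<^sub>R u)) (t *\<^sub>R u))) (at s)"
    by (rule has_derivative_compose) (use assms frechet_derivative_works in auto)
  then show ?thesis
    by (simp add: has_vector_derivative_def linear_scale[OF linear_frechet_derivative[OF assms]])
qed

section \<open>Linear systems with smooth coefficients\<close>

lemma linear_family_bounded_below:
  fixes a :: "'a::real_normed_vector \<Rightarrow> 'e::euclidean_space \<Rightarrow> 'e"
  assumes "open N" "\<And>y. y \<in> N \<Longrightarrow> linear (a y)" "\<And>y. y \<in> N \<Longrightarrow> inj (a y)"
    "\<And>v. continuous_on N (\<lambda>y. a y v)" "y0 \<in> N"
  obtains m where "m > 0" "eventually (\<lambda>y. y \<in> N \<and> (\<forall>z. norm z \<le> m * norm (a y z))) (at y0)"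
proof -
  obtain m where m: "m > 0" "\<And>z. m * norm z \<le> norm (a y0 z)"
    using linear_inj_bounded_below_pos assms by metis
  have "((\<lambda>y. \<Sum>b\<in>Basis. norm (a y b - a y0 b)) \<longlongrightarrow> (\<Sum>b\<in>(Basis::'e set). norm (a y0 b - a y0 b))) (at y0)"
    using assms(1,4,5) by (intro tendsto_intros) (simp add: continuous_on_eq_continuous_at isCont_def)
  \<comment> \<open>The perturbation may consume half of the lower bound \<open>m\<close>; the
    remaining half yields the constant \<open>2 / m\<close>.\<close>
  then have "eventually (\<lambda>y. (\<Sum>b\<in>Basis. norm (a y b - a y0 b)) < m / 2) (at y0)"
    by (rule order_tendstoD) (use m in auto)
  moreover have "eventually (\<lambda>y. y \<in> N) (at y0)"
    using assms(1,5) by (simp add: eventually_at_in_open')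
  ultimately have "eventually (\<lambda>y. y \<in> N \<and> (\<forall>z. norm z \<le> (2 / m) * norm (a y z))) (at y0)"
  proof eventually_elim
    case (elim y)
    have "norm z \<le> (2 / m) * norm (a y z)" for z
    proof -
      have *: "a y' z = (\<Sum>b\<in>Basis. (z \<bullet> b) *\<^sub>R a y' b)" if "y' \<in> N" for y'
        using assms(2)[OF that] by (subst euclidean_representation[symmetric, of z])
          (simp only: linear_sum linear_scale)
      have "a y z - a y0 z = (\<Sum>b\<in>Basis. (z \<bullet> b) *\<^sub>R (a y b - a y0 b))"
        using elim assms(5) by (simp add: * scaleR_diff_right sum_subtractf)
      also have "norm \<dots> \<le> (\<Sum>b\<in>Basis. norm z * norm (a y b - a y0 b))"
        by (intro sum_norm_le) (simp add: Basis_le_norm mult_right_mono)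
      also have "\<dots> \<le> norm z * (m / 2)"
        using elim mult_left_mono[of _ "m / 2" "norm z"] by (simp flip: sum_distrib_left)
      finally have "norm (a y0 z) \<le> norm (a y z) + norm z * (m / 2)"
        by (smt (verit) norm_minus_commute norm_triangle_sub)
      then show ?thesis using m(2)[of z] m(1) by (simp add: field_simps)
    qed
    then show ?case using elim by blast
  qed
  then show ?thesis using that[of "2 / m"] m(1) by simp
qed

text \<open>Serves to make inverse functions smooth without differentiating the inversion of linear
  maps. A directional derivative of \<open>u\<close> solves a system with the same coefficients
  \<open>a\<close>, whose right-hand side is built from \<open>u\<close> and derivatives of
  \<open>a\<close> and \<open>c\<close>, so induction on k applies to it.\<close>

lemma C_k_on_linear_solve:
  fixes a :: "'a::real_normed_vector \<Rightarrow> 'e::euclidean_space \<Rightarrow> 'e"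
  assumes "open N" and lin: "\<And>y. y \<in> N \<Longrightarrow> linear (a y)" and inj: "\<And>y. y \<in> N \<Longrightarrow> inj (a y)"
    and "\<And>v. C_k_on k N (\<lambda>y. a y v)" "C_k_on k N c" "\<And>y. y \<in> N \<Longrightarrow> a y (u y) = c y"
  shows "C_k_on k N u"
  using assms(4-)
proof (induction k arbitrary: u c)
  case 0
  have "(u \<longlongrightarrow> u y0) (at y0)" if y0: "y0 \<in> N" for y0
  proof -
    obtain m where m: "m > 0" "eventually (\<lambda>y. y \<in> N \<and> (\<forall>z. norm z \<le> m * norm (a y z))) (at y0)"
      using linear_family_bounded_below[of N a y0] assms(1) lin inj 0 y0 by auto
    have "isCont c y0" "isCont (\<lambda>y. a y (u y0)) y0"
      using 0 y0 assms(1) by (auto simp: continuous_on_eq_continuous_at)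
    then have "((\<lambda>y. m * norm (c y - a y (u y0))) \<longlongrightarrow> m * norm (c y0 - a y0 (u y0))) (at y0)"
      by (intro tendsto_intros) (auto simp: isCont_def)
    then have "((\<lambda>y. m * norm (c y - a y (u y0))) \<longlongrightarrow> 0) (at y0)"
      using 0 y0 by simp
    \<comment> \<open>The image of \<open>u y - u y0\<close> under \<open>a y\<close> is
      \<open>c y - a y (u y0)\<close>, which tends to 0.\<close>
    moreover have "eventually (\<lambda>y. norm (u y - u y0) \<le> m * norm (c y - a y (u y0))) (at y0)"
      using m(2)
    proof eventually_elim
      case (elim y)
      then show ?case using "0.prems"(3)[of y] linear_diff[OF lin, of y "u y" "u y0"] by metis
    qed
    ultimately have "((\<lambda>y. u y - u y0) \<longlongrightarrow> 0) (at y0)"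
      by (rule Lim_null_comparison[rotated])
    then show ?thesis using LIM_zero_cancel by blast
  qed
  then show ?case by (simp add: continuous_on_eq_continuous_at assms(1) isCont_def)
next
  case (Suc k)
  have ak: "C_k_on k N (\<lambda>y. a y v)" for v using Suc.prems(1) C_k_on_Suc_imp by blast
  \<comment> \<open>The system solved by \<open>dird v u\<close> has \<open>u\<close> itself on its
    right-hand side, so \<open>u\<close> must be known to be C^k beforehand.\<close>
  have uk: "C_k_on k N u"
    using Suc.IH[OF ak C_k_on_Suc_imp[OF Suc.prems(2)] Suc.prems(3)] .
  have acont: "continuous_on N (\<lambda>y. a y v)" for v
    using Suc.prems(1) C_k_on_Suc_imp
    by (auto simp: continuous_on_eq_continuous_within
        intro: differentiable_imp_continuous_within differentiable_at_withinI)
  \<comment> \<open>The product rule applied to \<open>a y (u y) = c y\<close> gives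
    \<open>a y0 (u' w) = c' w - (a' w) (u y0)\<close>. The candidate is this equation solved for
    \<open>u' w\<close>.\<close>
  have d: "(u has_derivative (\<lambda>w. inv (a y0) (dird w c y0 - dird w (\<lambda>y. a y (u y0)) y0))) (at y0)"
    (is "(u has_derivative ?D) _") if y0: "y0 \<in> N" for y0
  proof -
    have surj: "a y0 (inv (a y0) z) = z" for z
      using lin[OF y0] inj[OF y0] by (simp add: linear_injective_imp_surjective surj_f_inv_f)
    \<comment> \<open>On \<open>N\<close> one has \<open>r y = a y (u y - u y0)\<close>, so a
      remainder estimate for \<open>r\<close> turns into one for \<open>u\<close> by the lower bound
      on \<open>a y\<close>.\<close>
    define r where "r = (\<lambda>y. c y - a y (u y0))"
    define r' where "r' = (\<lambda>w. dird w c y0 - dird w (\<lambda>y. a y (u y0)) y0)"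
    have dr: "(r has_derivative r') (at y0)"
      unfolding r_def r'_def using Suc.prems y0
      by (intro Deriv.has_derivative_diff iffD1[OF frechet_derivative_works]) simp_all
    then have lr: "bounded_linear r'" by (rule has_derivative_bounded_linear)
    have blD: "bounded_linear ?D"
      using bounded_linear_compose[OF inj_linear_imp_inv_bounded_linear lr, of "a y0"] lin[OF y0] inj[OF y0]
      by (simp add: r'_def linear_conv_bounded_linear)
    then obtain K where K: "\<And>w. norm (?D w) \<le> norm w * K" "K > 0"
      using bounded_linear.pos_bounded by blast
    obtain m where m: "m > 0" "eventually (\<lambda>y. y \<in> N \<and> (\<forall>z. norm z \<le> m * norm (a y z))) (at y0)"
      using linear_family_bounded_below[OF assms(1) lin inj acont y0] by blast
    \<comment> \<open>The first summand is the remainder of \<open>r\<close>; the second one pays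
      for replacing \<open>a y0\<close> by \<open>a y\<close> in front of the candidate
      derivative.\<close>
    let ?e = "\<lambda>y. m * (norm (r y - r y0 - r' (y - y0)) / norm (y - y0)
                + K * (\<Sum>b\<in>Basis. norm (a y b - a y0 b)))"
    have "((\<lambda>y. norm (r y - r y0 - r' (y - y0)) / norm (y - y0)) \<longlongrightarrow> 0) (at y0)"
      using dr by (simp add: has_derivative_iff_norm)
    moreover have "((\<lambda>y. a y b) \<longlongrightarrow> a y0 b) (at y0)" for b
      using acont[of b] assms(1) y0 by (simp add: continuous_on_eq_continuous_at isCont_def)
    ultimately have "(?e \<longlongrightarrow> m * (0 + K * (\<Sum>b\<in>(Basis::'e set). norm (a y0 b - a y0 b)))) (at y0)"
      by (intro tendsto_intros)
    then have lim: "(?e \<longlongrightarrow> 0) (at y0)" by simp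
    have "eventually (\<lambda>y. norm (u y - u y0 - ?D (y - y0)) / norm (y - y0) \<le> ?e y) (at y0)"
      using m(2) eventually_neq_at_within[of y0]
    proof eventually_elim
      case (elim y)
      have y: "y \<in> N" using elim by simp
      let ?w = "y - y0"
      have rep: "a y' (?D ?w) = (\<Sum>b\<in>Basis. (?D ?w \<bullet> b) *\<^sub>R a y' b)" if "y' \<in> N" for y'
        using lin[OF that] by (subst euclidean_representation[symmetric, of "?D ?w"])
          (simp only: linear_sum linear_scale)
      have "a y0 (?D ?w) = r' ?w" unfolding r'_def by (rule surj)
      then have "a y (?D ?w) - r' ?w = (\<Sum>b\<in>Basis. (?D ?w \<bullet> b) *\<^sub>R (a y b - a y0 b))"
        using rep[OF y] rep[OF y0] by (simp add: scaleR_diff_right sum_subtractf)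
      also have "norm \<dots> \<le> (\<Sum>b\<in>Basis. (norm ?w * K) * norm (a y b - a y0 b))"
        using K(1)[of ?w]
        by (intro sum_norm_le) (auto intro!: mult_right_mono order_trans[OF Basis_le_norm])
      finally have 1: "norm (a y (?D ?w) - r' ?w) \<le> norm ?w * (K * (\<Sum>b\<in>Basis. norm (a y b - a y0 b)))"
        by (simp add: sum_distrib_left mult.assoc)
      have "a y (u y - u y0 - ?D ?w) = (r y - r y0 - r' ?w) - (a y (?D ?w) - r' ?w)"
        using Suc.prems(3)[OF y] Suc.prems(3)[OF y0] by (simp add: r_def linear_diff[OF lin[OF y]])
      then have "norm (a y (u y - u y0 - ?D ?w)) \<le> norm (r y - r y0 - r' ?w) + norm (a y (?D ?w) - r' ?w)"
        by (metis norm_triangle_ineq4)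
      with 1 have "norm (a y (u y - u y0 - ?D ?w)) \<le>
          norm ?w * (norm (r y - r y0 - r' ?w) / norm ?w + K * (\<Sum>b\<in>Basis. norm (a y b - a y0 b)))"
        using elim(2) by (simp add: distrib_left)
      then have "m * norm (a y (u y - u y0 - ?D ?w)) \<le> norm ?w * ?e y"
        using m(1) by (simp add: mult.left_commute)
      moreover have "norm (u y - u y0 - ?D ?w) \<le> m * norm (a y (u y - u y0 - ?D ?w))"
        using elim(1) by blast
      ultimately have "norm (u y - u y0 - ?D ?w) \<le> norm ?w * ?e y" by linarith
      then show ?case using elim(2) by (subst pos_divide_le_eq) (simp_all add: mult.commute)
    qed
    then have "((\<lambda>y. norm (u y - u y0 - ?D (y - y0)) / norm (y - y0)) \<longlongrightarrow> 0) (at y0)"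
      by (intro Lim_null_comparison[OF _ lim]) simp
    then show ?thesis using blD by (simp add: has_derivative_iff_norm)
  qed
  have "C_k_on k N (dird v u)" for v
  proof (rule Suc.IH[OF ak])
    show "C_k_on k N (\<lambda>y. dird v c y - (\<Sum>b\<in>Basis. (u y \<bullet> b) *\<^sub>R dird v (\<lambda>y. a y b) y))"
    proof -
      have "C_k_on k N (\<lambda>y. u y \<bullet> b)" for b
        by (rule C_k_on_linear_comp[OF bounded_linear_inner_left assms(1) uk])
      then have "C_k_on k N (\<lambda>y. \<Sum>b\<in>Basis. (u y \<bullet> b) *\<^sub>R dird v (\<lambda>y. a y b) y)"
        using Suc.prems
        by (intro C_k_on_sum[OF assms(1)] C_k_on_bounded_bilinear[OF bounded_bilinear_scaleR assms(1)]) auto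
      from C_k_on_add[OF assms(1) _ C_k_on_linear_comp[OF bounded_linear_minus[OF bounded_linear_ident] assms(1) this]]
      show ?thesis using Suc.prems(2) by simp
    qed
    show "a y (dird v u y) = dird v c y - (\<Sum>b\<in>Basis. (u y \<bullet> b) *\<^sub>R dird v (\<lambda>y. a y b) y)" if y: "y \<in> N" for y
    proof -
      have "dird v u y = inv (a y) (dird v c y - dird v (\<lambda>z. a z (u y)) y)"
        by (simp flip: frechet_derivative_at[OF d[OF y]])
      then have "a y (dird v u y) = dird v c y - dird v (\<lambda>z. a z (u y)) y"
        using lin[OF y] inj[OF y] by (simp add: linear_injective_imp_surjective surj_f_inv_f)
      moreover have "dird v (\<lambda>z. a z (u y)) y = (\<Sum>b\<in>Basis. (u y \<bullet> b) *\<^sub>R dird v (\<lambda>z. a z b) y)"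
      proof -
        have "a z (u y) = (\<Sum>b\<in>Basis. (u y \<bullet> b) *\<^sub>R a z b)" if "z \<in> N" for z
          using lin[OF that] by (subst euclidean_representation[symmetric, of "u y"])
            (simp only: linear_sum linear_scale)
        then have "frechet_derivative (\<lambda>z. a z (u y)) (at y)
            = frechet_derivative (\<lambda>z. \<Sum>b\<in>Basis. (u y \<bullet> b) *\<^sub>R a z b) (at y)"
          by (rule frechet_derivative_cong_open[OF assms(1) y])
        moreover have "((\<lambda>z. \<Sum>b\<in>Basis. (u y \<bullet> b) *\<^sub>R a z b) has_derivative
            (\<lambda>w. \<Sum>b\<in>Basis. (u y \<bullet> b) *\<^sub>R dird w (\<lambda>z. a z b) y)) (at y)"
          using Suc.prems(1) y
          by (intro has_derivative_sum has_derivative_scaleR_right iffD1[OF frechet_derivative_works]) auto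
        ultimately show ?thesis by (simp flip: frechet_derivative_at)
      qed
      ultimately show ?thesis by simp
    qed
  qed
  with d show ?case by (auto simp: differentiable_def)
qed

section \<open>Symmetry of second derivatives\<close>

lemma dird_commute_mvt:
  fixes G :: "'a::real_normed_vector \<Rightarrow> real"
  assumes "C_inf_on N G" "h > 0" "\<And>s t. 0 \<le> s \<Longrightarrow> s \<le> h \<Longrightarrow> 0 \<le> t \<Longrightarrow> t \<le> h \<Longrightarrow> x + s *\<^sub>R u + t *\<^sub>R v \<in> N"
  obtains s t where "0 < s" "s < h" "0 < t" "t < h"
    "G (x + h *\<^sub>R u + h *\<^sub>R v) - G (x + h *\<^sub>R u) - G (x + h *\<^sub>R v) + G x
      = h * h * dird v (dird u G) (x + s *\<^sub>R u + t *\<^sub>R v)"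
proof -
  have lineder: "((\<lambda>s. F (w + s *\<^sub>R z)) has_real_derivative dird z F (w + s *\<^sub>R z)) (at s)"
    if "C_inf_on N F" "w + s *\<^sub>R z \<in> N" for F :: "'a \<Rightarrow> real" and w z s
    using has_vector_derivative_line[OF C_inf_on_differentiable[OF that]]
    by (simp add: has_real_derivative_iff_has_vector_derivative)
  have "\<exists>s. 0 < s \<and> s < h \<and>
      (G ((x + h *\<^sub>R v) + h *\<^sub>R u) - G (x + h *\<^sub>R u)) - (G ((x + h *\<^sub>R v) + 0 *\<^sub>R u) - G (x + 0 *\<^sub>R u))
      = (h - 0) * (dird u G ((x + h *\<^sub>R v) + s *\<^sub>R u) - dird u G (x + s *\<^sub>R u))"
    using assms(2,3) assms(3)[of _ 0]
    by (intro MVT2 DERIV_diff lineder[OF assms(1)]) (auto simp: algebra_simps)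
  then obtain s where s: "0 < s" "s < h"
    "G (x + h *\<^sub>R u + h *\<^sub>R v) - G (x + h *\<^sub>R u) - G (x + h *\<^sub>R v) + G x
      = h * (dird u G ((x + s *\<^sub>R u) + h *\<^sub>R v) - dird u G ((x + s *\<^sub>R u) + 0 *\<^sub>R v))"
    by (auto simp: algebra_simps)
  have "\<exists>t. 0 < t \<and> t < h \<and>
      dird u G ((x + s *\<^sub>R u) + h *\<^sub>R v) - dird u G ((x + s *\<^sub>R u) + 0 *\<^sub>R v)
      = (h - 0) * dird v (dird u G) ((x + s *\<^sub>R u) + t *\<^sub>R v)"
    using assms(2,3) s(1,2)
    by (intro MVT2 lineder[OF C_inf_on_dird[OF assms(1)]]) auto
  then show ?thesis using s that by fastforce
qed

text \<open>The second difference of \<open>G\<close> over the parallelogram with sides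
  \<open>h u\<close> and \<open>h v\<close> is symmetric in u and v. The mean value theorem, applied
  in either order, expresses it by one of the iterated derivatives at a point of the parallelogram,
  which can be shrunk to x.\<close>

lemma dird_commute:
  fixes G :: "'a::real_normed_vector \<Rightarrow> real"
  assumes "open N" "C_inf_on N G" "x \<in> N"
  shows "dird u (dird v G) x = dird v (dird u G) x"
proof (rule ccontr)
  let ?A = "dird u (dird v G)" and ?B = "dird v (dird u G)"
  assume ne: "?A x \<noteq> ?B x"
  \<comment> \<open>Two numbers closer than \<open>e\<close> to \<open>?A x\<close> and to
    \<open>?B x\<close>, respectively, cannot coincide.\<close>
  define e where "e = \<bar>?A x - ?B x\<bar> / 2"
  have e: "e > 0" using ne by (simp add: e_def)
  have ev: "eventually (\<lambda>y. \<bar>F y - F x\<bar> < e) (nhds x)" if "C_inf_on N F" for F :: "'a \<Rightarrow> real"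
  proof -
    have "isCont F x"
      using C_inf_on_continuous[OF that] assms(1,3) by (simp add: continuous_on_eq_continuous_at)
    then have "(F \<longlongrightarrow> F x) (nhds x)" by (simp add: isCont_def tendsto_at_iff_tendsto_nhds)
    then show ?thesis using e by (auto dest!: tendstoD simp: dist_real_def)
  qed
  have "eventually (\<lambda>y. y \<in> N \<and> \<bar>?A y - ?A x\<bar> < e \<and> \<bar>?B y - ?B x\<bar> < e) (nhds x)"
    using assms by (intro eventually_conj ev C_inf_on_dird eventually_nhds_in_open)
  then obtain r where r: "r > 0"
    "\<And>y. dist y x < r \<Longrightarrow> y \<in> N \<and> \<bar>?A y - ?A x\<bar> < e \<and> \<bar>?B y - ?B x\<bar> < e"
    unfolding eventually_nhds_metric by blast
  \<comment> \<open>The parallelogram stays within \<open>r / 2\<close> of x. The summand 1 keeps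
    the denominator positive when u and v vanish.\<close>
  define h where "h = r / (2 * (norm u + norm v + 1))"
  have h: "h > 0" using r(1) by (simp add: h_def add_nonneg_pos)
  have near: "dist (x + s *\<^sub>R u + t *\<^sub>R v) x < r" if "0 \<le> s" "s \<le> h" "0 \<le> t" "t \<le> h" for s t
  proof -
    have "dist (x + s *\<^sub>R u + t *\<^sub>R v) x \<le> s * norm u + t * norm v"
      using that norm_triangle_ineq[of "s *\<^sub>R u" "t *\<^sub>R v"] by (simp add: dist_norm add.assoc)
    also have "\<dots> \<le> h * norm u + h * norm v" using that by (intro add_mono mult_right_mono) auto
    also have "\<dots> \<le> h * (norm u + norm v + 1)" using h by (simp add: algebra_simps)
    also have "\<dots> = r / 2"
    proof -
      have "norm u + norm v + 1 > 0" by (smt (verit) norm_ge_zero)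
      then show ?thesis unfolding h_def by (simp add: divide_simps)
    qed
    finally show ?thesis using r(1) by simp
  qed
  obtain s t where st: "0 < s" "s < h" "0 < t" "t < h"
    "G (x + h *\<^sub>R u + h *\<^sub>R v) - G (x + h *\<^sub>R u) - G (x + h *\<^sub>R v) + G x = h * h * ?B (x + s *\<^sub>R u + t *\<^sub>R v)"
    using dird_commute_mvt[OF assms(2) h, of x u v] near r(2) by blast
  have near': "x + s *\<^sub>R v + t *\<^sub>R u \<in> N" if "0 \<le> s" "s \<le> h" "0 \<le> t" "t \<le> h" for s t
    using near[OF that(3,4,1,2)] r(2) by (simp add: algebra_simps)
  obtain s' t' where st': "0 < s'" "s' < h" "0 < t'" "t' < h"
    "G (x + h *\<^sub>R v + h *\<^sub>R u) - G (x + h *\<^sub>R v) - G (x + h *\<^sub>R u) + G x = h * h * ?A (x + s' *\<^sub>R v + t' *\<^sub>R u)"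
    using dird_commute_mvt[OF assms(2) h, of x v u] near' by blast
  have "h * h * ?A (x + t' *\<^sub>R u + s' *\<^sub>R v) = h * h * ?B (x + s *\<^sub>R u + t *\<^sub>R v)"
    using st(5) st'(5) by (auto simp: algebra_simps)
  then have "?A (x + t' *\<^sub>R u + s' *\<^sub>R v) = ?B (x + s *\<^sub>R u + t *\<^sub>R v)" using h by simp
  moreover have "\<bar>?A (x + t' *\<^sub>R u + s' *\<^sub>R v) - ?A x\<bar> < e" "\<bar>?B (x + s *\<^sub>R u + t *\<^sub>R v) - ?B x\<bar> < e"
    using r(2) near st st' by auto
  moreover have False if "p = q" "\<bar>p - a\<bar> < \<bar>a - b\<bar> / 2" "\<bar>q - b\<bar> < \<bar>a - b\<bar> / 2" for p q a b :: real
    using that by (simp add: abs_if split: if_splits)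
  ultimately show False unfolding e_def by blast
qed

text \<open>Bootstrapping: if \<open>g\<close> is C^k, so are the coefficients
  \<open>frechet_derivative f (at (g y))\<close>. The derivative \<open>dird v g y\<close> solves
  the linear system with these coefficients and constant right-hand side v, hence it is C^k as well,
  and \<open>g\<close> is C^(k+1).\<close>

lemma C_inf_inverse_function:
  fixes f :: "'e::euclidean_space \<Rightarrow> 'e"
  assumes "open U" "C_inf_on U f" "x0 \<in> U" "inj (frechet_derivative f (at x0))"
  obtains U' V g where "open U'" "U' \<subseteq> U" "x0 \<in> U'" "open V" "homeomorphism U' V f g" "C_inf_on V g"
proof -
  define f' where "f' = (\<lambda>x. Blinfun (frechet_derivative f (at x)))"
  have bl: "bounded_linear (frechet_derivative f (at x))" if "x \<in> U" for x
    using C_inf_on_has_derivative[OF assms(2) that] has_derivative_bounded_linear by blast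
  have f'[simp]: "blinfun_apply (f' x) = frechet_derivative f (at x)" if "x \<in> U" for x
    using bl[OF that] by (simp add: f'_def bounded_linear_Blinfun_apply)
  have cont: "continuous_on U f'"
  proof (rule continuous_on_blinfun_componentwise)
    fix i :: 'e
    have "continuous_on U (dird i f)" using C_inf_on_continuous C_inf_on_dird assms(2) by blast
    then show "continuous_on U (\<lambda>x. blinfun_apply (f' x) i)"
      by (rule continuous_on_eq) simp
  qed
  let ?D = "frechet_derivative f (at x0)"
  have "bounded_linear (inv ?D)"
    using assms(3,4) bl inj_linear_imp_inv_bounded_linear by blast
  then have inv: "Blinfun (inv ?D) o\<^sub>L f' x0 = id_blinfun"
    using assms(3,4) by (intro blinfun_eqI) (simp add: bounded_linear_Blinfun_apply)
  have der: "(f has_derivative blinfun_apply (f' x)) (at x)" if "x \<in> U" for x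
    using C_inf_on_has_derivative[OF assms(2) that] that by simp
  obtain U' V g g' where UV: "open U'" "U' \<subseteq> U" "x0 \<in> U'" "open V" "f x0 \<in> V"
    "homeomorphism U' V f g" "\<And>y. y \<in> V \<Longrightarrow> (g has_derivative (g' y)) (at y)"
    "\<And>y. y \<in> V \<Longrightarrow> g' y = inv (blinfun_apply (f' (g y)))"
    "\<And>y. y \<in> V \<Longrightarrow> bij (blinfun_apply (f' (g y)))"
    by (rule inverse_function_theorem[OF assms(1) der cont assms(3) inv]) (assumption, rule that)
  have gU: "g y \<in> U" if "y \<in> V" for y using UV(2,6) that by (auto simp: homeomorphism_def)
  have "C_k_on k V g" for k
  proof (induction k)
    case 0
    then show ?case using UV(6) by (simp add: homeomorphism_def)
  next
    case (Suc k)
    have "C_k_on k V (dird v g)" for v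
    proof (rule C_k_on_linear_solve[OF UV(4)])
      fix y assume y: "y \<in> V"
      show "linear (frechet_derivative f (at (g y)))" using bl[OF gU[OF y]] bounded_linear.linear by blast
      show "inj (frechet_derivative f (at (g y)))" using UV(9)[OF y] gU[OF y] by (simp add: bij_is_inj)
      have "dird v g y = inv (frechet_derivative f (at (g y))) v"
        using frechet_derivative_at[OF UV(7)[OF y]] UV(8)[OF y] gU[OF y] by simp
      then show "frechet_derivative f (at (g y)) (dird v g y) = v"
        using UV(9)[OF y] gU[OF y] by (simp add: bij_is_surj surj_f_inv_f)
    next
      show "C_k_on k V (\<lambda>y. frechet_derivative f (at (g y)) v)" for v
        using C_inf_on_dird[OF assms(2), of v] gU
        by (intro C_k_on_compose[OF UV(4) assms(1) Suc]) (auto simp: C_inf_on_def)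
    qed (rule C_k_on_const)
    then show ?case using UV(7) by (auto simp: differentiable_def)
  qed
  then show ?thesis using that[OF UV(1-4,6)] by (simp add: C_inf_on_def)
qed

section \<open>Smoothness on arbitrary sets by local extension\<close>

lemma smooth_on_iff:
  "smooth_on S f \<longleftrightarrow> (\<forall>x\<in>S. \<exists>N g. open N \<and> x \<in> N \<and> C_inf_on N g \<and> (\<forall>y\<in>N \<inter> S. g y = f y))"
  unfolding smooth_on_def C_inf_on_def ..

lemma smooth_on_cong: "smooth_on S f \<Longrightarrow> (\<And>x. x \<in> S \<Longrightarrow> f x = g x) \<Longrightarrow> smooth_on S g"
  unfolding smooth_on_iff by (metis IntD2)

lemma smooth_on_subset:
  assumes "smooth_on S f" "S' \<subseteq> S" shows "smooth_on S' f"
  unfolding smooth_on_iff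
proof
  fix x assume "x \<in> S'"
  then obtain N g where "open N" "x \<in> N" "C_inf_on N g" "\<forall>y\<in>N \<inter> S. g y = f y"
    using assms unfolding smooth_on_iff by (meson subsetD)
  then show "\<exists>N g. open N \<and> x \<in> N \<and> C_inf_on N g \<and> (\<forall>y\<in>N \<inter> S'. g y = f y)"
    using assms(2) by (intro exI[of _ N] exI[of _ g]) auto
qed

lemma smooth_on_local:
  assumes "\<And>x. x \<in> S \<Longrightarrow> \<exists>T. open T \<and> x \<in> T \<and> smooth_on (S \<inter> T) f"
  shows "smooth_on S f"
  unfolding smooth_on_iff
proof
  fix x assume x: "x \<in> S"
  obtain T where T: "open T" "x \<in> T" "smooth_on (S \<inter> T) f" using assms[OF x] by blast
  then obtain N g where "open N" "x \<in> N" "C_inf_on N g" "\<forall>y\<in>N \<inter> (S \<inter> T). g y = f y"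
    using x unfolding smooth_on_iff by blast
  then show "\<exists>N g. open N \<and> x \<in> N \<and> C_inf_on N g \<and> (\<forall>y\<in>N \<inter> S. g y = f y)"
    using T by (intro exI[of _ "N \<inter> T"] exI[of _ g]) (auto intro: C_inf_on_subset)
qed

lemma C_inf_on_smooth_on: "open N \<Longrightarrow> C_inf_on N f \<Longrightarrow> smooth_on N f"
  unfolding smooth_on_iff by blast

lemma smooth_on_C_inf_on:
  assumes "open N" "smooth_on N f" shows "C_inf_on N f"
proof (rule C_inf_on_local)
  fix x assume "x \<in> N"
  then obtain N' g where N': "open N'" "x \<in> N'" "C_inf_on N' g" "\<forall>y\<in>N' \<inter> N. g y = f y"
    using assms(2) unfolding smooth_on_iff by blast
  have "C_inf_on (N' \<inter> N) f \<longleftrightarrow> C_inf_on (N' \<inter> N) g"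
    using N' assms by (intro C_inf_on_cong) auto
  then show "\<exists>N. open N \<and> x \<in> N \<and> C_inf_on N f"
    using N'(1,2) assms(1) \<open>x \<in> N\<close> C_inf_on_subset[OF N'(3), of "N' \<inter> N"]
    by (intro exI[of _ "N' \<inter> N"]) auto
qed

lemma smooth_on_continuous:
  assumes "smooth_on S f" shows "continuous_on S f"
proof -
  have "continuous (at x within S) f" if x: "x \<in> S" for x
  proof -
    obtain N g where N: "open N" "x \<in> N" "C_inf_on N g" "\<forall>y\<in>N \<inter> S. g y = f y"
      using assms x unfolding smooth_on_iff by blast
    have "isCont g x" using C_inf_on_continuous N continuous_on_eq_continuous_at by blast
    then have "continuous (at x within S) g" by (rule continuous_at_imp_continuous_at_within)
    moreover have "eventually (\<lambda>y. g y = f y) (at x within S)"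
      using N unfolding eventually_at_topological by blast
    moreover have "g x = f x" using N x by blast
    ultimately show ?thesis unfolding continuous_within using tendsto_cong by force
  qed
  then show ?thesis by (simp add: continuous_on_eq_continuous_within)
qed

text \<open>Only on \<open>S\<close> do the values of \<open>f\<close> lie in \<open>T\<close>; the
  extension of \<open>f\<close> may leave the domain of the extension of \<open>g\<close>, so it is
  cut down to an open preimage.\<close>

lemma smooth_on_compose:
  fixes f :: "'a::real_normed_vector \<Rightarrow> 'b::euclidean_space"
  assumes "smooth_on S f" "smooth_on T g" "f ` S \<subseteq> T"
  shows "smooth_on S (\<lambda>x. g (f x))"
  unfolding smooth_on_iff
proof
  fix x assume x: "x \<in> S"
  obtain N F where N: "open N" "x \<in> N" "C_inf_on N F" "\<forall>y\<in>N \<inter> S. F y = f y"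
    using assms(1) x unfolding smooth_on_iff by blast
  have Fx: "F x = f x" "f x \<in> T" using N x assms(3) by auto
  obtain N' G where N': "open N'" "f x \<in> N'" "C_inf_on N' G" "\<forall>y\<in>N' \<inter> T. G y = g y"
    using assms(2) Fx unfolding smooth_on_iff by blast
  have o: "open (N \<inter> F -` N')"
    by (rule continuous_open_preimage[OF C_inf_on_continuous[OF N(3)] N(1) N'(1)])
  show "\<exists>N G. open N \<and> x \<in> N \<and> C_inf_on N G \<and> (\<forall>y\<in>N \<inter> S. G y = g (f y))"
  proof (intro exI conjI)
    show "C_inf_on (N \<inter> F -` N') (\<lambda>x. G (F x))"
      by (rule C_inf_on_compose[OF o N'(1) C_inf_on_subset[OF N(3)] N'(3)]) auto
    show "x \<in> N \<inter> F -` N'" using N N' Fx by simp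
    show "\<forall>y\<in>(N \<inter> F -` N') \<inter> S. G (F y) = g (f y)"
      using N(4) N'(4) assms(3) by fastforce
  qed (rule o)
qed

lemma smooth_on_bounded_linear: "bounded_linear f \<Longrightarrow> smooth_on S f"
  unfolding smooth_on_iff using C_inf_on_bounded_linear by blast

lemma smooth_on_linear:
  fixes f :: "'a::euclidean_space \<Rightarrow> 'b::euclidean_space"
  shows "linear f \<Longrightarrow> smooth_on S f"
  by (simp add: smooth_on_bounded_linear linear_conv_bounded_linear)

lemma smooth_on_const: "smooth_on S (\<lambda>x. c)"
  unfolding smooth_on_iff using C_inf_on_const by blast

lemma smooth_on_id: "smooth_on S (\<lambda>x. x)"
  by (rule smooth_on_bounded_linear[OF bounded_linear_ident])

lemma smooth_on_bounded_bilinear: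
  assumes "bounded_bilinear B" "smooth_on S f" "smooth_on S g"
  shows "smooth_on S (\<lambda>x. B (f x) (g x))"
  unfolding smooth_on_iff
proof
  fix x assume x: "x \<in> S"
  obtain N F where N: "open N" "x \<in> N" "C_inf_on N F" "\<forall>y\<in>N \<inter> S. F y = f y"
    using assms(2) x unfolding smooth_on_iff by blast
  obtain N' G where N': "open N'" "x \<in> N'" "C_inf_on N' G" "\<forall>y\<in>N' \<inter> S. G y = g y"
    using assms(3) x unfolding smooth_on_iff by blast
  show "\<exists>N G. open N \<and> x \<in> N \<and> C_inf_on N G \<and> (\<forall>y\<in>N \<inter> S. G y = B (f y) (g y))"
    using N N'
    by (intro exI[of _ "N \<inter> N'"] exI[of _ "\<lambda>x. B (F x) (G x)"])
       (auto intro!: C_inf_on_bounded_bilinear[OF assms(1)] intro: C_inf_on_subset)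
qed

lemma smooth_on_add:
  assumes "smooth_on S f" "smooth_on S g"
  shows "smooth_on S (\<lambda>x. f x + g x)"
  unfolding smooth_on_iff
proof
  fix x assume x: "x \<in> S"
  obtain N F where N: "open N" "x \<in> N" "C_inf_on N F" "\<forall>y\<in>N \<inter> S. F y = f y"
    using assms(1) x unfolding smooth_on_iff by blast
  obtain N' G where N': "open N'" "x \<in> N'" "C_inf_on N' G" "\<forall>y\<in>N' \<inter> S. G y = g y"
    using assms(2) x unfolding smooth_on_iff by blast
  show "\<exists>N G. open N \<and> x \<in> N \<and> C_inf_on N G \<and> (\<forall>y\<in>N \<inter> S. G y = f y + g y)"
    using N N'
    by (intro exI[of _ "N \<inter> N'"] exI[of _ "\<lambda>x. F x + G x"])
       (auto intro!: C_inf_on_add intro: C_inf_on_subset)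
qed

lemmas smooth_on_scaleR = smooth_on_bounded_bilinear[OF bounded_bilinear_scaleR]
lemmas smooth_on_mult = smooth_on_bounded_bilinear[OF bounded_bilinear_mult]

lemma smooth_on_sum: "(\<And>i. i \<in> I \<Longrightarrow> smooth_on S (f i)) \<Longrightarrow> smooth_on S (\<lambda>x. \<Sum>i\<in>I. f i x)"
  by (induction I rule: infinite_finite_induct) (simp_all add: smooth_on_const smooth_on_add)

lemma smooth_on_power:
  fixes f :: "'a::real_normed_vector \<Rightarrow> 'b::real_normed_algebra_1"
  shows "smooth_on S f \<Longrightarrow> smooth_on S (\<lambda>x. f x ^ n)"
  by (induction n) (simp_all add: smooth_on_const smooth_on_mult)

lemma smooth_on_linear_comp:
  fixes f :: "'a::real_normed_vector \<Rightarrow> 'b::euclidean_space"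
  shows "bounded_linear L \<Longrightarrow> smooth_on S f \<Longrightarrow> smooth_on S (\<lambda>x. L (f x))"
  by (rule smooth_on_compose[OF _ smooth_on_bounded_linear[of L UNIV]]) auto

lemma smooth_on_Pair:
  fixes f :: "'a::real_normed_vector \<Rightarrow> 'b::euclidean_space"
    and g :: "'a \<Rightarrow> 'c::euclidean_space"
  assumes "smooth_on S f" "smooth_on S g"
  shows "smooth_on S (\<lambda>x. (f x, g x))"
proof -
  have "smooth_on S (\<lambda>x. (f x, 0) + (0, g x))"
    using smooth_on_linear_comp[OF bounded_linear_Pair[OF bounded_linear_ident bounded_linear_zero] assms(1)]
      smooth_on_linear_comp[OF bounded_linear_Pair[OF bounded_linear_zero bounded_linear_ident] assms(2)]
    by (rule smooth_on_add)
  then show ?thesis by simp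
qed

section \<open>Pointwise smoothness in charts\<close>

text \<open>Keeps those conditions of \<open>smooth_manifold\<close> that pass to arbitrary subsets
  of Euclidean spaces with the identity chart, to products and to restrictions. All of these occur
  as domains or targets below, and none of the formal rules on smooth maps looks at the shape of
  chart images.\<close>

definition smooth_space ::
  "'m::topological_space set \<Rightarrow> ('m, 'e::euclidean_space) chart set \<Rightarrow> bool" where
  "smooth_space M A \<longleftrightarrow>
     (\<forall>(U, \<phi>)\<in>A. openin (top_of_set M) U \<and> homeomorphism U (\<phi> ` U) \<phi> (inv_into U \<phi>)) \<and>
     (\<Union>(U, \<phi>)\<in>A. U) = M \<and>
     (\<forall>(U, \<phi>)\<in>A. \<forall>(V, \<psi>)\<in>A. smooth_on (\<phi> ` (U \<inter> V)) (\<psi> \<circ> inv_into U \<phi>))"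

lemma smooth_manifold_space: "smooth_manifold M A \<Longrightarrow> smooth_space M A"
  unfolding smooth_manifold_def smooth_space_def is_chart_def by blast

lemma smooth_space_chart:
  assumes "smooth_space M A" "(U, \<phi>) \<in> A"
  shows "openin (top_of_set M) U" "U \<subseteq> M" "inj_on \<phi> U" "continuous_on U \<phi>"
    "continuous_on (\<phi> ` U) (inv_into U \<phi>)"
proof -
  have *: "openin (top_of_set M) U" "homeomorphism U (\<phi> ` U) \<phi> (inv_into U \<phi>)"
    using assms unfolding smooth_space_def by auto
  show "openin (top_of_set M) U" "U \<subseteq> M" "inj_on \<phi> U" "continuous_on U \<phi>"
    "continuous_on (\<phi> ` U) (inv_into U \<phi>)"
    using * openin_imp_subset[OF *(1)] by (auto simp: homeomorphism_def intro: inj_on_inverseI)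
qed

lemma smooth_space_chart_open:
  assumes "smooth_space M A" "(U, \<phi>) \<in> A"
  obtains T where "open T" "U = M \<inter> T"
  using smooth_space_chart(1)[OF assms] by (auto simp: openin_open)

lemma smooth_space_compat:
  "smooth_space M A \<Longrightarrow> (U, \<phi>) \<in> A \<Longrightarrow> (V, \<psi>) \<in> A \<Longrightarrow>
    smooth_on (\<phi> ` (U \<inter> V)) (\<lambda>x. \<psi> (inv_into U \<phi> x))"
  unfolding smooth_space_def o_def by fast

lemma smooth_space_ex_chart:
  assumes "smooth_space M A" "p \<in> M" obtains U \<phi> where "(U, \<phi>) \<in> A" "p \<in> U"
  using assms unfolding smooth_space_def by blast

lemma chart_image_open:
  assumes "smooth_space M A" "(U, \<phi>) \<in> A" "open T"
  obtains T' where "open T'" "\<phi> ` (U \<inter> T) = \<phi> ` U \<inter> T'"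
proof -
  note c = smooth_space_chart[OF assms(1,2)]
  obtain T' where T': "open T'" "(\<phi> ` U) \<inter> inv_into U \<phi> -` T = (\<phi> ` U) \<inter> T'"
    using continuous_openin_preimage_gen[OF c(5) assms(3)] by (auto simp: openin_open)
  have "\<phi> ` (U \<inter> T) = (\<phi> ` U) \<inter> inv_into U \<phi> -` T" using c(3) by (auto simp: inv_into_f_f)
  then show ?thesis using that T' by simp
qed

text \<open>A pointwise notion with one pair of charts, so that maps can be composed and modified
  near a point. Continuity is a consequence and not a condition. The neighbourhood is cut out by an
  open set \<open>T\<close> of the ambient type, so that neighbourhoods are intersected without
  relative topologies.\<close>

definition smooth_at ::
  "'m::topological_space set \<Rightarrow> ('m, 'e::euclidean_space) chart set \<Rightarrow>
   ('n::topological_space, 'f::euclidean_space) chart set \<Rightarrow> ('m \<Rightarrow> 'n) \<Rightarrow> 'm \<Rightarrow> bool" where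
  "smooth_at M A A' F p \<longleftrightarrow>
     (\<exists>(U, \<phi>)\<in>A. \<exists>(V, \<psi>)\<in>A'. \<exists>T. open T \<and> p \<in> M \<inter> T \<and> M \<inter> T \<subseteq> U \<and> F ` (M \<inter> T) \<subseteq> V \<and>
        smooth_on (\<phi> ` (M \<inter> T)) (\<lambda>x. \<psi> (F (inv_into U \<phi> x))))"

lemma smooth_atI:
  "(U, \<phi>) \<in> A \<Longrightarrow> (V, \<psi>) \<in> A' \<Longrightarrow> open T \<Longrightarrow> p \<in> M \<inter> T \<Longrightarrow> M \<inter> T \<subseteq> U \<Longrightarrow> F ` (M \<inter> T) \<subseteq> V \<Longrightarrow>
    smooth_on (\<phi> ` (M \<inter> T)) (\<lambda>x. \<psi> (F (inv_into U \<phi> x))) \<Longrightarrow> smooth_at M A A' F p"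
  unfolding smooth_at_def by blast

lemma smooth_atE:
  assumes "smooth_at M A A' F p"
  obtains U \<phi> V \<psi> T where "(U, \<phi>) \<in> A" "(V, \<psi>) \<in> A'" "open T" "p \<in> M \<inter> T" "M \<inter> T \<subseteq> U"
    "F ` (M \<inter> T) \<subseteq> V" "smooth_on (\<phi> ` (M \<inter> T)) (\<lambda>x. \<psi> (F (inv_into U \<phi> x)))"
  using assms unfolding smooth_at_def by blast

text \<open>\<open>F\<close> is a chart, followed by the smooth coordinate expression, followed by
  an inverse chart.\<close>

lemma smooth_at_continuous_aux:
  assumes M: "smooth_space M A" and N: "smooth_space N A'"
    and "(U, \<phi>) \<in> A" "(V, \<psi>) \<in> A'" "M \<inter> T \<subseteq> U" "F ` (M \<inter> T) \<subseteq> V"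
    "smooth_on (\<phi> ` (M \<inter> T)) (\<lambda>x. \<psi> (F (inv_into U \<phi> x)))"
  shows "continuous_on (M \<inter> T) F"
proof -
  note cU = smooth_space_chart[OF M assms(3)] and cV = smooth_space_chart[OF N assms(4)]
  have "continuous_on (M \<inter> T) (\<lambda>q. inv_into V \<psi> (\<psi> (F (inv_into U \<phi> (\<phi> q)))))"
  proof (rule continuous_on_compose2[OF cV(5)])
    show "continuous_on (M \<inter> T) (\<lambda>q. \<psi> (F (inv_into U \<phi> (\<phi> q))))"
      using assms(5)
      by (intro continuous_on_compose2[OF smooth_on_continuous[OF assms(7)]] continuous_on_subset[OF cU(4)]) auto
    show "(\<lambda>q. \<psi> (F (inv_into U \<phi> (\<phi> q)))) ` (M \<inter> T) \<subseteq> \<psi> ` V"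
      using assms(5,6) cU(3) by (auto simp: subset_iff inv_into_f_f)
  qed
  moreover have "inv_into V \<psi> (\<psi> (F (inv_into U \<phi> (\<phi> q)))) = F q" if "q \<in> M \<inter> T" for q
    using that assms(5,6) cU(3) cV(3) by (auto simp: subset_iff inv_into_f_f image_subset_iff)
  ultimately show ?thesis by (rule continuous_on_eq)
qed

text \<open>The coordinate expression in the new charts is the old one between two transition maps,
  on a neighbourhood where all three are defined.\<close>

lemma smooth_at_charts:
  assumes M: "smooth_space M A" and N: "smooth_space N A'"
    and F: "smooth_at M A A' F p"
    and "(U, \<phi>) \<in> A" "(V, \<psi>) \<in> A'" "p \<in> U" "F p \<in> V"
  obtains T where "open T" "p \<in> M \<inter> T" "M \<inter> T \<subseteq> U" "F ` (M \<inter> T) \<subseteq> V"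
    "smooth_on (\<phi> ` (M \<inter> T)) (\<lambda>x. \<psi> (F (inv_into U \<phi> x)))"
proof -
  obtain U1 \<phi>1 V1 \<psi>1 T1 where 1: "(U1, \<phi>1) \<in> A" "(V1, \<psi>1) \<in> A'" "open T1" "p \<in> M \<inter> T1" "M \<inter> T1 \<subseteq> U1"
    "F ` (M \<inter> T1) \<subseteq> V1" "smooth_on (\<phi>1 ` (M \<inter> T1)) (\<lambda>x. \<psi>1 (F (inv_into U1 \<phi>1 x)))"
    using smooth_atE[OF F] by metis
  note c = smooth_space_chart(3)[OF M assms(4)] smooth_space_chart(3)[OF N assms(5)]
    smooth_space_chart(3)[OF M 1(1)] smooth_space_chart(3)[OF N 1(2)]
  note iv = inv_into_f_f[OF c(1)] inv_into_f_f[OF c(2)] inv_into_f_f[OF c(3)] inv_into_f_f[OF c(4)]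
  have cont: "continuous_on (M \<inter> T1) F"
    using smooth_at_continuous_aux[OF M N 1(1,2,5,6,7)] .
  obtain TU where TU: "open TU" "U = M \<inter> TU" using smooth_space_chart_open[OF M assms(4)] .
  obtain TV where TV: "open TV" "V = N \<inter> TV" using smooth_space_chart_open[OF N assms(5)] .
  have V1N: "V1 \<subseteq> N" using smooth_space_chart[OF N 1(2)] by simp
  obtain T2 where T2: "open T2" "(M \<inter> T1) \<inter> F -` TV = (M \<inter> T1) \<inter> T2"
    using continuous_openin_preimage_gen[OF cont TV(1)] by (auto simp: openin_open)
  \<comment> \<open>\<open>T1\<close> is the domain of the given expression, \<open>T2\<close> makes
    \<open>F\<close> land in \<open>V\<close>, and \<open>TU\<close> keeps the argument in
    \<open>U\<close>.\<close>
  let ?T = "T1 \<inter> T2 \<inter> TU"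
  have FV: "F q \<in> V" if "q \<in> M \<inter> ?T" for q using that T2(2) 1(6) V1N TV(2) by blast
  have sub: "M \<inter> ?T \<subseteq> U" using TU by blast
  show ?thesis
  proof
    show "open ?T" using 1(3) T2 TU by auto
    show "p \<in> M \<inter> ?T" using 1 T2 TU assms(6,7) TV by blast
    show "M \<inter> ?T \<subseteq> U" "F ` (M \<inter> ?T) \<subseteq> V" using sub FV by auto
    have "smooth_on (\<phi> ` (M \<inter> ?T)) (\<lambda>x. \<phi>1 (inv_into U \<phi> x))"
      using 1(5) TU(2) by (intro smooth_on_subset[OF smooth_space_compat[OF M assms(4) 1(1)]]) auto
    moreover have "\<phi>1 (inv_into U \<phi> x) \<in> \<phi>1 ` (M \<inter> T1)" if "x \<in> \<phi> ` (M \<inter> ?T)" for x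
      using that sub iv by auto
    ultimately have "smooth_on (\<phi> ` (M \<inter> ?T)) (\<lambda>x. \<psi>1 (F (inv_into U1 \<phi>1 (\<phi>1 (inv_into U \<phi> x)))))"
      by (intro smooth_on_compose[OF _ 1(7)]) auto
    moreover have "\<psi>1 (F (inv_into U1 \<phi>1 (\<phi>1 (inv_into U \<phi> x)))) \<in> \<psi>1 ` (V1 \<inter> V)"
      if "x \<in> \<phi> ` (M \<inter> ?T)" for x
      using that sub iv 1(5,6) FV by (auto simp: subset_iff image_subset_iff)
    ultimately have "smooth_on (\<phi> ` (M \<inter> ?T))
       (\<lambda>x. \<psi> (inv_into V1 \<psi>1 (\<psi>1 (F (inv_into U1 \<phi>1 (\<phi>1 (inv_into U \<phi> x)))))))"
      by (intro smooth_on_compose[OF _ smooth_space_compat[OF N 1(2) assms(5)]]) auto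
    then show "smooth_on (\<phi> ` (M \<inter> ?T)) (\<lambda>x. \<psi> (F (inv_into U \<phi> x)))"
      by (rule smooth_on_cong) (use sub iv 1(5,6) in \<open>auto simp: subset_iff image_subset_iff\<close>)
  qed
qed

lemma smooth_at_continuous:
  assumes "smooth_space M A" "smooth_space N A'" "smooth_at M A A' F p"
  obtains T where "open T" "p \<in> M \<inter> T" "continuous_on (M \<inter> T) F"
  using smooth_atE[OF assms(3)] smooth_at_continuous_aux[OF assms(1,2)] by metis

text \<open>The bridge between \<open>smooth_map\<close>, which asks for continuity and for all
  pairs of charts, and the pointwise calculus in which all later arguments are carried out.\<close>

lemma smooth_map_iff:
  assumes M: "smooth_space M A" and N: "smooth_space N A'"
  shows "smooth_map M A N A' F \<longleftrightarrow> F ` M \<subseteq> N \<and> (\<forall>p\<in>M. smooth_at M A A' F p)"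
proof (intro iffI conjI ballI)
  assume L: "smooth_map M A N A' F"
  then show FM: "F ` M \<subseteq> N" by (simp add: smooth_map_def)
  fix p assume p: "p \<in> M"
  obtain U \<phi> where U: "(U, \<phi>) \<in> A" "p \<in> U" using smooth_space_ex_chart[OF M p] .
  obtain V \<psi> where V: "(V, \<psi>) \<in> A'" "F p \<in> V" using smooth_space_ex_chart[OF N] FM p by blast
  obtain TU where TU: "open TU" "U = M \<inter> TU" using smooth_space_chart_open[OF M U(1)] .
  obtain TV where TV: "open TV" "V = N \<inter> TV" using smooth_space_chart_open[OF N V(1)] .
  obtain T2 where T2: "open T2" "M \<inter> F -` TV = M \<inter> T2"
    using continuous_openin_preimage_gen[OF _ TV(1), of M F] L by (auto simp: openin_open smooth_map_def)
  have "smooth_on (\<phi> ` (U \<inter> F -` V)) (\<psi> \<circ> F \<circ> inv_into U \<phi>)"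
    using L U(1) V(1) unfolding smooth_map_def by blast
  moreover have "U \<inter> F -` V = M \<inter> (TU \<inter> T2)" using TU T2 TV FM by blast
  ultimately show "smooth_at M A A' F p"
    using U V TU T2 TV FM p by (intro smooth_atI[OF U(1) V(1), of "TU \<inter> T2"]) (auto simp: o_def)
next
  assume R: "F ` M \<subseteq> N \<and> (\<forall>p\<in>M. smooth_at M A A' F p)"
  show "smooth_map M A N A' F"
    unfolding smooth_map_def
  proof (intro conjI ballI)
    show "F ` M \<subseteq> N" using R by simp
    have "(F \<longlongrightarrow> F p) (at p within M)" if p: "p \<in> M" for p
    proof -
      obtain T where T: "open T" "p \<in> M \<inter> T" "continuous_on (M \<inter> T) F"
        using smooth_at_continuous[OF M N] R p by metis
      then have "(F \<longlongrightarrow> F p) (at p within M \<inter> T)" by (simp add: continuous_on_def)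
      moreover have "at p within M \<inter> T = at p within M"
        using T by (intro at_within_nhd[of p T]) auto
      ultimately show ?thesis by simp
    qed
    then show "continuous_on M F" by (simp add: continuous_on_def)
    show "case c of (U, \<phi>) \<Rightarrow> \<forall>(V, \<psi>)\<in>A'. smooth_on (\<phi> ` (U \<inter> F -` V)) (\<psi> \<circ> F \<circ> inv_into U \<phi>)"
      if "c \<in> A" for c
    proof (clarify, rename_tac U \<phi> V \<psi>)
      fix U \<phi> V \<psi> assume c: "c = (U, \<phi>)" and V: "(V, \<psi>) \<in> A'"
      then have U: "(U, \<phi>) \<in> A" using that by simp
      note cU = smooth_space_chart[OF M U]
      show "smooth_on (\<phi> ` (U \<inter> F -` V)) (\<psi> \<circ> F \<circ> inv_into U \<phi>)"
      proof (rule smooth_on_local)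
        fix x assume "x \<in> \<phi> ` (U \<inter> F -` V)"
        then obtain p where p: "p \<in> U" "F p \<in> V" "x = \<phi> p" by blast
        then have "p \<in> M" using cU by auto
        then have sm: "smooth_at M A A' F p" using R by blast
        obtain T where T: "open T" "p \<in> M \<inter> T" "M \<inter> T \<subseteq> U" "F ` (M \<inter> T) \<subseteq> V"
          "smooth_on (\<phi> ` (M \<inter> T)) (\<lambda>x. \<psi> (F (inv_into U \<phi> x)))"
          using smooth_at_charts[OF M N sm U V p(1,2)] .
        obtain T' where T': "open T'" "\<phi> ` (U \<inter> T) = \<phi> ` U \<inter> T'" using chart_image_open[OF M U T(1)] .
        have MT: "M \<inter> T = U \<inter> T" using T(3) cU(2) by blast
        have "x \<in> T'" using T'(2) p T(2) MT by blast
        moreover have "smooth_on (\<phi> ` (U \<inter> F -` V) \<inter> T') (\<psi> \<circ> F \<circ> inv_into U \<phi>)"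
          unfolding o_def using T'(2) MT by (intro smooth_on_subset[OF T(5)]) auto
        ultimately show "\<exists>T. open T \<and> x \<in> T \<and> smooth_on (\<phi> ` (U \<inter> F -` V) \<inter> T) (\<psi> \<circ> F \<circ> inv_into U \<phi>)"
          using T'(1) by blast
      qed
    qed
  qed
qed

lemma smooth_at_compose:
  assumes M: "smooth_space M A" and N: "smooth_space N A'" and P: "smooth_space P A''"
    and F: "smooth_at M A A' F p" and G: "smooth_at N A' A'' G (F p)"
  shows "smooth_at M A A'' (\<lambda>x. G (F x)) p"
proof -
  obtain V \<psi> W \<rho> T2 where 2: "(V, \<psi>) \<in> A'" "(W, \<rho>) \<in> A''" "open T2" "F p \<in> N \<inter> T2" "N \<inter> T2 \<subseteq> V"
    "G ` (N \<inter> T2) \<subseteq> W" "smooth_on (\<psi> ` (N \<inter> T2)) (\<lambda>x. \<rho> (G (inv_into V \<psi> x)))"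
    using smooth_atE[OF G] by metis
  obtain U \<phi> where U: "(U, \<phi>) \<in> A" "p \<in> U"
    using smooth_atE[OF F] by (metis subsetD)
  obtain T1 where 1: "open T1" "p \<in> M \<inter> T1" "M \<inter> T1 \<subseteq> U" "F ` (M \<inter> T1) \<subseteq> V"
    "smooth_on (\<phi> ` (M \<inter> T1)) (\<lambda>x. \<psi> (F (inv_into U \<phi> x)))"
    using smooth_at_charts[OF M N F U(1) 2(1) U(2)] 2(4,5) by (metis subsetD)
  have cont: "continuous_on (M \<inter> T1) F"
    using smooth_at_continuous_aux[OF M N U(1) 2(1) 1(3-5)] .
  obtain T3 where T3: "open T3" "(M \<inter> T1) \<inter> F -` T2 = (M \<inter> T1) \<inter> T3"
    using continuous_openin_preimage_gen[OF cont 2(3)] by (auto simp: openin_open)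
  note c = smooth_space_chart(3)[OF M U(1)] smooth_space_chart(3)[OF N 2(1)]
  note iv = inv_into_f_f[OF c(1)] inv_into_f_f[OF c(2)]
  have VN: "V \<subseteq> N" using smooth_space_chart[OF N 2(1)] by simp
  have FT: "F q \<in> N \<inter> T2" "F q \<in> V" "q \<in> U" if "q \<in> M" "q \<in> T1" "q \<in> T3" for q
    using that T3(2) 1(3,4) VN by blast+
  have "smooth_on (\<phi> ` (M \<inter> (T1 \<inter> T3))) (\<lambda>x. \<rho> (G (inv_into V \<psi> (\<psi> (F (inv_into U \<phi> x))))))"
    using FT iv by (intro smooth_on_compose[OF smooth_on_subset[OF 1(5)] 2(7)]) auto
  then have "smooth_on (\<phi> ` (M \<inter> (T1 \<inter> T3))) (\<lambda>x. \<rho> (G (F (inv_into U \<phi> x))))"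
    by (rule smooth_on_cong) (use FT iv in auto)
  then show ?thesis
    using FT 1 2 T3 by (intro smooth_atI[OF U(1) 2(2), of "T1 \<inter> T3"]) auto
qed

lemma smooth_at_cong:
  assumes M: "smooth_space M A" and F: "smooth_at M A A' F p" "open T" "p \<in> T"
    "\<And>q. q \<in> M \<Longrightarrow> q \<in> T \<Longrightarrow> F q = G q"
  shows "smooth_at M A A' G p"
proof -
  obtain U \<phi> V \<psi> T1 where 1: "(U, \<phi>) \<in> A" "(V, \<psi>) \<in> A'" "open T1" "p \<in> M \<inter> T1" "M \<inter> T1 \<subseteq> U"
    "F ` (M \<inter> T1) \<subseteq> V" "smooth_on (\<phi> ` (M \<inter> T1)) (\<lambda>x. \<psi> (F (inv_into U \<phi> x)))"
    using smooth_atE[OF F(1)] by metis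
  note iv = inv_into_f_f[OF smooth_space_chart(3)[OF M 1(1)]]
  have "smooth_on (\<phi> ` (M \<inter> (T1 \<inter> T))) (\<lambda>x. \<psi> (F (inv_into U \<phi> x)))"
    by (rule smooth_on_subset[OF 1(7)]) auto
  then have "smooth_on (\<phi> ` (M \<inter> (T1 \<inter> T))) (\<lambda>x. \<psi> (G (inv_into U \<phi> x)))"
    by (rule smooth_on_cong) (use 1(5) F(4) iv in \<open>auto simp: subset_iff\<close>)
  then show ?thesis
    using 1 F by (intro smooth_atI[OF 1(1,2), of "T1 \<inter> T"]) force+
qed

lemma smooth_at_in:
  assumes "smooth_at M A A' F p" shows "p \<in> M"
  using assms by (auto elim: smooth_atE)

lemma smooth_at_id:
  assumes M: "smooth_space M A" "p \<in> M" shows "smooth_at M A A (\<lambda>x. x) p"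
proof -
  obtain U \<phi> where U: "(U, \<phi>) \<in> A" "p \<in> U" using smooth_space_ex_chart[OF M] .
  obtain TU where TU: "open TU" "U = M \<inter> TU" using smooth_space_chart_open[OF M(1) U(1)] .
  have "smooth_on (\<phi> ` (M \<inter> TU)) (\<lambda>x. \<phi> (inv_into U \<phi> x))"
    using smooth_space_compat[OF M(1) U(1) U(1)] TU by simp
  then show ?thesis using U TU by (intro smooth_atI[OF U(1) U(1)]) auto
qed

lemma smooth_at_const:
  assumes M: "smooth_space M A" "p \<in> M" and N: "smooth_space N A'" "c \<in> N"
  shows "smooth_at M A A' (\<lambda>x. c) p"
proof -
  obtain U \<phi> where U: "(U, \<phi>) \<in> A" "p \<in> U" using smooth_space_ex_chart[OF M] .
  obtain V \<psi> where V: "(V, \<psi>) \<in> A'" "c \<in> V" using smooth_space_ex_chart[OF N] .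
  obtain TU where TU: "open TU" "U = M \<inter> TU" using smooth_space_chart_open[OF M(1) U(1)] .
  then show ?thesis using U V by (intro smooth_atI[OF U(1) V(1), of TU]) (auto intro: smooth_on_const)
qed

section \<open>Subsets of Euclidean spaces\<close>

lemma mem_euclidean_atlas: "(U, \<phi>) \<in> euclidean_atlas S \<longleftrightarrow> U = S \<and> \<phi> = (\<lambda>x. x)"
  by (simp add: euclidean_atlas_def)

lemma smooth_space_euclid: "smooth_space S (euclidean_atlas S)"
proof -
  have "homeomorphism S S (\<lambda>x. x) (inv_into S (\<lambda>x. x))"
  proof (rule homeomorphismI)
    show "continuous_on S (inv_into S (\<lambda>x. x))"
      by (rule continuous_on_eq[OF continuous_on_id]) (simp add: inv_into_ident)
  qed (auto simp: inv_into_ident intro: continuous_on_id)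
  moreover have "smooth_on S ((\<lambda>x. x) \<circ> inv_into S (\<lambda>x. x))"
    by (rule smooth_on_cong[OF smooth_on_id]) (simp add: inv_into_ident)
  ultimately show ?thesis
    by (simp add: smooth_space_def euclidean_atlas_def)
qed

lemma smooth_at_euclid_iff:
  "smooth_at S (euclidean_atlas S) (euclidean_atlas T) f x \<longleftrightarrow>
    (\<exists>N. open N \<and> x \<in> S \<inter> N \<and> f ` (S \<inter> N) \<subseteq> T \<and> smooth_on (S \<inter> N) f)"
proof -
  have "smooth_on (S \<inter> N) (\<lambda>x. f (inv_into S (\<lambda>x. x) x)) \<longleftrightarrow> smooth_on (S \<inter> N) f" for N
    using smooth_on_cong[of "S \<inter> N" "\<lambda>x. f (inv_into S (\<lambda>x. x) x)" f]
      smooth_on_cong[of "S \<inter> N" f "\<lambda>x. f (inv_into S (\<lambda>x. x) x)"]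
    by (auto simp: inv_into_ident)
  then show ?thesis
    by (auto simp: smooth_at_def euclidean_atlas_def)
qed

lemma smooth_at_euclidI:
  "smooth_on S f \<Longrightarrow> f ` S \<subseteq> T \<Longrightarrow> x \<in> S \<Longrightarrow> smooth_at S (euclidean_atlas S) (euclidean_atlas T) f x"
  unfolding smooth_at_euclid_iff by (intro exI[of _ UNIV]) auto

lemma smooth_at_smooth_on:
  assumes "\<And>x. x \<in> S \<Longrightarrow> smooth_at S (euclidean_atlas S) (euclidean_atlas T) f x"
  shows "smooth_on S f"
  using assms unfolding smooth_at_euclid_iff by (intro smooth_on_local) blast

lemma smooth_at_smooth_on_comp:
  assumes "smooth_space M A" "smooth_at M A (euclidean_atlas S) F p" "smooth_on S g" "g ` S \<subseteq> T"
  shows "smooth_at M A (euclidean_atlas T) (\<lambda>x. g (F x)) p"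
proof -
  have "F p \<in> S" using assms(2) by (auto simp: euclidean_atlas_def smooth_at_def)
  then show ?thesis
    by (intro smooth_at_compose[OF assms(1) smooth_space_euclid smooth_space_euclid assms(2)]
        smooth_at_euclidI[OF assms(3,4)])
qed

lemma smooth_at_chart:
  assumes M: "smooth_space M A" and U: "(U, \<phi>) \<in> A" "p \<in> U" "\<phi> ` U \<subseteq> S"
  shows "smooth_at M A (euclidean_atlas S) \<phi> p"
proof -
  obtain TU where TU: "open TU" "U = M \<inter> TU" using smooth_space_chart_open[OF M U(1)] .
  note iv = inv_into_f_f[OF smooth_space_chart(3)[OF M U(1)]]
  have "smooth_on (\<phi> ` U) (\<lambda>x. \<phi> (inv_into U \<phi> x))"
    by (rule smooth_on_cong[OF smooth_on_id]) (auto simp: iv)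
  then show ?thesis using U TU
    by (intro smooth_atI[OF U(1), of S "\<lambda>x. x" _ TU]) (auto simp: mem_euclidean_atlas)
qed

lemma smooth_at_chart_inv:
  assumes M: "smooth_space M A" and U: "(U, \<phi>) \<in> A" "z \<in> \<phi> ` U"
  shows "smooth_at (\<phi> ` U) (euclidean_atlas (\<phi> ` U)) A (inv_into U \<phi>) z"
proof -
  note iv = inv_into_f_f[OF smooth_space_chart(3)[OF M U(1)]]
  have "smooth_on (\<phi> ` U) (\<lambda>x. \<phi> (inv_into U \<phi> (inv_into (\<phi> ` U) (\<lambda>x. x) x)))"
    by (rule smooth_on_cong[OF smooth_on_id]) (auto simp: iv inv_into_ident)
  then show ?thesis using U
    by (intro smooth_atI[OF _ U(1), of "\<phi> ` U" "\<lambda>x. x" _ UNIV]) (auto simp: mem_euclidean_atlas iv)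
qed

lemma smooth_at_euclid_target_mono:
  "smooth_space M A \<Longrightarrow> smooth_at M A (euclidean_atlas S) F p \<Longrightarrow> S \<subseteq> S' \<Longrightarrow>
    smooth_at M A (euclidean_atlas S') F p"
  using smooth_at_smooth_on_comp[of M A S F p "\<lambda>x. x" S'] smooth_on_id by auto

text \<open>Smoothness into a subset of a Euclidean space is extrinsic: the identity chart of any
  set that contains the nearby values serves as target.\<close>

lemma smooth_at_euclid_target:
  assumes M: "smooth_space M A" and F: "smooth_at M A (euclidean_atlas S) F p"
    "open T" "p \<in> T" "F ` (M \<inter> T) \<subseteq> S'"
  shows "smooth_at M A (euclidean_atlas S') F p"
proof -
  obtain U \<phi> T1 where 1: "(U, \<phi>) \<in> A" "open T1" "p \<in> M \<inter> T1" "M \<inter> T1 \<subseteq> U"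
    "smooth_on (\<phi> ` (M \<inter> T1)) (\<lambda>x. F (inv_into U \<phi> x))"
    using F(1) by (auto simp: smooth_at_def euclidean_atlas_def)
  have "smooth_on (\<phi> ` (M \<inter> (T1 \<inter> T))) (\<lambda>x. F (inv_into U \<phi> x))"
    by (rule smooth_on_subset[OF 1(5)]) auto
  then show ?thesis using 1 F
    by (intro smooth_atI[OF 1(1), of S' "\<lambda>x. x" _ "T1 \<inter> T"]) (auto simp: mem_euclidean_atlas)
qed

lemma smooth_at_euclid_source_subset:
  assumes "smooth_space N A'" "smooth_at S (euclidean_atlas S) A' F x" "S' \<subseteq> S" "x \<in> S'"
  shows "smooth_at S' (euclidean_atlas S') A' F x"
proof -
  have "smooth_at S' (euclidean_atlas S') (euclidean_atlas S) (\<lambda>x. x) x"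
    using assms by (intro smooth_at_euclidI smooth_on_id) auto
  from smooth_at_compose[OF smooth_space_euclid smooth_space_euclid assms(1) this assms(2)]
  show ?thesis .
qed

lemma smooth_at_euclid_source_open:
  assumes "smooth_space N A'" "smooth_at S' (euclidean_atlas S') A' F x" "open T" "S' = S \<inter> T"
  shows "smooth_at S (euclidean_atlas S) A' F x"
proof -
  have "smooth_at S (euclidean_atlas S) (euclidean_atlas S') (\<lambda>x. x) x"
    using smooth_at_in[OF assms(2)] assms(3,4) unfolding smooth_at_euclid_iff
    by (intro exI[of _ T]) (auto intro: smooth_on_id)
  from smooth_at_compose[OF smooth_space_euclid smooth_space_euclid assms(1) this assms(2)]
  show ?thesis .
qed

section \<open>Products\<close>

lemma mem_prod_atlas:
  "c \<in> prod_atlas A A' \<longleftrightarrow> (\<exists>U \<phi> V \<psi>. c = (U \<times> V, map_prod \<phi> \<psi>) \<and> (U, \<phi>) \<in> A \<and> (V, \<psi>) \<in> A')"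
  by (auto simp: prod_atlas_def)

lemma prod_atlas_euclid: "prod_atlas (euclidean_atlas S) (euclidean_atlas T) = euclidean_atlas (S \<times> T)"
proof -
  have "map_prod (\<lambda>x. x) (\<lambda>x. x) = (\<lambda>x::'a \<times> 'b. x)" by (rule ext) (simp add: map_prod_def split_beta)
  then show ?thesis by (auto simp: prod_atlas_def euclidean_atlas_def)
qed

lemma inv_into_map_prod:
  assumes "inj_on \<phi> U" "inj_on \<psi> V" "x \<in> \<phi> ` U" "y \<in> \<psi> ` V"
  shows "inv_into (U \<times> V) (map_prod \<phi> \<psi>) (x, y) = (inv_into U \<phi> x, inv_into V \<psi> y)"
  using assms by (intro inv_into_f_eq map_prod_inj_on) (auto simp: inv_into_into f_inv_into_f)

lemma smooth_space_prod:
  assumes M: "smooth_space M A" and N: "smooth_space N A'"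
  shows "smooth_space (M \<times> N) (prod_atlas A A')"
proof -
  have 1: "openin (top_of_set (M \<times> N)) (U \<times> V) \<and>
      homeomorphism (U \<times> V) (map_prod \<phi> \<psi> ` (U \<times> V)) (map_prod \<phi> \<psi>) (inv_into (U \<times> V) (map_prod \<phi> \<psi>))"
    if U: "(U, \<phi>) \<in> A" and V: "(V, \<psi>) \<in> A'" for U \<phi> V \<psi>
  proof
    note cU = smooth_space_chart[OF M U] and cV = smooth_space_chart[OF N V]
    show "openin (top_of_set (M \<times> N)) (U \<times> V)" using cU(1) cV(1) by (rule openin_Times)
    have inj: "inj_on (map_prod \<phi> \<psi>) (U \<times> V)" using cU(3) cV(3) by (rule map_prod_inj_on)
    have im: "map_prod \<phi> \<psi> ` (U \<times> V) = \<phi> ` U \<times> \<psi> ` V" by (rule map_prod_surj_on) auto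
    show "homeomorphism (U \<times> V) (map_prod \<phi> \<psi> ` (U \<times> V)) (map_prod \<phi> \<psi>) (inv_into (U \<times> V) (map_prod \<phi> \<psi>))"
    proof (rule homeomorphismI)
      show "continuous_on (U \<times> V) (map_prod \<phi> \<psi>)"
        unfolding map_prod_def split_beta
        by (intro continuous_on_Pair continuous_on_compose2[OF cU(4)] continuous_on_compose2[OF cV(4)]
            continuous_on_fst continuous_on_snd continuous_on_id) auto
      have "continuous_on (\<phi> ` U \<times> \<psi> ` V) (\<lambda>z. (inv_into U \<phi> (fst z), inv_into V \<psi> (snd z)))"
        by (intro continuous_on_Pair continuous_on_compose2[OF cU(5)] continuous_on_compose2[OF cV(5)]
            continuous_on_fst continuous_on_snd continuous_on_id) auto
      then show "continuous_on (map_prod \<phi> \<psi> ` (U \<times> V)) (inv_into (U \<times> V) (map_prod \<phi> \<psi>))"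
        unfolding im by (rule continuous_on_eq) (auto simp: inv_into_map_prod[OF cU(3) cV(3)])
      show "map_prod \<phi> \<psi> ` (U \<times> V) \<subseteq> map_prod \<phi> \<psi> ` (U \<times> V)" ..
      show "inv_into (U \<times> V) (map_prod \<phi> \<psi>) ` (map_prod \<phi> \<psi> ` (U \<times> V)) \<subseteq> U \<times> V"
        unfolding im by (auto simp: inv_into_map_prod[OF cU(3) cV(3)] inv_into_f_f[OF cU(3)] inv_into_f_f[OF cV(3)])
    qed (simp_all add: inv_into_f_f[OF inj] f_inv_into_f)
  qed
  have 2: "smooth_on (map_prod \<phi> \<psi> ` ((U \<times> V) \<inter> (U' \<times> V')))
      (map_prod \<phi>' \<psi>' \<circ> inv_into (U \<times> V) (map_prod \<phi> \<psi>))"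
    if U: "(U, \<phi>) \<in> A" "(U', \<phi>') \<in> A" and V: "(V, \<psi>) \<in> A'" "(V', \<psi>') \<in> A'" for U \<phi> V \<psi> U' \<phi>' V' \<psi>'
  proof -
    note cU = smooth_space_chart[OF M U(1)] and cV = smooth_space_chart[OF N V(1)]
    have im: "map_prod \<phi> \<psi> ` ((U \<times> V) \<inter> (U' \<times> V')) = \<phi> ` (U \<inter> U') \<times> \<psi> ` (V \<inter> V')"
      unfolding Times_Int_Times by (rule map_prod_surj_on) auto
    have "smooth_on (\<phi> ` (U \<inter> U') \<times> \<psi> ` (V \<inter> V'))
      (\<lambda>z. (\<phi>' (inv_into U \<phi> (fst z)), \<psi>' (inv_into V \<psi> (snd z))))"
      by (intro smooth_on_Pair
          smooth_on_compose[OF smooth_on_bounded_linear[OF bounded_linear_fst] smooth_space_compat[OF M U]]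
          smooth_on_compose[OF smooth_on_bounded_linear[OF bounded_linear_snd] smooth_space_compat[OF N V]]) auto
    then show ?thesis
      unfolding im
      by (rule smooth_on_cong) (auto simp: inv_into_map_prod[OF cU(3) cV(3)])
  qed
  have 3: "(\<Union>(U, \<phi>)\<in>prod_atlas A A'. U) = M \<times> N"
  proof -
    have "z \<in> (\<Union>(U, \<phi>)\<in>prod_atlas A A'. U) \<longleftrightarrow> z \<in> M \<times> N" for z
    proof
      assume "z \<in> (\<Union>(U, \<phi>)\<in>prod_atlas A A'. U)"
      then obtain U \<phi> V \<psi> where UV: "(U, \<phi>) \<in> A" "(V, \<psi>) \<in> A'" "z \<in> U \<times> V"
        by (auto simp: mem_prod_atlas)
      then show "z \<in> M \<times> N"
        using smooth_space_chart(2)[OF M UV(1)] smooth_space_chart(2)[OF N UV(2)] by auto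
    next
      assume z: "z \<in> M \<times> N"
      then have z': "fst z \<in> M" "snd z \<in> N" by auto
      obtain U \<phi> where U: "(U, \<phi>) \<in> A" "fst z \<in> U" using smooth_space_ex_chart[OF M z'(1)] .
      obtain V \<psi> where V: "(V, \<psi>) \<in> A'" "snd z \<in> V" using smooth_space_ex_chart[OF N z'(2)] .
      have "(U \<times> V, map_prod \<phi> \<psi>) \<in> prod_atlas A A'" using U V by (auto simp: mem_prod_atlas)
      moreover have "z \<in> U \<times> V" using U V by (simp add: mem_Times_iff)
      ultimately show "z \<in> (\<Union>(U, \<phi>)\<in>prod_atlas A A'. U)" by blast
    qed
    then show ?thesis by blast
  qed
  show ?thesis
    unfolding smooth_space_def
    using 1 2 3 by (auto simp: mem_prod_atlas)
qed

lemma smooth_at_fst: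
  assumes M: "smooth_space M A" and N: "smooth_space N A'" and p: "z \<in> M \<times> N"
  shows "smooth_at (M \<times> N) (prod_atlas A A') A fst z"
proof -
  have p': "fst z \<in> M" "snd z \<in> N" using p by auto
  obtain U \<phi> where U: "(U, \<phi>) \<in> A" "fst z \<in> U" using smooth_space_ex_chart[OF M p'(1)] .
  obtain V \<psi> where V: "(V, \<psi>) \<in> A'" "snd z \<in> V" using smooth_space_ex_chart[OF N p'(2)] .
  obtain TU where TU: "open TU" "U = M \<inter> TU" using smooth_space_chart_open[OF M U(1)] .
  obtain TV where TV: "open TV" "V = N \<inter> TV" using smooth_space_chart_open[OF N V(1)] .
  note cU = smooth_space_chart[OF M U(1)] and cV = smooth_space_chart[OF N V(1)]
  have eq: "(M \<times> N) \<inter> (TU \<times> TV) = U \<times> V" using TU TV by auto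
  have im: "map_prod \<phi> \<psi> ` (U \<times> V) = \<phi> ` U \<times> \<psi> ` V" by (rule map_prod_surj_on) auto
  have "smooth_on (\<phi> ` U \<times> \<psi> ` V) (\<lambda>z. \<phi> (fst (inv_into (U \<times> V) (map_prod \<phi> \<psi>) z)))"
    by (rule smooth_on_cong[OF smooth_on_bounded_linear[OF bounded_linear_fst]])
      (auto simp: inv_into_map_prod[OF cU(3) cV(3)] inv_into_f_f[OF cU(3)])
  then show ?thesis
    using U V TU TV eq im mem_prod_atlas[of "(U \<times> V, map_prod \<phi> \<psi>)" A A']
    by (intro smooth_atI[of "U \<times> V" "map_prod \<phi> \<psi>" _ U \<phi> _ "TU \<times> TV"]) (auto simp: open_Times mem_Times_iff)
qed

lemma smooth_at_snd:
  assumes M: "smooth_space M A" and N: "smooth_space N A'" and p: "z \<in> M \<times> N"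
  shows "smooth_at (M \<times> N) (prod_atlas A A') A' snd z"
proof -
  have p': "fst z \<in> M" "snd z \<in> N" using p by auto
  obtain U \<phi> where U: "(U, \<phi>) \<in> A" "fst z \<in> U" using smooth_space_ex_chart[OF M p'(1)] .
  obtain V \<psi> where V: "(V, \<psi>) \<in> A'" "snd z \<in> V" using smooth_space_ex_chart[OF N p'(2)] .
  obtain TU where TU: "open TU" "U = M \<inter> TU" using smooth_space_chart_open[OF M U(1)] .
  obtain TV where TV: "open TV" "V = N \<inter> TV" using smooth_space_chart_open[OF N V(1)] .
  note cU = smooth_space_chart[OF M U(1)] and cV = smooth_space_chart[OF N V(1)]
  have eq: "(M \<times> N) \<inter> (TU \<times> TV) = U \<times> V" using TU TV by auto
  have im: "map_prod \<phi> \<psi> ` (U \<times> V) = \<phi> ` U \<times> \<psi> ` V" by (rule map_prod_surj_on) auto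
  have "smooth_on (\<phi> ` U \<times> \<psi> ` V) (\<lambda>z. \<psi> (snd (inv_into (U \<times> V) (map_prod \<phi> \<psi>) z)))"
    by (rule smooth_on_cong[OF smooth_on_bounded_linear[OF bounded_linear_snd]])
      (auto simp: inv_into_map_prod[OF cU(3) cV(3)] inv_into_f_f[OF cV(3)])
  then show ?thesis
    using U V TU TV eq im mem_prod_atlas[of "(U \<times> V, map_prod \<phi> \<psi>)" A A']
    by (intro smooth_atI[of "U \<times> V" "map_prod \<phi> \<psi>" _ V \<psi> _ "TU \<times> TV"]) (auto simp: open_Times mem_Times_iff)
qed

lemma smooth_at_Pair:
  assumes M: "smooth_space M A" and N: "smooth_space N A1" and P: "smooth_space P A2"
    and F: "smooth_at M A A1 F p" and G: "smooth_at M A A2 G p"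
  shows "smooth_at M A (prod_atlas A1 A2) (\<lambda>x. (F x, G x)) p"
proof -
  obtain U \<phi> where U: "(U, \<phi>) \<in> A" "p \<in> U"
    using smooth_atE[OF F] by (metis subsetD)
  obtain V \<psi> where V: "(V, \<psi>) \<in> A1" "F p \<in> V" using smooth_atE[OF F] by (metis image_subset_iff)
  obtain W \<rho> where W: "(W, \<rho>) \<in> A2" "G p \<in> W" using smooth_atE[OF G] by (metis image_subset_iff)
  obtain T1 where 1: "open T1" "p \<in> M \<inter> T1" "M \<inter> T1 \<subseteq> U" "F ` (M \<inter> T1) \<subseteq> V"
    "smooth_on (\<phi> ` (M \<inter> T1)) (\<lambda>x. \<psi> (F (inv_into U \<phi> x)))"
    using smooth_at_charts[OF M N F U(1) V(1) U(2) V(2)] .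
  obtain T2 where 2: "open T2" "p \<in> M \<inter> T2" "M \<inter> T2 \<subseteq> U" "G ` (M \<inter> T2) \<subseteq> W"
    "smooth_on (\<phi> ` (M \<inter> T2)) (\<lambda>x. \<rho> (G (inv_into U \<phi> x)))"
    using smooth_at_charts[OF M P G U(1) W(1) U(2) W(2)] .
  have "smooth_on (\<phi> ` (M \<inter> (T1 \<inter> T2))) (\<lambda>x. (\<psi> (F (inv_into U \<phi> x)), \<rho> (G (inv_into U \<phi> x))))"
    by (intro smooth_on_Pair smooth_on_subset[OF 1(5)] smooth_on_subset[OF 2(5)]) auto
  then show ?thesis
    using 1 2 V W mem_prod_atlas[of "(V \<times> W, map_prod \<psi> \<rho>)" A1 A2]
    by (intro smooth_atI[OF U(1), of "V \<times> W" "map_prod \<psi> \<rho>" _ "T1 \<inter> T2"]) auto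
qed

section \<open>Restrictions\<close>

lemma mem_restrict_atlas: "c \<in> restrict_atlas A W \<longleftrightarrow> (\<exists>U \<phi>. c = (U \<inter> W, \<phi>) \<and> (U, \<phi>) \<in> A)"
  by (auto simp: restrict_atlas_def)

lemma inv_into_Int: "inj_on \<phi> U \<Longrightarrow> x \<in> \<phi> ` (U \<inter> W) \<Longrightarrow> inv_into (U \<inter> W) \<phi> x = inv_into U \<phi> x"
  by (auto simp: inv_into_f_f inj_on_def intro!: inv_into_f_eq)

lemma smooth_space_restrict:
  assumes M: "smooth_space M A" "W \<subseteq> M"
  shows "smooth_space W (restrict_atlas A W)"
proof -
  have 1: "openin (top_of_set W) (U \<inter> W) \<and> homeomorphism (U \<inter> W) (\<phi> ` (U \<inter> W)) \<phi> (inv_into (U \<inter> W) \<phi>)"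
    if U: "(U, \<phi>) \<in> A" for U \<phi>
  proof
    note c = smooth_space_chart[OF M(1) U]
    show "openin (top_of_set W) (U \<inter> W)"
      using c(1) M(2) by (auto simp: openin_open)
    have inj: "inj_on \<phi> (U \<inter> W)" using c(3) by (rule inj_on_subset) auto
    show "homeomorphism (U \<inter> W) (\<phi> ` (U \<inter> W)) \<phi> (inv_into (U \<inter> W) \<phi>)"
    proof (rule homeomorphismI)
      show "continuous_on (U \<inter> W) \<phi>" using c(4) by (rule continuous_on_subset) auto
      have "continuous_on (\<phi> ` (U \<inter> W)) (inv_into U \<phi>)" using c(5) by (rule continuous_on_subset) auto
      then show "continuous_on (\<phi> ` (U \<inter> W)) (inv_into (U \<inter> W) \<phi>)"
        by (rule continuous_on_eq) (simp add: inv_into_Int[OF c(3)])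
    qed (use inv_into_f_f[OF inj] in auto)
  qed
  have 2: "smooth_on (\<phi> ` (U \<inter> W \<inter> (V \<inter> W))) (\<psi> \<circ> inv_into (U \<inter> W) \<phi>)"
    if U: "(U, \<phi>) \<in> A" and V: "(V, \<psi>) \<in> A" for U \<phi> V \<psi>
  proof (rule smooth_on_cong)
    show "smooth_on (\<phi> ` (U \<inter> W \<inter> (V \<inter> W))) (\<lambda>x. \<psi> (inv_into U \<phi> x))"
      by (rule smooth_on_subset[OF smooth_space_compat[OF M(1) U V]]) auto
    show "\<psi> (inv_into U \<phi> x) = (\<psi> \<circ> inv_into (U \<inter> W) \<phi>) x" if "x \<in> \<phi> ` (U \<inter> W \<inter> (V \<inter> W))" for x
      using that by (subst o_apply, subst inv_into_Int[OF smooth_space_chart(3)[OF M(1) U]]) auto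
  qed
  have 3: "(\<Union>(U, \<phi>)\<in>restrict_atlas A W. U) = W"
  proof -
    have "(\<Union>(U, \<phi>)\<in>restrict_atlas A W. U) = (\<Union>(U, \<phi>)\<in>A. U) \<inter> W"
      by (force simp: restrict_atlas_def)
    then show ?thesis using M unfolding smooth_space_def by auto
  qed
  show ?thesis
    unfolding smooth_space_def using 1 2 3 by (auto simp: mem_restrict_atlas)
qed

lemma smooth_at_restrict_incl:
  assumes M: "smooth_space M A" "W \<subseteq> M" "p \<in> W"
  shows "smooth_at W (restrict_atlas A W) A (\<lambda>x. x) p"
proof -
  obtain U \<phi> where U: "(U, \<phi>) \<in> A" "p \<in> U" using smooth_space_ex_chart[OF M(1)] M by blast
  obtain TU where TU: "open TU" "U = M \<inter> TU" using smooth_space_chart_open[OF M(1) U(1)] .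
  have eq: "W \<inter> TU = U \<inter> W" using TU M by auto
  have "smooth_on (\<phi> ` (U \<inter> W)) (\<lambda>x. \<phi> (inv_into (U \<inter> W) \<phi> x))"
    by (rule smooth_on_cong[OF smooth_on_id]) (simp add: f_inv_into_f)
  then show ?thesis
    using U TU M eq mem_restrict_atlas[of "(U \<inter> W, \<phi>)" A W]
    by (intro smooth_atI[of "U \<inter> W" \<phi> _ U \<phi> _ TU]) auto
qed

text \<open>The relatively open form of the subset supplies the neighbourhood on which the identity
  lands in it. For a general subset there is only the inclusion in the other direction.\<close>

lemma smooth_at_restrict_into:
  assumes M: "smooth_space M A" "open T" "p \<in> M \<inter> T"
  shows "smooth_at M A (restrict_atlas A (M \<inter> T)) (\<lambda>x. x) p"
proof -
  obtain U \<phi> where U: "(U, \<phi>) \<in> A" "p \<in> U" using smooth_space_ex_chart[OF M(1)] M by blast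
  obtain TU where TU: "open TU" "U = M \<inter> TU" using smooth_space_chart_open[OF M(1) U(1)] .
  have "smooth_on (\<phi> ` (M \<inter> (TU \<inter> T))) (\<lambda>x. \<phi> (inv_into U \<phi> x))"
    by (rule smooth_on_cong[OF smooth_on_id]) (use TU in \<open>auto simp: f_inv_into_f\<close>)
  then show ?thesis
    using U TU M mem_restrict_atlas[of "(U \<inter> (M \<inter> T), \<phi>)" A "M \<inter> T"]
    by (intro smooth_atI[of U \<phi> _ "U \<inter> (M \<inter> T)" \<phi> _ "TU \<inter> T"]) auto
qed

text \<open>In the chart \<open>map_prod (\<lambda>x. x) \<phi>\<close> the function
  \<open>K\<close> has a local extension \<open>g\<close> to an open set. Its derivative in the time
  direction (1, 0) is determined by \<open>K\<close>, because a short time segment through a point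
  of the domain stays in it; in other directions the derivative could depend on the
  extension.\<close>

lemma smooth_at_deriv:
  fixes K :: "real \<times> 'm::topological_space \<Rightarrow> real"
  assumes M: "smooth_space M A" and T: "open T" "z \<in> (UNIV \<times> M) \<inter> T"
    and K: "\<And>z. z \<in> (UNIV \<times> M) \<inter> T \<Longrightarrow>
      smooth_at (UNIV \<times> M) (prod_atlas (euclidean_atlas UNIV) A) (euclidean_atlas UNIV) K z"
  shows "smooth_at (UNIV \<times> M) (prod_atlas (euclidean_atlas UNIV) A) (euclidean_atlas UNIV)
    (\<lambda>(t, p). deriv (\<lambda>s. K (s, p)) t) z"
proof -
  let ?A = "prod_atlas (euclidean_atlas (UNIV::real set)) A"
  note M' = smooth_space_prod[OF smooth_space_euclid M, of UNIV]
  have "snd z \<in> M" using T(2) by auto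
  then obtain U \<phi> where U: "(U, \<phi>) \<in> A" "snd z \<in> U" using smooth_space_ex_chart[OF M] by blast
  note c = smooth_space_chart[OF M U(1)]
  let ?\<Phi> = "map_prod (\<lambda>x::real. x) \<phi>"
  have UA: "(UNIV \<times> U, ?\<Phi>) \<in> ?A" using U by (auto simp: prod_atlas_def euclidean_atlas_def)
  have idA: "(UNIV, \<lambda>x::real. x) \<in> euclidean_atlas UNIV" by (simp add: mem_euclidean_atlas)
  have zU: "z \<in> UNIV \<times> U" using U by (simp add: mem_Times_iff)
  have iv: "inv_into (UNIV \<times> U) ?\<Phi> (t, \<phi> q) = (t, q)" if "q \<in> U" for t q
    using that by (intro inv_into_f_eq map_prod_inj_on c(3)) (auto simp: inj_on_def)
  obtain T1 where T1: "open T1" "z \<in> (UNIV \<times> M) \<inter> T1" "(UNIV \<times> M) \<inter> T1 \<subseteq> UNIV \<times> U"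
    "smooth_on (?\<Phi> ` ((UNIV \<times> M) \<inter> T1)) (\<lambda>x. K (inv_into (UNIV \<times> U) ?\<Phi> x))"
    by (rule smooth_at_charts[OF M' smooth_space_euclid K[OF T(2)] UA idA zU UNIV_I]) (rule that)
  obtain N g where N: "open N" "?\<Phi> z \<in> N" "C_inf_on N g"
    "\<forall>y\<in>N \<inter> ?\<Phi> ` ((UNIV \<times> M) \<inter> T1). g y = K (inv_into (UNIV \<times> U) ?\<Phi> y)"
    using T1(2,4) unfolding smooth_on_iff by blast
  obtain TU where TU: "open TU" "U = M \<inter> TU" using smooth_space_chart_open[OF M U(1)] .
  have contP: "continuous_on ((UNIV \<times> M) \<inter> T1) ?\<Phi>"
    using smooth_space_chart(4)[OF M' UA] T1(3) by (rule continuous_on_subset)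
  obtain T2 where T2: "open T2" "(UNIV \<times> M) \<inter> T1 \<inter> ?\<Phi> -` N = (UNIV \<times> M) \<inter> T1 \<inter> T2"
    using continuous_openin_preimage_gen[OF contP N(1)] by (auto simp: openin_open)
  let ?T = "T1 \<inter> T2"
  have val: "K (s, q) = g (s, \<phi> q)" "(s, \<phi> q) \<in> N" "q \<in> U" if "q \<in> M" "(s, q) \<in> ?T" for s q
  proof -
    show q: "q \<in> U" using that T1(3) by blast
    have "(s, q) \<in> (UNIV \<times> M) \<inter> T1 \<inter> ?\<Phi> -` N" using that T2(2) by blast
    then show Nm: "(s, \<phi> q) \<in> N" by simp
    have "?\<Phi> (s, q) \<in> ?\<Phi> ` ((UNIV \<times> M) \<inter> T1)" using that by (intro imageI) auto
    then have "(s, \<phi> q) \<in> N \<inter> ?\<Phi> ` ((UNIV \<times> M) \<inter> T1)" using Nm by simp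
    then show "K (s, q) = g (s, \<phi> q)" using N(4) iv[OF q] by metis
  qed
  have der: "deriv (\<lambda>s. K (s, q)) t = dird (1, 0) g (t, \<phi> q)" if q: "q \<in> M" "(t, q) \<in> ?T" for t q
  proof -
    have "g differentiable (at ((0, \<phi> q) + t *\<^sub>R (1, 0)))"
      using C_inf_on_differentiable[OF N(3) val(2)[OF q]] by simp
    from has_vector_derivative_line[OF this]
    have "((\<lambda>s. g (s, \<phi> q)) has_real_derivative dird (1, 0) g (t, \<phi> q)) (at t)"
      by (simp add: has_real_derivative_iff_has_vector_derivative)
    moreover have "open ((\<lambda>s. (s, q)) -` ?T)"
      using T1(1) T2(1) by (intro open_vimage continuous_intros) auto
    ultimately have "((\<lambda>s. K (s, q)) has_real_derivative dird (1, 0) g (t, \<phi> q)) (at t)"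
      by (rule has_field_derivative_transform_within_open) (use q(2) val(1)[OF q(1)] in simp_all)
    then show ?thesis by (rule DERIV_imp_deriv)
  qed
  have "smooth_on (?\<Phi> ` ((UNIV \<times> M) \<inter> ?T)) (dird (1, 0) g)"
    using val(2) by (intro smooth_on_subset[OF C_inf_on_smooth_on[OF N(1) C_inf_on_dird[OF N(3)]]]) auto
  then have "smooth_on (?\<Phi> ` ((UNIV \<times> M) \<inter> ?T))
      (\<lambda>x. (\<lambda>(t, p). deriv (\<lambda>s. K (s, p)) t) (inv_into (UNIV \<times> U) ?\<Phi> x))"
    by (rule smooth_on_cong) (use val(3) iv der in auto)
  moreover have "z \<in> ?T" using T1(2) T2(2) N(2) by blast
  ultimately show ?thesis
    using T1 T2 T(2) by (intro smooth_atI[OF UA, of UNIV "\<lambda>x. x" _ ?T]) (auto simp: mem_euclidean_atlas)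
qed

section \<open>Smooth representations of the multiplicative monoid of reals\<close>

text \<open>Homotheties of a graded space, made linear on the whole type by dropping the components
  outside of \<open>span B\<close>. Thus \<open>dil B w 1\<close> is the orthogonal projection onto
  \<open>span B\<close>. At t = 0 the convention \<open>0 ^ 0 = 1\<close> retains exactly the
  components of weight 0.\<close>

definition dil :: "'a::euclidean_space set \<Rightarrow> ('a \<Rightarrow> nat) \<Rightarrow> real \<Rightarrow> 'a \<Rightarrow> 'a" where
  "dil B w t y = (\<Sum>b\<in>B. (t ^ w b * (y \<bullet> b)) *\<^sub>R b)"

lemma finite_subset_Basis: "B \<subseteq> Basis \<Longrightarrow> finite B"
  using finite_Basis finite_subset by blast

lemma inner_sum_Basis_subset:
  assumes "B \<subseteq> Basis" "c \<in> Basis"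
  shows "(\<Sum>b\<in>B. f b *\<^sub>R b) \<bullet> c = (if c \<in> B then f c else 0)"
proof -
  have "(\<Sum>b\<in>B. f b *\<^sub>R b) \<bullet> c = (\<Sum>b\<in>B. if b = c then f b else 0)"
    unfolding inner_sum_left using assms
    by (intro sum.cong) (auto simp: inner_Basis subset_iff)
  then show ?thesis using finite_subset_Basis[OF assms(1)] by simp
qed

lemma sum_Basis_in_span: "(\<Sum>b\<in>B. f b *\<^sub>R b) \<in> span B"
  by (intro span_sum span_scale span_base)

lemma in_span_Basis_eqI:
  assumes "B \<subseteq> Basis" "x \<in> span B" "y \<in> span B" "\<And>b. b \<in> B \<Longrightarrow> x \<bullet> b = y \<bullet> b"
  shows "x = y"
proof (rule euclidean_eqI)
  fix b :: 'a assume "b \<in> Basis"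
  moreover have "x \<bullet> b = 0 \<and> y \<bullet> b = 0" if "b \<in> Basis" "b \<notin> B"
    using assms(2,3) that unfolding span_substd_basis[OF assms(1)] by blast
  ultimately show "x \<bullet> b = y \<bullet> b" using assms(4) by (cases "b \<in> B") auto
qed

lemma dil_inner: "B \<subseteq> Basis \<Longrightarrow> c \<in> B \<Longrightarrow> dil B w t y \<bullet> c = t ^ w c * (y \<bullet> c)"
  unfolding dil_def by (subst inner_sum_Basis_subset) auto

lemma dil_in_span: "dil B w t y \<in> span B"
  unfolding dil_def by (rule sum_Basis_in_span)

lemma dil_1:
  assumes "B \<subseteq> Basis" "y \<in> span B" shows "dil B w 1 y = y"
  by (rule in_span_Basis_eqI[OF assms(1) dil_in_span assms(2)]) (simp add: dil_inner[OF assms(1)])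

lemma dil_dil: "B \<subseteq> Basis \<Longrightarrow> dil B w s (dil B w t y) = dil B w (s * t) y"
  by (rule in_span_Basis_eqI) (auto simp: dil_in_span dil_inner power_mult_distrib)

lemma linear_dil: "linear (dil B w t)"
  unfolding dil_def
  by (intro linearI) (simp_all add: inner_add_left algebra_simps sum.distrib scaleR_sum_right)

section \<open>Iterated derivatives in one real variable\<close>

abbreviation tder :: "(real \<Rightarrow> 'a::real_normed_vector) \<Rightarrow> real \<Rightarrow> 'a" where
  "tder \<equiv> dird (1::real)"

lemma tder_has_vector_derivative:
  assumes "C_inf_on N f" "t \<in> N"
  shows "(f has_vector_derivative tder f t) (at t)"
  using has_vector_derivative_line[of f 0 t 1] C_inf_on_differentiable[OF assms] by simp

lemma tder_eq: "(f has_vector_derivative d) (at t) \<Longrightarrow> tder f t = d"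
  unfolding has_vector_derivative_def by (drule frechet_derivative_at, drule fun_cong[of _ _ 1]) simp

lemma C_inf_on_tder: "C_inf_on N f \<Longrightarrow> C_inf_on N ((tder ^^ k) f)"
  by (induction k) (auto intro: C_inf_on_dird)

lemma tder_linear:
  assumes "bounded_linear L" "open N" "C_inf_on N f" "t \<in> N"
  shows "(tder ^^ k) (\<lambda>t. L (f t)) t = L ((tder ^^ k) f t)"
  using assms(4)
proof (induction k arbitrary: t)
  case (Suc k)
  have "((\<lambda>t. L ((tder ^^ k) f t)) has_vector_derivative L (tder ((tder ^^ k) f) t)) (at t)"
    by (intro bounded_linear.has_vector_derivative[OF assms(1)]
        tder_has_vector_derivative[OF C_inf_on_tder[OF assms(3)] Suc.prems])
  then have "tder (\<lambda>t. L ((tder ^^ k) f t)) t = L (tder ((tder ^^ k) f) t)" by (rule tder_eq)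
  then show ?case
    using frechet_derivative_cong_open[OF assms(2) Suc.prems Suc.IH] by simp
qed simp

lemma tder_add:
  assumes "open N" "C_inf_on N f" "C_inf_on N g" "t \<in> N"
  shows "(tder ^^ k) (\<lambda>t. f t + g t) t = (tder ^^ k) f t + (tder ^^ k) g t"
  using assms(4)
proof (induction k arbitrary: t)
  case (Suc k)
  have "((\<lambda>t. (tder ^^ k) f t + (tder ^^ k) g t) has_vector_derivative
      tder ((tder ^^ k) f) t + tder ((tder ^^ k) g) t) (at t)"
    by (intro has_vector_derivative_add tder_has_vector_derivative[OF C_inf_on_tder[OF assms(2)] Suc.prems]
        tder_has_vector_derivative[OF C_inf_on_tder[OF assms(3)] Suc.prems])
  then have "tder (\<lambda>t. (tder ^^ k) f t + (tder ^^ k) g t) t = tder ((tder ^^ k) f) t + tder ((tder ^^ k) g) t"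
    by (rule tder_eq)
  then show ?case
    using frechet_derivative_cong_open[OF assms(1) Suc.prems Suc.IH] by simp
qed simp

text \<open>At t = 0 it says that the k-th Taylor coefficient along an orbit is homogeneous of
  degree k. This is the source of all homogeneity below.\<close>

lemma tder_scale_arg:
  assumes "open N" "C_inf_on N f" "s * t \<in> N"
  shows "(tder ^^ k) (\<lambda>t. f (s * t)) t = s ^ k *\<^sub>R (tder ^^ k) f (s * t)"
  using assms(3)
proof (induction k arbitrary: t)
  case (Suc k)
  have o: "open ((\<lambda>t. s * t) -` N)" using assms(1) by (intro open_vimage continuous_intros)
  have "((\<lambda>t. s * t) has_vector_derivative s) (at t)"
    by (auto intro!: derivative_eq_intros simp: has_vector_derivative_def)
  then have "(((tder ^^ k) f \<circ> (\<lambda>t. s * t)) has_vector_derivative s *\<^sub>R tder ((tder ^^ k) f) (s * t)) (at t)"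
    by (rule vector_diff_chain_at) (rule tder_has_vector_derivative[OF C_inf_on_tder[OF assms(2)] Suc.prems])
  then have "((\<lambda>t. s ^ k *\<^sub>R (tder ^^ k) f (s * t)) has_vector_derivative
      s ^ k *\<^sub>R (s *\<^sub>R tder ((tder ^^ k) f) (s * t))) (at t)"
    unfolding o_def by (rule bounded_linear.has_vector_derivative[OF bounded_linear_scaleR_right])
  then have "tder (\<lambda>t. s ^ k *\<^sub>R (tder ^^ k) f (s * t)) t = s ^ Suc k *\<^sub>R tder ((tder ^^ k) f) (s * t)"
    using tder_eq by fastforce
  then show ?case
    using frechet_derivative_cong_open[OF o, of t "(tder ^^ k) (\<lambda>t. f (s * t))"] Suc by simp
qed simp

text \<open>The \<open>pochhammer\<close> factor is the falling factorial j (j - 1) ... (j - k + 1).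
  It is 0 for j < k, so the truncated subtraction in the exponent does no harm there.\<close>

lemma tder_power: "(tder ^^ k) (\<lambda>t. t ^ j *\<^sub>R v) = (\<lambda>t. (pochhammer (of_nat j - of_nat k + 1) k * t ^ (j - k)) *\<^sub>R v)"
proof (induction k)
  case (Suc k)
  have d: "((\<lambda>t. (pochhammer (of_nat j - of_nat k + 1) k * t ^ (j - k)) *\<^sub>R v) has_vector_derivative
     (pochhammer (of_nat j - of_nat k + 1) k * (of_nat (j - k) * t ^ (j - k - 1))) *\<^sub>R v) (at t)" for t :: real
    unfolding has_vector_derivative_def
    by (auto intro!: derivative_eq_intros simp: algebra_simps)
  have p: "pochhammer (of_nat j - of_nat k + 1) k * of_nat (j - k)
      = pochhammer (of_nat j - of_nat (Suc k) + 1 :: real) (Suc k)"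
  proof (cases "k \<le> j")
    case True
    then show ?thesis by (simp add: pochhammer_rec of_nat_diff algebra_simps)
  next
    case False
    then have "pochhammer (of_nat j - of_nat (Suc k) + 1 :: real) (Suc k) = 0"
      by (simp add: pochhammer_eq_0_iff) (intro exI[of _ "k - j"], simp add: of_nat_diff)
    then show ?thesis using False by simp
  qed
  show ?case
  proof
    fix t
    have "(tder ^^ Suc k) (\<lambda>t. t ^ j *\<^sub>R v) t = tder ((tder ^^ k) (\<lambda>t. t ^ j *\<^sub>R v)) t" by simp
    also have "\<dots> = (pochhammer (of_nat j - of_nat k + 1) k * (of_nat (j - k) * t ^ (j - k - 1))) *\<^sub>R v"
      unfolding Suc by (rule tder_eq[OF d])
    also have "\<dots> = (pochhammer (of_nat j - of_nat (Suc k) + 1) (Suc k) * t ^ (j - Suc k)) *\<^sub>R v"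
      unfolding p[symmetric] by (simp add: mult.assoc)
    finally show "(tder ^^ Suc k) (\<lambda>t. t ^ j *\<^sub>R v) t =
      (pochhammer (of_nat j - of_nat (Suc k) + 1) (Suc k) * t ^ (j - Suc k)) *\<^sub>R v" .
  qed
qed simp

lemma tder_power_0: "(tder ^^ k) (\<lambda>t. t ^ j *\<^sub>R v) 0 = (if j = k then fact k *\<^sub>R v else 0)"
proof -
  have "pochhammer (of_nat j - of_nat k + 1 :: real) k = 0" if "j < k"
    using that by (simp add: pochhammer_eq_0_iff) (intro exI[of _ "k - j - 1"], simp add: of_nat_diff)
  moreover have "pochhammer (1::real) k = fact k" by (simp add: pochhammer_fact)
  ultimately show ?thesis by (cases j k rule: linorder_cases) (simp_all add: tder_power)
qed

text \<open>If all Taylor coefficients at \<open>0\<close> of \<open>t \<mapsto> D t v\<close> vanish, then \<open>D (2\<^sup>-\<^sup>n) v\<close> decays faster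
  than any exponential, whereas \<open>D (2\<^sup>n)\<close> grows at most exponentially. Their product is \<open>D 1\<close>.\<close>

lemma flat_monoid_hom:
  fixes D :: "real \<Rightarrow> 'e::euclidean_space \<Rightarrow> 'e"
  assumes lin: "\<And>t. linear (D t)" and smooth: "C_inf_on UNIV (\<lambda>t. D t v)"
    and hom: "\<And>s t v. D (s * t) v = D s (D t v)"
    and flat: "\<And>k. (tder ^^ k) (\<lambda>t. D t v) 0 = 0"
  shows "D 1 v = 0"
proof -
  let ?d = "\<lambda>k. (tder ^^ k) (\<lambda>t. D t v)"
  \<comment> \<open>Taylor's formula of order n in each coordinate, with all lower coefficients
    equal to 0.\<close>
  have bound: "\<exists>C. \<forall>x. \<bar>x\<bar> \<le> 1 \<longrightarrow> norm (D x v) \<le> C * \<bar>x\<bar> ^ n" for n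
  proof -
    have "continuous_on {-1..1} (?d n)"
      using C_inf_on_continuous[OF C_inf_on_tder[OF smooth]] continuous_on_subset by blast
    then have "bounded (?d n ` {-1..1})"
      by (intro compact_imp_bounded compact_continuous_image compact_Icc)
    then obtain C where C: "\<And>t. t \<in> {-1..1} \<Longrightarrow> norm (?d n t) \<le> C" unfolding bounded_iff by blast
    have "norm (D x v) \<le> (of_nat (card (Basis :: 'e set)) * C) * \<bar>x\<bar> ^ n" if x: "\<bar>x\<bar> \<le> 1" for x
    proof -
      have "\<bar>D x v \<bullet> b\<bar> \<le> C * \<bar>x\<bar> ^ n" if b: "b \<in> Basis" for b
      proof -
        let ?e = "\<lambda>k t. ?d k t \<bullet> b"
        have "\<forall>m x. DERIV (?e m) x :> ?e (Suc m) x"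
          unfolding has_real_derivative_iff_has_vector_derivative
          using tder_has_vector_derivative[OF C_inf_on_tder[OF smooth]]
          by (auto intro!: bounded_linear.has_vector_derivative[OF bounded_linear_inner_left])
        then obtain t where t: "\<bar>t\<bar> \<le> \<bar>x\<bar>"
          "D x v \<bullet> b = (\<Sum>m<n. (?e m 0 / fact m) * x ^ m) + (?e n t / fact n) * x ^ n"
          using Maclaurin_all_le[of ?e "\<lambda>x. D x v \<bullet> b" x n] by auto
        then have "\<bar>D x v \<bullet> b\<bar> = \<bar>?e n t\<bar> / fact n * \<bar>x\<bar> ^ n"
          by (simp add: flat abs_mult power_abs)
        also have "\<dots> \<le> C * \<bar>x\<bar> ^ n"
        proof (rule mult_right_mono)
          have "t \<in> {-1..1}" using t(1) x by (auto simp: abs_le_iff)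
          then have "\<bar>?e n t\<bar> \<le> C" using order_trans[OF Basis_le_norm[OF b] C] by blast
          moreover have "\<bar>?e n t\<bar> / fact n \<le> \<bar>?e n t\<bar> / 1"
            by (intro divide_left_mono) (auto simp: fact_ge_1)
          ultimately show "\<bar>?e n t\<bar> / fact n \<le> C" by simp
        qed simp
        finally show ?thesis .
      qed
      then have "(\<Sum>b\<in>Basis. \<bar>D x v \<bullet> b\<bar>) \<le> of_nat (card (Basis :: 'e set)) * (C * \<bar>x\<bar> ^ n)"
        by (intro sum_bounded_above)
      then show ?thesis using norm_le_l1[of "D x v"] by (simp add: mult.assoc)
    qed
    then show ?thesis by blast
  qed
  obtain c where c: "c > 0" "\<And>z. norm (D 2 z) \<le> norm z * c"
    using bounded_linear.pos_bounded[of "D 2"] lin by (auto simp: linear_conv_bounded_linear)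
  have grow: "norm (D (2 ^ n * s) v) \<le> c ^ n * norm (D s v)" for n s
  proof (induction n)
    case (Suc n)
    have "norm (D (2 ^ Suc n * s) v) = norm (D 2 (D (2 ^ n * s) v))"
      by (simp flip: hom add: mult.assoc)
    also have "\<dots> \<le> norm (D (2 ^ n * s) v) * c" by (rule c(2))
    also have "\<dots> \<le> c ^ n * norm (D s v) * c" using Suc c(1) by (simp add: mult_right_mono)
    finally show ?case by (simp add: mult_ac)
  qed simp
  \<comment> \<open>The order of decay is chosen to beat the growth factor \<open>c\<close> of
    \<open>D 2\<close>.\<close>
  obtain m where m: "c < 2 ^ m" using real_arch_pow[of 2 c] by auto
  obtain C where C: "\<And>x. \<bar>x\<bar> \<le> 1 \<Longrightarrow> norm (D x v) \<le> C * \<bar>x\<bar> ^ m" using bound by blast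
  have "norm (D 1 v) \<le> C * (c / 2 ^ m) ^ n" for n
  proof -
    have "norm (D (2 ^ n * (1 / 2 ^ n)) v) \<le> c ^ n * norm (D (1 / 2 ^ n) v)" by (rule grow)
    also have "\<dots> \<le> c ^ n * (C * \<bar>1 / 2 ^ n\<bar> ^ m)"
      using c(1) by (intro mult_left_mono C) (auto simp: divide_simps)
    also have "\<dots> = C * (c / 2 ^ m) ^ n"
      by (simp add: power_divide flip: power_mult) (simp add: mult.commute)
    finally show ?thesis by simp
  qed
  moreover have "(\<lambda>n. C * (c / 2 ^ m) ^ n) \<longlonglongrightarrow> C * 0"
    using c(1) m by (intro tendsto_mult tendsto_const LIMSEQ_power_zero) simp
  ultimately have "norm (D 1 v) \<le> C * 0" by (intro LIMSEQ_le_const) auto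
  then show ?thesis by simp
qed

text \<open>A basis \<open>C\<close> of common eigenvectors is extracted from the ranges of the
  Taylor coefficients \<open>P k\<close>. The map \<open>L\<close> sends it to \<open>B\<close> by
  an arbitrary bijection, and \<open>w b\<close> is the weight of the eigenvector that becomes
  b.\<close>

lemma monoid_hom_diagonal:
  fixes D :: "real \<Rightarrow> 'e::euclidean_space \<Rightarrow> 'e"
  assumes lin: "\<And>t. linear (D t)" and smooth: "\<And>v. C_inf_on UNIV (\<lambda>t. D t v)"
    and hom: "\<And>s t v. D (s * t) v = D s (D t v)"
    and B: "B \<subseteq> Basis" "\<And>t v. D t v \<in> span B" "\<And>v. v \<in> span B \<Longrightarrow> D 1 v = v"
  obtains L w where "linear L" "inj_on L (span B)" "L ` span B \<subseteq> span B"
    "\<And>t v b. v \<in> span B \<Longrightarrow> b \<in> B \<Longrightarrow> L (D t v) \<bullet> b = t ^ w b * (L v \<bullet> b)"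
proof -
  define P where "P k v = (1 / fact k) *\<^sub>R (tder ^^ k) (\<lambda>t. D t v) 0" for k v
  have bl: "bounded_linear (D t)" for t using lin linear_conv_bounded_linear by blast
  have linP: "linear (P k)" for k
  proof (rule linearI)
    show "P k (x + y) = P k x + P k y" for x y
      unfolding P_def using tder_add[OF open_UNIV smooth smooth UNIV_I]
      by (simp add: linear_add[OF lin] scaleR_add_right)
    show "P k (c *\<^sub>R x) = c *\<^sub>R P k x" for c x
      unfolding P_def using tder_linear[OF bounded_linear_scaleR_right open_UNIV smooth UNIV_I]
      by (simp add: linear_scale[OF lin])
  qed
  \<comment> \<open>Differentiate \<open>D s (D t v) = D (s * t) v\<close> k times with respect to t
    at t = 0.\<close>
  have DP: "D s (P k v) = s ^ k *\<^sub>R P k v" for s k v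
  proof -
    have "D s ((tder ^^ k) (\<lambda>t. D t v) 0) = (tder ^^ k) (\<lambda>t. D s (D t v)) 0"
      by (rule tder_linear[OF bl open_UNIV smooth UNIV_I, symmetric])
    also have "\<dots> = s ^ k *\<^sub>R (tder ^^ k) (\<lambda>t. D t v) (s * 0)"
      unfolding hom[symmetric] by (rule tder_scale_arg[OF open_UNIV smooth]) simp
    finally show ?thesis by (simp add: P_def linear_scale[OF lin])
  qed
  \<comment> \<open>By \<open>DP\<close> the curve t \<mapsto> \<open>D t (P k v)\<close> is a
    monomial of degree k, so its only Taylor coefficient that can be nonzero is the k-th.\<close>
  have PP: "P j (P k v) = (if j = k then P k v else 0)" for j k v
    unfolding P_def[of j] by (simp add: DP tder_power_0)
  have P0: "D 1 v = 0" if "\<And>k. P k v = 0" for v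
    using that by (intro flat_monoid_hom[OF lin smooth hom]) (simp add: P_def)
  define S where "S = (\<Union>k. range (P k))"
  \<comment> \<open>\<open>S\<close> collects the ranges for infinitely many k, but an independent
    subset is finite. Hence only finitely many weights occur.\<close>
  obtain C where C: "C \<subseteq> S" "independent C" "S \<subseteq> span C" using maximal_independent_subset[of S] .
  have finC: "finite C" using C(2) independent_imp_finite by blast
  have "\<forall>c\<in>C. \<exists>k. P k c = c"
  proof
    fix c assume "c \<in> C"
    then obtain k u where "c = P k u" using C(1) unfolding S_def by blast
    then show "\<exists>k. P k c = c" using PP[of k k u] by auto
  qed
  then obtain wt where wt: "\<And>c. c \<in> C \<Longrightarrow> P (wt c) c = c" by metis
  have Pc: "P j c = 0" if "c \<in> C" "j \<noteq> wt c" for j c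
    using PP[of j "wt c" c] wt[OF that(1)] that(2) by simp
  \<comment> \<open>\<open>P j\<close> vanishes on \<open>C\<close> and hence on its own range, but
    it is idempotent.\<close>
  have Pzero: "P j u = 0" if j: "j \<notin> wt ` C" for j u
  proof -
    have "P j c = 0" if "c \<in> C" for c using that j by (intro Pc) auto
    moreover have "P j u \<in> span C" using C(3) unfolding S_def by blast
    ultimately have "P j (P j u) = 0" using linear_eq_0_on_span[OF linP] by blast
    then show ?thesis using PP[of j j u] by simp
  qed
  have PB: "P k v \<in> span B" for k v using DP[of 1 k v] B(2)[of 1 "P k v"] by simp
  have spanCB: "span C = span B"
  proof
    show "span C \<subseteq> span B"
      using C(1) PB unfolding S_def by (intro span_minimal subspace_span) blast
    show "span B \<subseteq> span C"
    proof
      fix v assume v: "v \<in> span B"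
      let ?s = "\<Sum>k\<in>wt ` C. P k v"
      \<comment> \<open>With all Taylor coefficients gone, flatness gives
        \<open>D 1 (v - ?s) = 0\<close>, and \<open>D 1\<close> is the identity on
        \<open>span B\<close>. So v is the sum of its components.\<close>
      have "P j (v - ?s) = 0" for j
      proof -
        have "P j ?s = (\<Sum>k\<in>wt ` C. if j = k then P k v else 0)"
          by (simp add: linear_sum[OF linP] PP)
        also have "\<dots> = P j v" using finC Pzero[of j v] by simp
        finally show ?thesis by (simp add: linear_diff[OF linP])
      qed
      moreover have "v - ?s \<in> span B" using v PB by (intro span_diff span_sum)
      ultimately have "v = ?s" using P0[of "v - ?s"] B(3)[of "v - ?s"] by simp
      moreover have "?s \<in> span C" using C(3) unfolding S_def by (intro span_sum) blast
      ultimately show "v \<in> span C" by simp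
    qed
  qed
  have indB: "independent B" using B(1) independent_Basis independent_mono by blast
  have "card C = card B"
    using dim_span_eq_card_independent[OF C(2)] dim_span_eq_card_independent[OF indB] spanCB by simp
  then obtain \<sigma> where \<sigma>: "bij_betw \<sigma> C B"
    using finC finite_subset_Basis[OF B(1)] finite_same_card_bij by blast
  obtain L where L: "linear L" "\<And>c. c \<in> C \<Longrightarrow> L c = \<sigma> c"
    using linear_independent_extend[OF C(2)] by blast
  have LC: "L ` C = B" using \<sigma> L(2) by (auto simp: bij_betw_def)
  define w where "w = (\<lambda>b. wt (inv_into C \<sigma> b))"
  have key: "L (D t v) \<bullet> b = t ^ w b * (L v \<bullet> b)" if v: "v \<in> span C" and b: "b \<in> B" for t v b
  proof -
    have l1: "linear (\<lambda>v. L (D t v) \<bullet> b)" "linear (\<lambda>v. t ^ w b * (L v \<bullet> b))"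
      using L(1) lin[of t] by (auto intro!: linearI simp: linear_add linear_scale algebra_simps)
    have "L (D t c) \<bullet> b = t ^ w b * (L c \<bullet> b)" if c: "c \<in> C" for c
    proof -
      have "D t c = t ^ wt c *\<^sub>R c" using DP[of t "wt c" c] wt[OF c] by simp
      then have 1: "L (D t c) \<bullet> b = t ^ wt c * (\<sigma> c \<bullet> b)" using L c by (simp add: linear_scale)
      show ?thesis
      proof (cases "\<sigma> c = b")
        case True
        then have "w b = wt c" using \<sigma> c by (simp add: w_def bij_betw_def inv_into_f_eq)
        then show ?thesis using 1 L(2)[OF c] by simp
      next
        case False
        then have "\<sigma> c \<bullet> b = 0" using \<sigma> c b B(1) by (auto simp: inner_Basis bij_betw_def subset_iff)
        then show ?thesis using 1 L(2)[OF c] by simp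
      qed
    qed
    then show ?thesis using linear_eq_on_span[OF l1 _ v] by blast
  qed
  have "inj_on L (span C)"
    using linear_inj_on_span_independent_image[OF L(1), of C] LC indB \<sigma> L(2)
    by (metis bij_betw_def inj_on_cong)
  moreover have "L ` span C \<subseteq> span B"
    using LC by (metis L(1) linear_span_image order_refl)
  ultimately show ?thesis using that[of L w] L(1) key unfolding spanCB by blast
qed

section \<open>Homogeneous functions are polynomial\<close>

text \<open>A positive weight bounds each exponent by k.\<close>

lemma finite_weighted_exponents:
  assumes "finite B" "\<And>b. b \<in> B \<Longrightarrow> w b > 0"
  shows "finite (weighted_exponents B w k)"
proof (rule finite_subset)
  show "weighted_exponents B w k \<subseteq> {m. \<forall>b. (b \<in> B \<longrightarrow> m b \<in> {..k}) \<and> (b \<notin> B \<longrightarrow> m b = 0)}"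
  proof (clarsimp simp: weighted_exponents_def)
    fix m b assume b: "b \<in> B"
    have "m b \<le> m b * w b" using assms(2)[OF b] by simp
    also have "\<dots> \<le> (\<Sum>b\<in>B. m b * w b)" using assms(1) b by (intro member_le_sum) auto
    finally show "m b \<le> (\<Sum>b\<in>B. m b * w b)" .
  qed
  show "finite {m. \<forall>b. (b \<in> B \<longrightarrow> m b \<in> {..k}) \<and> (b \<notin> B \<longrightarrow> m b = (0::nat))}"
    using assms(1) by (intro finite_set_of_finite_funs) auto
qed

lemma weighted_polynomial_cong:
  "weighted_polynomial B w k P \<Longrightarrow> (\<And>y. y \<in> span B \<Longrightarrow> P y = Q y) \<Longrightarrow> weighted_polynomial B w k Q"
  unfolding weighted_polynomial_def by auto

lemma weighted_polynomial_0: "weighted_polynomial B w k (\<lambda>y. 0)"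
  unfolding weighted_polynomial_def by (intro exI[of _ "\<lambda>m. 0"]) simp

lemma weighted_polynomial_add:
  assumes "weighted_polynomial B w k P" "weighted_polynomial B w k Q"
  shows "weighted_polynomial B w k (\<lambda>y. P y + Q y)"
proof -
  obtain c d where "\<forall>y\<in>span B. P y = (\<Sum>m\<in>weighted_exponents B w k. c m * (\<Prod>b\<in>B. (y \<bullet> b) ^ m b))"
    "\<forall>y\<in>span B. Q y = (\<Sum>m\<in>weighted_exponents B w k. d m * (\<Prod>b\<in>B. (y \<bullet> b) ^ m b))"
    using assms unfolding weighted_polynomial_def by blast
  then show ?thesis
    unfolding weighted_polynomial_def
    by (intro exI[of _ "\<lambda>m. c m + d m"]) (simp add: distrib_right sum.distrib)
qed

lemma weighted_polynomial_scale:
  assumes "weighted_polynomial B w k P"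
  shows "weighted_polynomial B w k (\<lambda>y. r * P y)"
proof -
  obtain c where "\<forall>y\<in>span B. P y = (\<Sum>m\<in>weighted_exponents B w k. c m * (\<Prod>b\<in>B. (y \<bullet> b) ^ m b))"
    using assms unfolding weighted_polynomial_def by blast
  then show ?thesis
    unfolding weighted_polynomial_def
    by (intro exI[of _ "\<lambda>m. r * c m"]) (simp add: sum_distrib_left mult.assoc)
qed

lemma weighted_polynomial_sum:
  "(\<And>i. i \<in> I \<Longrightarrow> weighted_polynomial B w k (P i)) \<Longrightarrow> weighted_polynomial B w k (\<lambda>y. \<Sum>i\<in>I. P i y)"
  by (induction I rule: infinite_finite_induct) (simp_all add: weighted_polynomial_0 weighted_polynomial_add)

lemma weighted_polynomial_const:
  assumes "finite B" "\<And>b. b \<in> B \<Longrightarrow> w b > 0"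
  shows "weighted_polynomial B w 0 (\<lambda>y. r)"
proof -
  have "weighted_exponents B w 0 = {\<lambda>b. 0}"
    using assms by (auto simp: weighted_exponents_def fun_eq_iff) (metis less_irrefl)
  then show ?thesis
    unfolding weighted_polynomial_def by (intro exI[of _ "\<lambda>m. r"]) simp
qed

text \<open>Raising the exponent of b by one embeds the exponents of weight \<open>k - w b\<close>
  into those of weight k. The image consists of the monomials divisible by the coordinate b, which
  explains the coefficient 0 on the others.\<close>

lemma weighted_polynomial_mult_coord:
  assumes B: "finite B" "\<And>b. b \<in> B \<Longrightarrow> w b > 0" and b: "b \<in> B" "w b \<le> k"
    and P: "weighted_polynomial B w (k - w b) P"
  shows "weighted_polynomial B w k (\<lambda>y. (y \<bullet> b) * P y)"
proof -
  let ?E = "weighted_exponents B w"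
  obtain c where c: "\<forall>y\<in>span B. P y = (\<Sum>m\<in>?E (k - w b). c m * (\<Prod>b\<in>B. (y \<bullet> b) ^ m b))"
    using P unfolding weighted_polynomial_def by blast
  let ?up = "\<lambda>m. m(b := m b + 1)" and ?down = "\<lambda>m. m(b := m b - 1)"
  let ?c = "\<lambda>m. if m b = 0 then 0 else c (?down m)"
  have wsum: "(\<Sum>b'\<in>B. ?up m b' * w b') = (\<Sum>b'\<in>B. m b' * w b') + w b" for m
    using B(1) b(1) by (simp add: sum.remove[OF B(1) b(1)])
  have bij: "bij_betw ?up (?E (k - w b)) {m \<in> ?E k. m b \<noteq> 0}"
  proof (rule bij_betwI[where g = ?down])
    show "?up \<in> ?E (k - w b) \<rightarrow> {m \<in> ?E k. m b \<noteq> 0}"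
      using b wsum by (auto simp: weighted_exponents_def)
    show "?down \<in> {m \<in> ?E k. m b \<noteq> 0} \<rightarrow> ?E (k - w b)"
    proof
      fix m assume m: "m \<in> {m \<in> ?E k. m b \<noteq> 0}"
      then have "?up (?down m) = m" by auto
      then have "(\<Sum>b'\<in>B. m b' * w b') = (\<Sum>b'\<in>B. ?down m b' * w b') + w b"
        using wsum[of "?down m"] by simp
      then show "?down m \<in> ?E (k - w b)" using m b by (auto simp: weighted_exponents_def)
    qed
  qed auto
  have "(y \<bullet> b) * P y = (\<Sum>m\<in>?E k. ?c m * (\<Prod>b\<in>B. (y \<bullet> b) ^ m b))" if y: "y \<in> span B" for y
  proof -
    have "(y \<bullet> b) * P y = (\<Sum>m\<in>?E (k - w b). c m * ((y \<bullet> b) * (\<Prod>b\<in>B. (y \<bullet> b) ^ m b)))"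
      using c y by (simp add: sum_distrib_left mult.left_commute)
    also have "\<dots> = (\<Sum>m\<in>?E (k - w b). ?c (?up m) * (\<Prod>b\<in>B. (y \<bullet> b) ^ ?up m b))"
    proof (rule sum.cong[OF refl])
      fix m
      have "(\<Prod>b\<in>B. (y \<bullet> b) ^ ?up m b) = (y \<bullet> b) * (\<Prod>b\<in>B. (y \<bullet> b) ^ m b)"
        using B(1) b(1) by (simp add: prod.remove[OF B(1) b(1)])
      then show "c m * ((y \<bullet> b) * (\<Prod>b\<in>B. (y \<bullet> b) ^ m b)) = ?c (?up m) * (\<Prod>b\<in>B. (y \<bullet> b) ^ ?up m b)"
        by simp
    qed
    also have "\<dots> = (\<Sum>m | m \<in> ?E k \<and> m b \<noteq> 0. ?c m * (\<Prod>b\<in>B. (y \<bullet> b) ^ m b))"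
      by (rule sum.reindex_bij_betw[OF bij])
    also have "\<dots> = (\<Sum>m\<in>?E k. ?c m * (\<Prod>b\<in>B. (y \<bullet> b) ^ m b))"
      by (rule sum.mono_neutral_left) (use finite_weighted_exponents[of B w k] B in auto)
    finally show ?thesis .
  qed
  then show ?thesis unfolding weighted_polynomial_def by (intro exI[of _ ?c] ballI)
qed

lemma weighted_polynomial_dil:
  assumes "B \<subseteq> Basis" "weighted_polynomial B w k P" "y \<in> span B"
  shows "P (dil B w t y) = t ^ k * P y"
proof -
  obtain c where c: "\<forall>y\<in>span B. P y = (\<Sum>m\<in>weighted_exponents B w k. c m * (\<Prod>b\<in>B. (y \<bullet> b) ^ m b))"
    using assms unfolding weighted_polynomial_def by blast
  have "(\<Prod>b\<in>B. (dil B w t y \<bullet> b) ^ m b) = t ^ k * (\<Prod>b\<in>B. (y \<bullet> b) ^ m b)"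
    if m: "m \<in> weighted_exponents B w k" for m
  proof -
    have "(\<Prod>b\<in>B. (dil B w t y \<bullet> b) ^ m b) = (\<Prod>b\<in>B. t ^ (m b * w b) * (y \<bullet> b) ^ m b)"
      by (intro prod.cong) (simp_all add: dil_inner[OF assms(1)] power_mult_distrib mult.commute flip: power_mult)
    also have "\<dots> = t ^ (\<Sum>b\<in>B. m b * w b) * (\<Prod>b\<in>B. (y \<bullet> b) ^ m b)"
      by (simp add: prod.distrib power_sum)
    finally show ?thesis using m by (simp add: weighted_exponents_def)
  qed
  then show ?thesis
    using c assms(3) dil_in_span[of B w t y] by (simp add: sum_distrib_left mult.left_commute)
qed

lemma tendsto_dil_0:
  assumes "B \<subseteq> Basis" "\<And>b. b \<in> B \<Longrightarrow> w b > 0"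
  shows "((\<lambda>t. dil B w t y) \<longlongrightarrow> 0) (at_right 0)"
proof -
  have "((\<lambda>t. dil B w t y) \<longlongrightarrow> (\<Sum>b\<in>B. (0 ^ w b * (y \<bullet> b)) *\<^sub>R b)) (at_right 0)"
    unfolding dil_def by (intro tendsto_intros)
  moreover have "(\<Sum>b\<in>B. ((0::real) ^ w b * (y \<bullet> b)) *\<^sub>R b) = 0"
    using assms(2) by (intro sum.neutral) auto
  ultimately show ?thesis by simp
qed

text \<open>Strong induction on the weight: the derivative along b is homogeneous of weight
  \<open>k - w b\<close>, which is smaller than k as \<open>w b\<close> is positive, and Euler's
  identity recovers \<open>g\<close> from these derivatives. If the weight would be negative,
  continuity at 0 makes the derivative vanish.\<close>

lemma homogeneous_C_inf_weighted_polynomial: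
  fixes g :: "'f::euclidean_space \<Rightarrow> real"
  assumes B: "B \<subseteq> Basis" and w: "\<And>b. b \<in> B \<Longrightarrow> w b > 0"
    and "C_inf_on UNIV g" "\<And>t y. t > 0 \<Longrightarrow> g (dil B w t y) = t ^ k * g y"
  shows "weighted_polynomial B w k g"
  using assms(3,4)
proof (induction k arbitrary: g rule: less_induct)
  case (less k)
  note finB = finite_subset_Basis[OF B]
  have pos: "eventually (\<lambda>t::real. t > 0) (at_right 0)"
    by (rule eventually_at_right_less)
  have lim: "((\<lambda>t. F (dil B w t y)) \<longlongrightarrow> F 0) (at_right 0)" if "C_inf_on UNIV F" for F :: "'f \<Rightarrow> real" and y
  proof -
    have "isCont F 0" using C_inf_on_continuous[OF that] by (simp add: continuous_on_eq_continuous_at)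
    moreover have "((\<lambda>t. dil B w t y) \<longlongrightarrow> 0) (at_right 0)" using tendsto_dil_0[OF B] w by blast
    ultimately show ?thesis by (rule isCont_tendsto_compose)
  qed
  show ?case
  proof (cases "k = 0")
    case True
    \<comment> \<open>In weight 0 the function is constant along orbits, and these tend to
      0.\<close>
    have "g y = g 0" for y
    proof -
      have "((\<lambda>t. g (dil B w t y)) \<longlongrightarrow> g y) (at_right 0)"
        by (rule tendsto_eventually) (use pos less.prems(2) True in \<open>auto elim!: eventually_mono\<close>)
      then show ?thesis using lim[OF less.prems(1)] tendsto_unique[OF trivial_limit_at_right_real] by blast
    qed
    then show ?thesis
      using weighted_polynomial_cong[OF weighted_polynomial_const[of B w "g 0"], of g] finB w True by metis
  next
    case False
    note der = C_inf_on_has_derivative[OF less.prems(1) UNIV_I]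
    have hom: "t ^ w b * dird b g (dil B w t y) = t ^ k * dird b g y" if b: "b \<in> B" and t: "t > 0" for b t y
    proof -
      have db: "dil B w t b = t ^ w b *\<^sub>R b"
        using b B by (intro in_span_Basis_eqI[OF B dil_in_span])
          (auto simp: dil_inner[OF B] span_base span_scale inner_Basis subset_iff)
      have "((\<lambda>y. g (dil B w t y)) has_derivative
          (\<lambda>v. frechet_derivative g (at (dil B w t y)) (dil B w t v))) (at y)"
        by (rule has_derivative_compose[OF _ der]) (rule linear_imp_has_derivative[OF linear_dil])
      moreover have "((\<lambda>y. g (dil B w t y)) has_derivative (\<lambda>v. t ^ k * dird v g y)) (at y)"
        unfolding less.prems(2)[OF t] by (intro has_derivative_mult_right der)
      ultimately have "dird (dil B w t b) g (dil B w t y) = t ^ k * dird b g y"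
        using has_derivative_unique by metis
      then show ?thesis
        by (simp add: db linear_scale[OF bounded_linear.linear[OF has_derivative_bounded_linear[OF der]]])
    qed
    have wp: "weighted_polynomial B w k (\<lambda>y. (y \<bullet> b) * dird b g y)" if b: "b \<in> B" for b
    proof (cases "w b \<le> k")
      case True
      have "weighted_polynomial B w (k - w b) (dird b g)"
      proof (rule less.IH)
        show "k - w b < k" using w[OF b] False by simp
        show "C_inf_on UNIV (dird b g)" by (rule C_inf_on_dird[OF less.prems(1)])
        show "dird b g (dil B w t y) = t ^ (k - w b) * dird b g y" if "t > 0" for t y
          using hom[OF b that, of y] True that by (simp add: power_diff field_simps)
      qed
      then show ?thesis using weighted_polynomial_mult_coord[of B w b k] finB w b True by blast
    next
      case False
      \<comment> \<open>By homogeneity this value equals \<open>t ^ (w b - k)\<close> times the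
        derivative at a point tending to 0; the first factor tends to 0 and the second one
        converges.\<close>
      have "dird b g y = 0" for y
      proof -
        have "((\<lambda>t. t ^ (w b - k) * dird b g (dil B w t y)) \<longlongrightarrow> 0 ^ (w b - k) * dird b g 0) (at_right 0)"
          by (intro tendsto_intros lim C_inf_on_dird[OF less.prems(1)])
        moreover have "((\<lambda>t. t ^ (w b - k) * dird b g (dil B w t y)) \<longlongrightarrow> dird b g y) (at_right 0)"
        proof (rule tendsto_eventually, use pos in eventually_elim)
          case (elim t)
          then show ?case using hom[OF b elim, of y] False by (simp add: power_diff field_simps)
        qed
        ultimately have "dird b g y = 0 ^ (w b - k) * dird b g 0"
          using tendsto_unique[OF trivial_limit_at_right_real] by blast
        then show ?thesis using False by simp
      qed
      then show ?thesis by (simp add: weighted_polynomial_0)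
    qed
    have euler: "g y = (1 / k) * (\<Sum>b\<in>B. w b * ((y \<bullet> b) * dird b g y))" if y: "y \<in> span B" for y
    proof -
      \<comment> \<open>Euler's identity: differentiate \<open>g (dil B w t y) = t ^ k * g y\<close>
        at t = 1 in two ways. Since homogeneity is given for t > 0 only, the second derivative is
        computed on an open half-line.\<close>
      have "((\<lambda>t. dil B w t y) has_derivative (\<lambda>s. s *\<^sub>R (\<Sum>b\<in>B. (w b * (y \<bullet> b)) *\<^sub>R b))) (at 1)"
        unfolding dil_def
        by (auto intro!: derivative_eq_intros simp: scaleR_sum_right mult_ac)
      from has_derivative_compose[OF this, of g "frechet_derivative g (at y)"]
      have d1: "((\<lambda>t. g (dil B w t y)) has_derivative (\<lambda>s. dird (s *\<^sub>R (\<Sum>b\<in>B. (w b * (y \<bullet> b)) *\<^sub>R b)) g y)) (at 1)"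
        using der dil_1[OF B y] by simp
      have d2: "((\<lambda>t. g (dil B w t y)) has_derivative (\<lambda>s. k * s * g y)) (at 1)"
      proof (rule has_derivative_transform_within_open[of "\<lambda>t. t ^ k * g y" _ _ _ "{0<..}"])
        show "((\<lambda>t. t ^ k * g y) has_derivative (\<lambda>s. k * s * g y)) (at 1)"
          by (auto intro!: derivative_eq_intros)
      qed (use less.prems(2) in auto)
      have "dird (1 *\<^sub>R (\<Sum>b\<in>B. (w b * (y \<bullet> b)) *\<^sub>R b)) g y = real k * (1::real) * g y"
        by (rule fun_cong[OF has_derivative_unique[OF d1 d2]])
      moreover have "linear (frechet_derivative g (at y))"
        using has_derivative_bounded_linear[OF der] bounded_linear.linear by blast
      ultimately have "(\<Sum>b\<in>B. (w b * (y \<bullet> b)) * dird b g y) = k * g y"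
        by (simp add: linear_sum linear_scale)
      then show ?thesis using False by (simp add: mult.assoc)
    qed
    have "weighted_polynomial B w k (\<lambda>y. (1 / k) * (\<Sum>b\<in>B. w b * ((y \<bullet> b) * dird b g y)))"
      using wp by (intro weighted_polynomial_scale weighted_polynomial_sum)
    then show ?thesis by (rule weighted_polynomial_cong) (rule euler[symmetric])
  qed
qed

text \<open>Composition with the projection \<open>dil B w 1\<close> extends f from
  \<open>span B\<close> to a smooth homogeneous function on the whole space.\<close>

lemma homogeneous_weighted_polynomial:
  fixes f :: "'f::euclidean_space \<Rightarrow> real"
  assumes B: "B \<subseteq> Basis" and w: "\<And>b. b \<in> B \<Longrightarrow> w b > 0"
    and f: "smooth_on (span B) f" "\<And>t y. y \<in> span B \<Longrightarrow> f (dil B w t y) = t ^ k * f y"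
  shows "weighted_polynomial B w k f"
proof (rule weighted_polynomial_cong)
  have "smooth_on UNIV (\<lambda>y. f (dil B w 1 y))"
    by (rule smooth_on_compose[OF smooth_on_linear[OF linear_dil] f(1)]) (auto simp: dil_in_span)
  then show "weighted_polynomial B w k (\<lambda>y. f (dil B w 1 y))"
  proof (intro homogeneous_C_inf_weighted_polynomial[of B w, OF B w] smooth_on_C_inf_on[OF open_UNIV])
    show "f (dil B w 1 (dil B w t y)) = t ^ k * f (dil B w 1 y)" for t y
      using f(2)[OF dil_in_span[of B w 1 y], of t] by (simp add: dil_dil[OF B])
  qed auto
qed (simp add: dil_1[OF B])

section \<open>Maximal atlases\<close>

lemma smooth_manifold_iff:
  "smooth_manifold M A \<longleftrightarrow>
     (\<forall>U \<phi>. (U, \<phi>) \<in> A \<longrightarrow> is_chart M (U, \<phi>)) \<and> (\<Union>(U, \<phi>)\<in>A. U) = M \<and>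
     (\<forall>U \<phi> V \<psi>. (U, \<phi>) \<in> A \<longrightarrow> (V, \<psi>) \<in> A \<longrightarrow> smooth_on (\<phi> ` (U \<inter> V)) (\<psi> \<circ> inv_into U \<phi>))"
  unfolding smooth_manifold_def by auto

definition maximal_atlas ::
  "'m::{t2_space,second_countable_topology} set \<Rightarrow> ('m, 'e::euclidean_space) chart set \<Rightarrow> ('m, 'e) chart set" where
  "maximal_atlas M A = {c. smooth_manifold M (insert c A)}"

text \<open>Near each point the transition map is factored through a chart \<open>W\<close> of
  \<open>A\<close>, with which both given charts are compatible.\<close>

lemma maximal_atlas_compat:
  assumes A: "smooth_manifold M A" and c: "(U, \<phi>) \<in> maximal_atlas M A" and d: "(V, \<psi>) \<in> maximal_atlas M A"
  shows "smooth_on (\<phi> ` (U \<inter> V)) (\<psi> \<circ> inv_into U \<phi>)"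
proof (rule smooth_on_local)
  have c': "smooth_space M (insert (U, \<phi>) A)" and d': "smooth_space M (insert (V, \<psi>) A)"
    using c d smooth_manifold_space unfolding maximal_atlas_def by auto
  fix x assume "x \<in> \<phi> ` (U \<inter> V)"
  then obtain p where p: "p \<in> U" "p \<in> V" "x = \<phi> p" by blast
  have pM: "p \<in> M" using smooth_space_chart(2)[OF c', of U \<phi>] p by auto
  then obtain W \<rho> where W: "(W, \<rho>) \<in> A" "p \<in> W"
    using smooth_space_ex_chart[OF smooth_manifold_space[OF A]] by metis
  obtain T where T: "open T" "W = M \<inter> T"
    using smooth_space_chart_open[OF smooth_manifold_space[OF A] W(1)] .
  obtain T' where T': "open T'" "\<phi> ` (U \<inter> T) = \<phi> ` U \<inter> T'" using chart_image_open[OF c' _ T(1), of U \<phi>] by auto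
  note injU = smooth_space_chart(3)[OF c', of U \<phi>] and injW = smooth_space_chart(3)[OF c', of W \<rho>]
  have UM: "U \<subseteq> M" using smooth_space_chart(2)[OF c', of U \<phi>] by simp
  have sub: "\<phi> ` (U \<inter> V) \<inter> T' \<subseteq> \<phi> ` (U \<inter> V \<inter> W)"
  proof
    fix z assume z: "z \<in> \<phi> ` (U \<inter> V) \<inter> T'"
    then obtain q where q: "q \<in> U \<inter> V" "z = \<phi> q" by blast
    have "z \<in> \<phi> ` (U \<inter> T)" using z T'(2) by blast
    then obtain q' where "q' \<in> U \<inter> T" "z = \<phi> q'" by blast
    then have "q' = q" using q injU by (auto dest: inj_onD)
    then show "z \<in> \<phi> ` (U \<inter> V \<inter> W)" using q \<open>q' \<in> U \<inter> T\<close> T(2) UM by blast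
  qed
  have s1: "smooth_on (\<phi> ` (U \<inter> V) \<inter> T') (\<lambda>x. \<rho> (inv_into U \<phi> x))"
    using sub by (intro smooth_on_subset[OF smooth_space_compat[OF c', of U \<phi> W \<rho>]]) (use W in auto)
  have "smooth_on (\<phi> ` (U \<inter> V) \<inter> T') (\<lambda>x. \<psi> (inv_into W \<rho> (\<rho> (inv_into U \<phi> x))))"
  proof (rule smooth_on_compose[OF s1])
    show "smooth_on (\<rho> ` (W \<inter> V)) (\<lambda>x. \<psi> (inv_into W \<rho> x))"
      by (rule smooth_space_compat[OF d']) (use W in auto)
    show "(\<lambda>x. \<rho> (inv_into U \<phi> x)) ` (\<phi> ` (U \<inter> V) \<inter> T') \<subseteq> \<rho> ` (W \<inter> V)"
      using sub injU by (auto simp: inv_into_f_f)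
  qed
  then have "smooth_on (\<phi> ` (U \<inter> V) \<inter> T') (\<psi> \<circ> inv_into U \<phi>)"
    by (rule smooth_on_cong) (use sub injU injW W in \<open>auto simp: inv_into_f_f\<close>)
  moreover have "x \<in> T'" using p W T T' by blast
  ultimately show "\<exists>T. open T \<and> x \<in> T \<and> smooth_on (\<phi> ` (U \<inter> V) \<inter> T) (\<psi> \<circ> inv_into U \<phi>)"
    using T' by blast
qed

lemma maximal_atlas_superset: "smooth_manifold M A \<Longrightarrow> A \<subseteq> maximal_atlas M A"
  unfolding maximal_atlas_def by (auto simp: insert_absorb)

lemma smooth_structure_maximal_atlas:
  assumes A: "smooth_manifold M A" shows "smooth_structure M (maximal_atlas M A)"
  unfolding smooth_structure_def
proof (intro conjI allI impI)
  have sup: "A \<subseteq> maximal_atlas M A" by (rule maximal_atlas_superset[OF A])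
  have each: "is_chart M (U, \<phi>)" "U \<subseteq> M" if "(U, \<phi>) \<in> maximal_atlas M A" for U \<phi>
    using that unfolding maximal_atlas_def smooth_manifold_def by auto
  show man: "smooth_manifold M (maximal_atlas M A)"
    unfolding smooth_manifold_def
  proof (intro conjI)
    show "\<forall>c\<in>maximal_atlas M A. is_chart M c" using each by auto
    have "M = (\<Union>(U, \<phi>)\<in>A. U)" using A unfolding smooth_manifold_def by simp
    then show "(\<Union>(U, \<phi>)\<in>maximal_atlas M A. U) = M" using each(2) sup by blast
    show "\<forall>(U, \<phi>)\<in>maximal_atlas M A. \<forall>(V, \<psi>)\<in>maximal_atlas M A.
        smooth_on (\<phi> ` (U \<inter> V)) (\<psi> \<circ> inv_into U \<phi>)"
      using maximal_atlas_compat[OF A] by auto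
  qed
  fix A' assume A': "smooth_manifold M A' \<and> maximal_atlas M A \<subseteq> A'"
  have "smooth_manifold M (insert c A)" if "c \<in> A'" for c
  proof -
    have sub: "insert c A \<subseteq> A'" using that A' sup by blast
    have chart: "U \<subseteq> M" if "(U, \<phi>) \<in> A'" for U \<phi>
      using A' that unfolding smooth_manifold_def by auto
    have "M = (\<Union>(U, \<phi>)\<in>A. U)" using A unfolding smooth_manifold_def by simp
    then have "(\<Union>(U, \<phi>)\<in>insert c A. U) = M" using sub chart by (cases c) auto
    then show ?thesis using A' sub unfolding smooth_manifold_iff by (auto simp: subset_iff)
  qed
  then show "A' = maximal_atlas M A" using A' unfolding maximal_atlas_def by blast
qed

text \<open>Smoothness of the identity in both directions makes the union of the two atlases an
  atlas, and maximality of each one identifies it with the union.\<close>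

lemma smooth_structure_unique:
  assumes "smooth_structure M A" "smooth_structure M A'"
    and "\<And>p. p \<in> M \<Longrightarrow> smooth_at M A A' (\<lambda>x. x) p" "\<And>p. p \<in> M \<Longrightarrow> smooth_at M A' A (\<lambda>x. x) p"
  shows "A = A'"
proof -
  have man: "smooth_manifold M A" "smooth_manifold M A'" using assms unfolding smooth_structure_def by auto
  note sp = smooth_manifold_space[OF man(1)] smooth_manifold_space[OF man(2)]
  have m: "smooth_map M A M A' (\<lambda>x. x)" "smooth_map M A' M A (\<lambda>x. x)"
    using smooth_map_iff[OF sp(1,2)] smooth_map_iff[OF sp(2,1)] assms(3,4) by auto
  have comp: "smooth_on (\<phi> ` (U \<inter> V)) (\<psi> \<circ> inv_into U \<phi>)"
    if "(U, \<phi>) \<in> A \<union> A'" "(V, \<psi>) \<in> A \<union> A'" for U \<phi> V \<psi>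
  proof -
    have V: "(\<lambda>x. x) -` V = V" for V :: "'a set" by auto
    have o: "\<psi> \<circ> (\<lambda>x. x) \<circ> inv_into U \<phi> = \<psi> \<circ> inv_into U \<phi>" by auto
    have "smooth_on (\<phi> ` (U \<inter> V)) (\<psi> \<circ> inv_into U \<phi>)" if "(U, \<phi>) \<in> A" "(V, \<psi>) \<in> A'"
      using m(1) that unfolding smooth_map_def by (fastforce simp: V o)
    moreover have "smooth_on (\<phi> ` (U \<inter> V)) (\<psi> \<circ> inv_into U \<phi>)" if "(U, \<phi>) \<in> A'" "(V, \<psi>) \<in> A"
      using m(2) that unfolding smooth_map_def by (fastforce simp: V o)
    moreover have "smooth_on (\<phi> ` (U \<inter> V)) (\<psi> \<circ> inv_into U \<phi>)" if "(U, \<phi>) \<in> A" "(V, \<psi>) \<in> A"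
      using man(1) that unfolding smooth_manifold_def by blast
    moreover have "smooth_on (\<phi> ` (U \<inter> V)) (\<psi> \<circ> inv_into U \<phi>)" if "(U, \<phi>) \<in> A'" "(V, \<psi>) \<in> A'"
      using man(2) that unfolding smooth_manifold_def by blast
    ultimately show ?thesis using that by blast
  qed
  have "smooth_manifold M (A \<union> A')"
    unfolding smooth_manifold_def
  proof (intro conjI)
    show "\<forall>c\<in>A \<union> A'. is_chart M c" using man unfolding smooth_manifold_def by auto
    have "(\<Union>(U, \<phi>)\<in>A. U) = M" "(\<Union>(U, \<phi>)\<in>A'. U) = M" using man unfolding smooth_manifold_def by auto
    then show "(\<Union>(U, \<phi>)\<in>A \<union> A'. U) = M" by (simp add: UN_Un)
    show "\<forall>(U, \<phi>)\<in>A \<union> A'. \<forall>(V, \<psi>)\<in>A \<union> A'. smooth_on (\<phi> ` (U \<inter> V)) (\<psi> \<circ> inv_into U \<phi>)"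
      using comp by auto
  qed
  then have "A \<union> A' = A" "A \<union> A' = A'" using assms(1,2) unfolding smooth_structure_def by blast+
  then show ?thesis by simp
qed

lemma smooth_at_curve:
  fixes K :: "real \<times> 'm::topological_space \<Rightarrow> 'b::euclidean_space"
  assumes M: "smooth_space M A"
    and K: "smooth_at (UNIV \<times> M) (prod_atlas (euclidean_atlas UNIV) A) (euclidean_atlas UNIV) K (t, p)"
  obtains N where "open N" "t \<in> N" "C_inf_on N (\<lambda>s. K (s, p))"
proof -
  have p: "p \<in> M" using smooth_at_in[OF K] by simp
  note E = smooth_space_euclid[of "UNIV :: real set"]
  have "smooth_at UNIV (euclidean_atlas UNIV) (prod_atlas (euclidean_atlas UNIV) A) (\<lambda>s::real. (s, p)) t"
    by (intro smooth_at_Pair[OF E E M] smooth_at_id[OF E] smooth_at_const[OF E _ M p] UNIV_I)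
  from smooth_at_compose[OF E smooth_space_prod[OF E M] smooth_space_euclid this K]
  obtain N where "open N" "t \<in> N" "smooth_on N (\<lambda>s. K (s, p))"
    unfolding smooth_at_euclid_iff by auto
  then show ?thesis using that smooth_on_C_inf_on by blast
qed

section \<open>Homogeneous coordinates near a fixed point\<close>

lemma smooth_at_nbhd:
  assumes M: "smooth_space M A" and N: "smooth_space N A'" and F: "smooth_at M A A' F p"
    and T: "open T" "F p \<in> T"
  obtains S where "open S" "p \<in> S" "\<And>q. q \<in> M \<Longrightarrow> q \<in> S \<Longrightarrow> F q \<in> T"
proof -
  obtain S where S: "open S" "p \<in> M \<inter> S" "continuous_on (M \<inter> S) F"
    using smooth_at_continuous[OF M N F] .
  obtain S' where S': "open S'" "(M \<inter> S) \<inter> F -` T = (M \<inter> S) \<inter> S'"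
    using continuous_openin_preimage_gen[OF S(3) T(1)] by (auto simp: openin_open)
  show ?thesis
  proof
    show "open (S \<inter> S')" using S S' by blast
    show "p \<in> S \<inter> S'" using S S' T by blast
    show "F q \<in> T" if "q \<in> M" "q \<in> S \<inter> S'" for q using that S' by blast
  qed
qed

text \<open>The induction runs over a whole open set, since the next time derivative at z looks at
  neighbouring times.\<close>

lemma smooth_at_tder:
  fixes K :: "real \<times> 'm::topological_space \<Rightarrow> real"
  assumes M: "smooth_space M A" and T: "open T" "z \<in> (UNIV \<times> M) \<inter> T"
    and K: "\<And>z. z \<in> (UNIV \<times> M) \<inter> T \<Longrightarrow>
      smooth_at (UNIV \<times> M) (prod_atlas (euclidean_atlas UNIV) A) (euclidean_atlas UNIV) K z"
  shows "smooth_at (UNIV \<times> M) (prod_atlas (euclidean_atlas UNIV) A) (euclidean_atlas UNIV)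
    (\<lambda>(t, p). (tder ^^ k) (\<lambda>s. K (s, p)) t) z"
  using T(2)
proof (induction k arbitrary: z)
  case 0
  have "(\<lambda>(t, p). K (t, p)) = K" by auto
  then show ?case using K[OF 0] by simp
next
  case (Suc k)
  let ?K = "\<lambda>(t, p). (tder ^^ k) (\<lambda>s. K (s, p)) t"
  have "smooth_at (UNIV \<times> M) (prod_atlas (euclidean_atlas UNIV) A) (euclidean_atlas UNIV)
    (\<lambda>(t, p). deriv (\<lambda>s. ?K (s, p)) t) z"
    by (rule smooth_at_deriv[OF M T(1) Suc.prems Suc.IH])
  then show ?case
  proof (rule smooth_at_cong[OF smooth_space_prod[OF smooth_space_euclid M] _ T(1)])
    show "z \<in> T" using Suc.prems by simp
    fix x assume x: "x \<in> UNIV \<times> M" "x \<in> T"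
    obtain t p where tp: "x = (t, p)" by (cases x)
    obtain N where N: "open N" "t \<in> N" "C_inf_on N (\<lambda>s. ?K (s, p))"
      using smooth_at_curve[OF M Suc.IH, of t p] x tp by auto
    have "(?K \<circ> (\<lambda>s. (s, p)) has_vector_derivative tder (\<lambda>s. ?K (s, p)) t) (at t)"
      unfolding o_def by (rule tder_has_vector_derivative[OF N(3,2)])
    then have "deriv (\<lambda>s. ?K (s, p)) t = tder (\<lambda>s. ?K (s, p)) t"
      by (intro DERIV_imp_deriv) (simp add: has_real_derivative_iff_has_vector_derivative o_def)
    then show "(case x of (t, p) \<Rightarrow> deriv (\<lambda>s. ?K (s, p)) t) =
        (case x of (t, p) \<Rightarrow> (tder ^^ Suc k) (\<lambda>s. K (s, p)) t)"
      by (simp add: tp)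
  qed
qed

lemma dird_linear_comp:
  assumes "bounded_linear L" "f differentiable (at x)"
  shows "dird v (\<lambda>x. L (f x)) x = L (dird v f x)"
proof -
  have "((\<lambda>x. L (f x)) has_derivative (\<lambda>v. L (dird v f x))) (at x)"
    using assms by (intro bounded_linear.has_derivative[OF assms(1)] iffD1[OF frechet_derivative_works])
  then show ?thesis by (simp flip: frechet_derivative_at)
qed

text \<open>Prepares the computation of the differential of \<open>Psi\<close>: a spatial derivative
  of a k-fold time derivative becomes a k-fold time derivative of the linearized
  homotheties.\<close>

lemma dird_iterated_commute:
  fixes G :: "'a::real_normed_vector \<Rightarrow> real"
  assumes N: "open N" "C_inf_on N G" "x \<in> N"
  shows "C_inf_on N ((dird u ^^ k) G)" "dird v ((dird u ^^ k) G) x = (dird u ^^ k) (dird v G) x"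
proof -
  have sm: "C_inf_on N ((dird u ^^ k) G)" if "C_inf_on N G" for G :: "'a \<Rightarrow> real" and k
    using that by (induction k) (auto intro: C_inf_on_dird)
  then show "C_inf_on N ((dird u ^^ k) G)" using N by blast
  show "dird v ((dird u ^^ k) G) x = (dird u ^^ k) (dird v G) x"
    using N(3)
  proof (induction k arbitrary: x)
    case (Suc k)
    have "dird v ((dird u ^^ Suc k) G) x = dird v (dird u ((dird u ^^ k) G)) x" by simp
    also have "\<dots> = dird u (dird v ((dird u ^^ k) G)) x"
      by (rule dird_commute[OF N(1) sm[OF N(2)] Suc.prems])
    also have "\<dots> = dird u ((dird u ^^ k) (dird v G)) x"
      using frechet_derivative_cong_open[OF N(1) Suc.prems Suc.IH] by simp
    finally show ?case by simp
  qed simp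
qed

lemma dird_iterated_tder:
  fixes G :: "real \<times> 'a::real_normed_vector \<Rightarrow> real"
  assumes N: "open N" "C_inf_on N G" "(t, z) \<in> N"
  shows "(dird (1, 0) ^^ k) G (t, z) = (tder ^^ k) (\<lambda>t. G (t, z)) t"
  using N(3)
proof (induction k arbitrary: t)
  case (Suc k)
  have sm: "C_inf_on N ((dird (1, 0) ^^ k) G)" by (rule dird_iterated_commute(1)[OF N(1,2) Suc.prems])
  have o: "open ((\<lambda>t. (t, z)) -` N)" using N(1) by (intro open_vimage continuous_intros)
  have "(dird (1, 0) ^^ k) G differentiable (at ((0, z) + t *\<^sub>R (1, 0)))"
    using C_inf_on_differentiable[OF sm Suc.prems] by simp
  from tder_eq[OF has_vector_derivative_line[OF this]]
  have "(dird (1, 0) ^^ Suc k) G (t, z) = tder (\<lambda>t. (dird (1, 0) ^^ k) G (t, z)) t" by simp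
  also have "\<dots> = tder ((tder ^^ k) (\<lambda>t. G (t, z))) t"
    using frechet_derivative_cong_open[OF o, of t "\<lambda>t. (dird (1, 0) ^^ k) G (t, z)"] Suc by simp
  finally show ?case by simp
qed simp

text \<open>With all weights 0 nothing is rescaled; what remains is the orthogonal projection onto
  \<open>span B\<close>.\<close>

abbreviation proj :: "'a::euclidean_space set \<Rightarrow> 'a \<Rightarrow> 'a" where
  "proj B \<equiv> dil B (\<lambda>_. 0) 1"

lemma bounded_linear_dil: "bounded_linear (dil B w t)"
  using linear_dil linear_conv_bounded_linear by blast

text \<open>Common ground of the homotheties and of the additive flow, before any composition law.
  It is instantiated with both.\<close>

locale smooth_time_dependent =
  fixes M :: "'m::{t2_space,second_countable_topology} set"
    and A :: "('m, 'e::euclidean_space) chart set" and \<Phi> :: "real \<Rightarrow> 'm \<Rightarrow> 'm"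
  assumes space: "smooth_space M A"
    and smooth: "smooth_map (UNIV \<times> M) (prod_atlas (euclidean_atlas UNIV) A) M A (\<lambda>(s, p). \<Phi> s p)"
begin

lemma space_RM: "smooth_space (UNIV \<times> M) (prod_atlas (euclidean_atlas (UNIV :: real set)) A)"
  by (rule smooth_space_prod[OF smooth_space_euclid space])

lemma in_M: "p \<in> M \<Longrightarrow> \<Phi> s p \<in> M"
  using smooth unfolding smooth_map_def by auto

lemma smooth_at_flow:
  "p \<in> M \<Longrightarrow> smooth_at (UNIV \<times> M) (prod_atlas (euclidean_atlas UNIV) A) A (\<lambda>(s, p). \<Phi> s p) (s, p)"
  using smooth smooth_map_iff[OF space_RM space] by auto

lemma smooth_at_comp:
  assumes N: "smooth_space N A'" and "smooth_at N A' (euclidean_atlas UNIV) \<tau> x" "smooth_at N A' A F x" "F x \<in> M"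
  shows "smooth_at N A' A (\<lambda>x. \<Phi> (\<tau> x) (F x)) x"
  using smooth_at_compose[OF N space_RM space smooth_at_Pair[OF N smooth_space_euclid space assms(2,3)]
      smooth_at_flow[OF assms(4)]] by simp

lemma smooth_at_slice:
  assumes p: "p \<in> M" shows "smooth_at M A (prod_atlas (euclidean_atlas UNIV) A) (\<lambda>q. (s::real, q)) p"
  by (intro smooth_at_Pair[OF space smooth_space_euclid space] smooth_at_id[OF space p]
      smooth_at_const[OF space p smooth_space_euclid UNIV_I])

lemma smooth_at_time:
  assumes "p \<in> M" shows "smooth_at M A A (\<Phi> s) p"
  using smooth_at_compose[OF space space_RM space smooth_at_slice[OF assms] smooth_at_flow[OF assms]] by simp

end

section \<open>Homotheties in a chart around a fixed point\<close>

locale homothety_action = smooth_time_dependent M A h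
  for M :: "'m::{t2_space,second_countable_topology} set"
    and A :: "('m, 'e::euclidean_space) chart set" and h +
  assumes manifold: "smooth_manifold M A"
    and h_1: "p \<in> M \<Longrightarrow> h 1 p = p"
    and h_h: "p \<in> M \<Longrightarrow> h s (h t p) = h (s * t) p"

locale fixed_point_chart = homothety_action +
  fixes x0 U \<phi> B
  assumes x0: "x0 \<in> U" "h 0 x0 = x0" and chart: "(U, \<phi>) \<in> A" and B: "B \<subseteq> Basis"
    and chart_open: "openin (top_of_set (span B)) (\<phi> ` U)"
begin

text \<open>The inverse chart, made constant along the complement of \<open>span B\<close>. It turns
  \<open>K\<close> into a function on an open set of the whole space, where Frechet derivatives make
  sense.\<close>

definition sec where "sec z = inv_into U \<phi> (proj B z)"
definition K where "K = (\<lambda>(t, z). \<phi> (h t (sec z)))"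
text \<open>The pairs for which the chart can be entered and the moved point is still inside
  \<open>U\<close>. On this open set the homotheties have the coordinate expression
  \<open>K\<close>.\<close>

definition K_dom where "K_dom = {(t, z). proj B z \<in> \<phi> ` U \<and> h t (sec z) \<in> U}"
definition D where "D t v = dird (0, v) K (t, \<phi> x0)"

lemma UM: "U \<subseteq> M" and inj: "inj_on \<phi> U"
  using smooth_space_chart[OF space chart] by auto

lemma x0M: "x0 \<in> M" using x0 UM by auto

lemma h_x0: "h t x0 = x0"
  using h_h[OF x0M, of t 0] x0(2) by simp

lemma chart_span: "q \<in> U \<Longrightarrow> \<phi> q \<in> span B"
  using openin_imp_subset[OF chart_open] by auto

lemma proj_chart: "q \<in> U \<Longrightarrow> proj B (\<phi> q) = \<phi> q"
  using dil_1[OF B chart_span] .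

lemma sec_chart: "q \<in> U \<Longrightarrow> sec (\<phi> q) = q"
  by (simp add: sec_def proj_chart inv_into_f_f[OF inj])

lemma sec_in: "proj B z \<in> \<phi> ` U \<Longrightarrow> sec z \<in> U" "proj B z \<in> \<phi> ` U \<Longrightarrow> \<phi> (sec z) = proj B z"
  by (simp_all add: sec_def inv_into_into f_inv_into_f)

lemma smooth_at_chart_inv_span:
  assumes "z \<in> \<phi> ` U"
  shows "smooth_at (span B) (euclidean_atlas (span B)) A (inv_into U \<phi>) z"
proof -
  obtain T where T: "open T" "\<phi> ` U = span B \<inter> T" using chart_open by (auto simp: openin_open)
  show ?thesis
    by (rule smooth_at_euclid_source_open[OF space smooth_at_chart_inv[OF space chart assms] T])
qed

lemma smooth_at_sec:
  assumes "proj B z \<in> \<phi> ` U"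
  shows "smooth_at UNIV (euclidean_atlas UNIV) A sec z"
proof -
  have "smooth_at UNIV (euclidean_atlas UNIV) (euclidean_atlas (span B)) (proj B) z"
    by (intro smooth_at_euclidI smooth_on_linear linear_dil) (auto simp: dil_in_span)
  from smooth_at_compose[OF smooth_space_euclid smooth_space_euclid space this smooth_at_chart_inv_span[OF assms]]
  show ?thesis by (simp add: sec_def[abs_def])
qed

lemma K_dom: "open K_dom" "C_inf_on K_dom K"
proof -
  have *: "\<exists>T. open T \<and> x \<in> T \<and> T \<subseteq> K_dom \<and> C_inf_on T K" if x: "x \<in> K_dom" for x
  proof -
    obtain t z where tz: "x = (t, z)" "proj B z \<in> \<phi> ` U" "h t (sec z) \<in> U"
      using x by (auto simp: K_dom_def)
    note E = smooth_space_euclid[of "UNIV :: (real \<times> 'b) set"]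
    have 1: "smooth_at UNIV (euclidean_atlas UNIV) (euclidean_atlas UNIV) (fst :: real \<times> 'b \<Rightarrow> real) x"
      "smooth_at UNIV (euclidean_atlas UNIV) (euclidean_atlas UNIV) (snd :: real \<times> 'b \<Rightarrow> 'b) x"
      by (intro smooth_at_euclidI smooth_on_bounded_linear bounded_linear_fst bounded_linear_snd; simp)+
    have s: "sec (snd x) \<in> M" using tz sec_in UM by auto
    have "smooth_at UNIV (euclidean_atlas UNIV) A (\<lambda>x. sec (snd x)) x"
      using smooth_at_compose[OF E smooth_space_euclid space 1(2) smooth_at_sec] tz by simp
    from smooth_at_comp[OF E 1(1) this s]
    have sm: "smooth_at UNIV (euclidean_atlas UNIV) A (\<lambda>x. h (fst x) (sec (snd x))) x" .
    have "(\<lambda>x. h (fst x) (sec (snd x))) x \<in> U" using tz by simp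
    then obtain T where T: "open T" "x \<in> UNIV \<inter> T" "(\<lambda>x. h (fst x) (sec (snd x))) ` (UNIV \<inter> T) \<subseteq> U"
      "smooth_on ((\<lambda>x. x) ` (UNIV \<inter> T)) (\<lambda>y. \<phi> (h (fst (inv_into UNIV (\<lambda>x. x) y)) (sec (snd (inv_into UNIV (\<lambda>x. x) y)))))"
      using smooth_at_charts[OF E space sm _ chart, of UNIV "\<lambda>x. x"] by (auto simp: mem_euclidean_atlas)
    then have smT: "smooth_on T K"
      by (simp add: inv_into_ident K_def case_prod_unfold)
    obtain T' where T': "open T'" "\<phi> ` U = span B \<inter> T'" using chart_open by (auto simp: openin_open)
    let ?T = "T \<inter> (\<lambda>x. proj B (snd x)) -` T'"
    have o: "open ?T"
      using T(1) T'(1)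
      by (intro open_Int open_vimage bounded_linear.continuous_on[OF bounded_linear_dil] continuous_intros)
    have "?T \<subseteq> K_dom" using T(3) T'(2) by (auto simp: K_dom_def dil_in_span)
    moreover have "x \<in> ?T" using T(2) T'(2) tz by auto
    moreover have "C_inf_on ?T K"
      using C_inf_on_subset[OF smooth_on_C_inf_on[OF T(1) smT]] by blast
    ultimately show ?thesis using o by blast
  qed
  show "open K_dom" unfolding open_subopen[of K_dom] using * by meson
  show "C_inf_on K_dom K" by (rule C_inf_on_local) (use * in meson)
qed

text \<open>The point \<open>x0\<close> is fixed for every t, so the linearization
  \<open>D t\<close> exists for all times, in particular at 0 and for large t.\<close>

lemma dom_x0: "(t, \<phi> x0) \<in> K_dom"
  using x0 by (simp add: K_dom_def proj_chart sec_chart h_x0)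

lemma K_x0: "K (t, \<phi> x0) = \<phi> x0"
  using x0 by (simp add: K_def sec_chart h_x0)

lemma proj_K: "(t, z) \<in> K_dom \<Longrightarrow> proj B (K (t, z)) = K (t, z)"
  by (simp add: K_dom_def K_def proj_chart)

lemma K_K:
  assumes "(t, z) \<in> K_dom" shows "K (s, K (t, z)) = K (s * t, z)"
proof -
  have "sec z \<in> M" "h t (sec z) \<in> U" using assms sec_in(1) UM by (auto simp: K_dom_def)
  then show ?thesis by (simp add: K_def sec_chart h_h)
qed

lemma K_1:
  assumes "(1, z) \<in> K_dom" shows "K (1, z) = proj B z"
proof -
  have "proj B z \<in> \<phi> ` U" using assms by (auto simp: K_dom_def)
  moreover from this have "sec z \<in> M" using sec_in(1) UM by blast
  ultimately show ?thesis by (simp add: K_def h_1 sec_in(2))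
qed

lemma open_dom_slice: "open {z. (t, z) \<in> K_dom}"
proof -
  have "open ((\<lambda>z. (t, z)) -` K_dom)" by (intro open_vimage K_dom continuous_intros)
  then show ?thesis by (simp add: vimage_def)
qed

lemma D: "((\<lambda>z. K (t, z)) has_derivative D t) (at (\<phi> x0))"
proof -
  have "((\<lambda>z. (t, z)) has_derivative (\<lambda>v. (0, v))) (at (\<phi> x0))"
    by (auto intro!: derivative_eq_intros)
  from has_derivative_compose[OF this C_inf_on_has_derivative[OF K_dom(2) dom_x0]]
  show ?thesis by (simp add: D_def[abs_def])
qed

lemma linear_D: "linear (D t)"
  using has_derivative_bounded_linear[OF D] bounded_linear.linear by blast

lemma C_inf_on_D: "C_inf_on UNIV (\<lambda>t. D t v)"
  unfolding D_def
proof (rule C_inf_on_compose[OF open_UNIV K_dom(1) _ C_inf_on_dird[OF K_dom(2)]])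
  show "C_inf_on UNIV (\<lambda>t::real. (t, \<phi> x0))"
    by (rule smooth_on_C_inf_on[OF open_UNIV smooth_on_Pair[OF smooth_on_id smooth_on_const]])
qed (use dom_x0 in auto)

text \<open>Chain rule for \<open>K (s, K (t, z)) = K (s * t, z)\<close>. As \<open>x0\<close> is
  fixed, both factors are differentiated at the same point \<open>\<phi> x0\<close>.\<close>

lemma D_mult: "D (s * t) v = D s (D t v)"
proof -
  have "((\<lambda>z. K (s, K (t, z))) has_derivative (\<lambda>v. D s (D t v))) (at (\<phi> x0))"
    by (rule has_derivative_compose[OF D]) (simp add: K_x0 D)
  then have "((\<lambda>z. K (s * t, z)) has_derivative (\<lambda>v. D s (D t v))) (at (\<phi> x0))"
    by (rule has_derivative_transform_within_open[OF _ open_dom_slice[of t]]) (use dom_x0 K_K in auto)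
  then show ?thesis using has_derivative_unique[OF D] by metis
qed

lemma proj_D: "proj B (D t v) = D t v"
proof -
  have "((\<lambda>z. proj B (K (t, z))) has_derivative (\<lambda>v. proj B (D t v))) (at (\<phi> x0))"
    by (rule bounded_linear.has_derivative[OF bounded_linear_dil D])
  then have "((\<lambda>z. K (t, z)) has_derivative (\<lambda>v. proj B (D t v))) (at (\<phi> x0))"
    by (rule has_derivative_transform_within_open[OF _ open_dom_slice[of t]]) (use dom_x0 proj_K in auto)
  then show ?thesis using has_derivative_unique[OF D] by metis
qed

lemma D_1: "D 1 v = proj B v"
proof -
  have "(proj B has_derivative proj B) (at (\<phi> x0))"
    by (rule bounded_linear_imp_has_derivative[OF bounded_linear_dil])
  then have "((\<lambda>z. K (1, z)) has_derivative proj B) (at (\<phi> x0))"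
    by (rule has_derivative_transform_within_open[OF _ open_dom_slice[of 1]]) (use dom_x0 K_1 in auto)
  then show ?thesis using has_derivative_unique[OF D] by metis
qed

lemma D_diagonal:
  obtains L w where "linear L" "inj_on L (span B)" "L ` span B \<subseteq> span B"
    "\<And>t v b. b \<in> B \<Longrightarrow> L (D t v) \<bullet> b = t ^ w b * (L (proj B v) \<bullet> b)"
proof -
  have Dspan: "D t v \<in> span B" for t v using proj_D[of t v] dil_in_span by metis
  have D1: "D 1 v = v" if "v \<in> span B" for v using dil_1[OF B that] D_1 by simp
  obtain L w where L: "linear L" "inj_on L (span B)" "L ` span B \<subseteq> span B"
    "\<And>t v b. v \<in> span B \<Longrightarrow> b \<in> B \<Longrightarrow> L (D t v) \<bullet> b = t ^ w b * (L v \<bullet> b)"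
    using monoid_hom_diagonal[of D B, OF linear_D C_inf_on_D D_mult B Dspan D1] by blast
  \<comment> \<open>Off \<open>span B\<close> the map \<open>D t\<close> sees only the projection,
    because \<open>D 1\<close> is the projection and \<open>D t = D (t * 1)\<close>.\<close>
  have "D t v = D t (proj B v)" for t v using D_mult[of t 1 v] by (simp add: D_1)
  then show ?thesis using that[of L w] L dil_in_span by metis
qed

end

lemma smooth_at_binop:
  fixes f :: "'m::topological_space \<Rightarrow> 'a::euclidean_space" and g :: "'m \<Rightarrow> 'b::euclidean_space"
  assumes M: "smooth_space M A"
    and "smooth_at M A (euclidean_atlas UNIV) f p" "smooth_at M A (euclidean_atlas UNIV) g p"
    and F: "smooth_on UNIV (\<lambda>(x, y). F x y)"
  shows "smooth_at M A (euclidean_atlas UNIV) (\<lambda>q. F (f q) (g q)) p"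
proof -
  have "smooth_at M A (euclidean_atlas UNIV) (\<lambda>q. (f q, g q)) p"
    using smooth_at_Pair[OF M smooth_space_euclid smooth_space_euclid assms(2,3)]
    by (simp add: prod_atlas_euclid)
  from smooth_at_smooth_on_comp[OF M this F] show ?thesis by simp
qed

lemma smooth_at_add:
  fixes f :: "'m::topological_space \<Rightarrow> 'a::euclidean_space"
  assumes M: "smooth_space M A"
    and "smooth_at M A (euclidean_atlas UNIV) f p" "smooth_at M A (euclidean_atlas UNIV) g p"
  shows "smooth_at M A (euclidean_atlas UNIV) (\<lambda>q. f q + g q) p"
proof (rule smooth_at_binop[OF assms])
  show "smooth_on UNIV (\<lambda>(x, y). x + y :: 'a)"
    unfolding case_prod_unfold
    by (intro smooth_on_add smooth_on_bounded_linear bounded_linear_fst bounded_linear_snd)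
qed

lemma smooth_at_sum:
  fixes f :: "'i \<Rightarrow> 'm::topological_space \<Rightarrow> 'a::euclidean_space"
  assumes M: "smooth_space M A" "p \<in> M"
    and "\<And>i. i \<in> I \<Longrightarrow> smooth_at M A (euclidean_atlas UNIV) (f i) p"
  shows "smooth_at M A (euclidean_atlas UNIV) (\<lambda>q. \<Sum>i\<in>I. f i q) p"
  using assms(3)
  by (induction I rule: infinite_finite_induct)
    (simp_all add: smooth_at_const[OF M smooth_space_euclid] smooth_at_add[OF M(1)])

section \<open>Homogeneous coordinates from Taylor coefficients\<close>

locale diagonal_chart = fixed_point_chart M A h x0 U \<phi> B
  for M :: "'m::{t2_space,second_countable_topology} set"
    and A :: "('m, 'e::euclidean_space) chart set" and h x0 U \<phi> B +
  fixes L :: "'e \<Rightarrow> 'e" and w :: "'e \<Rightarrow> nat"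
  assumes linear_L: "linear L" and inj_L: "inj_on L (span B)" and L_span: "L ` span B \<subseteq> span B"
    and L_D: "b \<in> B \<Longrightarrow> L (D t v) \<bullet> b = t ^ w b * (L (proj B v) \<bullet> b)"
begin

text \<open>Only the germ at t = 0 of the orbit of p enters. So it is \<open>h 0 p\<close>, not p
  itself, that has to lie in the chart, and \<open>Psi\<close> is defined along entire fibers at
  once.\<close>

definition Psi :: "'m \<Rightarrow> 'e" where
  "Psi p = (\<Sum>b\<in>B. ((tder ^^ w b) (\<lambda>t. L (\<phi> (h t p)) \<bullet> b) 0 / fact (w b)) *\<^sub>R b)"

lemma Psi_span: "Psi p \<in> span B"
  unfolding Psi_def by (rule sum_Basis_in_span)

lemma Psi_inner: "b \<in> B \<Longrightarrow> Psi p \<bullet> b = (tder ^^ w b) (\<lambda>t. L (\<phi> (h t p)) \<bullet> b) 0 / fact (w b)"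
  unfolding Psi_def using B by (subst inner_sum_Basis_subset[OF B]) auto

lemma bounded_linear_L_inner: "bounded_linear (\<lambda>v. L v \<bullet> b)"
  using linear_L
  by (intro bounded_linear_compose[OF bounded_linear_inner_left]) (simp add: linear_conv_bounded_linear)

lemma smooth_at_component:
  assumes "p \<in> M" "h t p \<in> U"
  shows "smooth_at (UNIV \<times> M) (prod_atlas (euclidean_atlas UNIV) A) (euclidean_atlas UNIV)
    (\<lambda>z. L (\<phi> (h (fst z) (snd z))) \<bullet> b) (t, p)"
proof -
  have "smooth_at (UNIV \<times> M) (prod_atlas (euclidean_atlas UNIV) A) (euclidean_atlas UNIV)
      (\<lambda>z. \<phi> ((\<lambda>(t, p). h t p) z)) (t, p)"
    by (rule smooth_at_compose[OF space_RM space smooth_space_euclid smooth_at_flow[OF assms(1)]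
          smooth_at_chart[OF space chart]]) (use assms in auto)
  from smooth_at_smooth_on_comp[OF space_RM this smooth_on_bounded_linear[OF bounded_linear_L_inner]]
  show ?thesis by (simp add: case_prod_unfold)
qed

lemma component_curve:
  assumes "p \<in> M" "h 0 p \<in> U"
  obtains N where "open N" "0 \<in> N" "C_inf_on N (\<lambda>t. L (\<phi> (h t p)) \<bullet> b)"
  using smooth_at_curve[OF space smooth_at_component[OF assms]] by auto

lemma smooth_at_Psi:
  assumes p: "p \<in> M" "h 0 p \<in> U"
  shows "smooth_at M A (euclidean_atlas (span B)) Psi p"
proof -
  obtain TU where TU: "open TU" "U = M \<inter> TU" using smooth_space_chart_open[OF space chart] .
  have "continuous_on (UNIV \<times> M) (\<lambda>(t, p). h t p)" using smooth by (simp add: smooth_map_def)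
  from continuous_openin_preimage_gen[OF this TU(1)]
  obtain T where T: "open T" "(UNIV \<times> M) \<inter> (\<lambda>(t, p). h t p) -` TU = (UNIV \<times> M) \<inter> T"
    by (auto simp: openin_open)
  have in_U: "h t q \<in> U" if "(t, q) \<in> (UNIV \<times> M) \<inter> T" for t q
  proof -
    have "(t, q) \<in> (UNIV \<times> M) \<inter> (\<lambda>(t, p). h t p) -` TU" using that T(2) by simp
    then show ?thesis using TU(2) in_M by auto
  qed
  have 0: "(0, p) \<in> (UNIV \<times> M) \<inter> T" using T(2) TU(2) p by (auto simp: set_eq_iff)
  have comp: "smooth_at M A (euclidean_atlas UNIV) (\<lambda>p. (tder ^^ k) (\<lambda>t. L (\<phi> (h t p)) \<bullet> b) 0) p" for k b
  proof -
    have "smooth_at (UNIV \<times> M) (prod_atlas (euclidean_atlas UNIV) A) (euclidean_atlas UNIV)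
        (\<lambda>z. L (\<phi> (h (fst z) (snd z))) \<bullet> b) z" if z: "z \<in> (UNIV \<times> M) \<inter> T" for z
      using smooth_at_component[of "snd z" "fst z" b] in_U[of "fst z" "snd z"] z by auto
    from smooth_at_tder[OF space T(1) 0 this, of k]
    have sm: "smooth_at (UNIV \<times> M) (prod_atlas (euclidean_atlas UNIV) A) (euclidean_atlas UNIV)
        (\<lambda>(t, p). (tder ^^ k) (\<lambda>t. L (\<phi> (h t p)) \<bullet> b) t) (0, p)" by simp
    have "smooth_at M A (prod_atlas (euclidean_atlas UNIV) A) (\<lambda>q. (0, q)) p"
      by (intro smooth_at_Pair[OF space smooth_space_euclid space] smooth_at_id[OF space p(1)]
          smooth_at_const[OF space p(1) smooth_space_euclid UNIV_I])
    from smooth_at_compose[OF space space_RM smooth_space_euclid this sm] show ?thesis by simp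
  qed
  have "smooth_at M A (euclidean_atlas UNIV) Psi p"
    unfolding Psi_def[abs_def]
  proof (rule smooth_at_sum[OF space p(1)])
    fix b
    have "smooth_on UNIV (\<lambda>x. (x / fact (w b)) *\<^sub>R b)"
      by (intro smooth_on_bounded_linear bounded_linear_scaleR_const bounded_linear_divide)
    from smooth_at_smooth_on_comp[OF space comp this]
    show "smooth_at M A (euclidean_atlas UNIV)
        (\<lambda>p. ((tder ^^ w b) (\<lambda>t. L (\<phi> (h t p)) \<bullet> b) 0 / fact (w b)) *\<^sub>R b) p" by simp
  qed
  then show ?thesis
    by (rule smooth_at_euclid_target[OF space _ open_UNIV]) (auto simp: Psi_span)
qed

text \<open>The orbit of \<open>h s p\<close> is the orbit of p with time rescaled by s, also for s
  = 0, where only the coefficients of weight 0 survive.\<close>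

lemma Psi_h:
  assumes p: "p \<in> M" "h 0 p \<in> U"
  shows "Psi (h s p) = dil B w s (Psi p)"
proof (rule in_span_Basis_eqI[OF B Psi_span dil_in_span])
  fix b assume b: "b \<in> B"
  obtain N where N: "open N" "0 \<in> N" "C_inf_on N (\<lambda>t. L (\<phi> (h t p)) \<bullet> b)"
    using component_curve[OF p] .
  have "(tder ^^ w b) (\<lambda>t. L (\<phi> (h (s * t) p)) \<bullet> b) 0
      = s ^ w b *\<^sub>R (tder ^^ w b) (\<lambda>t. L (\<phi> (h t p)) \<bullet> b) (s * 0)"
    by (rule tder_scale_arg[OF N(1,3)]) (simp add: N)
  then show "Psi (h s p) \<bullet> b = dil B w s (Psi p) \<bullet> b"
    using b by (simp add: Psi_inner dil_inner[OF B] h_h[OF p(1)] mult.commute)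
qed

definition slice where "slice = {z. (0, z) \<in> K_dom}"

lemma slice: "open slice" "\<phi> x0 \<in> slice" "z \<in> slice \<Longrightarrow> sec z \<in> M \<and> h 0 (sec z) \<in> U"
  using open_dom_slice[of 0] dom_x0 sec_in(1) UM by (auto simp: slice_def K_dom_def)

lemma C_inf_on_Psi_sec: "C_inf_on slice (\<lambda>z. Psi (sec z))"
proof (rule C_inf_on_local)
  fix z assume z: "z \<in> slice"
  then have "proj B z \<in> \<phi> ` U" by (simp add: slice_def K_dom_def)
  from smooth_at_compose[OF smooth_space_euclid space smooth_space_euclid smooth_at_sec[OF this] smooth_at_Psi]
  have "smooth_at UNIV (euclidean_atlas UNIV) (euclidean_atlas (span B)) (\<lambda>z. Psi (sec z)) z"
    using slice(3)[OF z] by blast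
  then obtain N where "open N" "z \<in> N" "smooth_on N (\<lambda>z. Psi (sec z))"
    unfolding smooth_at_euclid_iff by auto
  then show "\<exists>N. open N \<and> z \<in> N \<and> C_inf_on N (\<lambda>z. Psi (sec z))" using smooth_on_C_inf_on by blast
qed

text \<open>After exchanging the derivatives, the component along b is the Taylor coefficient of
  order \<open>w b\<close> of t \<mapsto> \<open>L (D t v) \<bullet> b\<close>. By diagonality this
  is a monomial of exactly that degree, so the factorials cancel and \<open>L\<close>
  remains.\<close>

lemma dird_Psi_sec: "dird v (\<lambda>z. Psi (sec z)) (\<phi> x0) = L (proj B v)"
proof (rule in_span_Basis_eqI[OF B])
  let ?F = "\<lambda>z. Psi (sec z)"
  have diff: "?F differentiable (at (\<phi> x0))"
    by (rule C_inf_on_differentiable[OF C_inf_on_Psi_sec slice(2)])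
  have "proj B (dird v ?F (\<phi> x0)) = dird v (\<lambda>z. proj B (?F z)) (\<phi> x0)"
    by (rule dird_linear_comp[OF bounded_linear_dil diff, symmetric])
  also have "\<dots> = dird v ?F (\<phi> x0)" by (simp add: dil_1[OF B Psi_span])
  finally show "dird v ?F (\<phi> x0) \<in> span B" using dil_in_span by metis
  show "L (proj B v) \<in> span B" using L_span dil_in_span by blast
  fix b assume b: "b \<in> B"
  let ?G = "\<lambda>x. L (K x) \<bullet> b" and ?k = "w b"
  have smG: "C_inf_on K_dom ?G"
    using C_k_on_linear_comp[OF bounded_linear_L_inner K_dom(1)] K_dom(2) by (simp add: C_inf_on_def)
  note smk = dird_iterated_commute(1)[OF K_dom(1) smG dom_x0[of 0], where u = "(1, 0)" and k = ?k]
  have eq: "?F z \<bullet> b = (dird (1, 0) ^^ ?k) ?G (0, z) / fact ?k" if "z \<in> slice" for z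
    using that dird_iterated_tder[OF K_dom(1) smG, of 0 z ?k] b
    by (simp add: Psi_inner slice_def K_def)
  have "((\<lambda>z. (0, z)) has_derivative (\<lambda>v. (0, v))) (at (\<phi> x0))"
    by (auto intro!: derivative_eq_intros)
  from has_derivative_compose[OF this C_inf_on_has_derivative[OF smk dom_x0]]
  have "((\<lambda>z. (dird (1, 0) ^^ ?k) ?G (0, z)) has_derivative (\<lambda>v. dird (0, v) ((dird (1, 0) ^^ ?k) ?G) (0, \<phi> x0)))
      (at (\<phi> x0))" .
  then have "((\<lambda>z. (dird (1, 0) ^^ ?k) ?G (0, z) / fact ?k) has_derivative
      (\<lambda>v. dird (0, v) ((dird (1, 0) ^^ ?k) ?G) (0, \<phi> x0) / fact ?k)) (at (\<phi> x0))"
    by (rule bounded_linear.has_derivative[OF bounded_linear_divide])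
  then have "((\<lambda>z. ?F z \<bullet> b) has_derivative
      (\<lambda>v. dird (0, v) ((dird (1, 0) ^^ ?k) ?G) (0, \<phi> x0) / fact ?k)) (at (\<phi> x0))"
    by (rule has_derivative_transform_within_open[OF _ slice(1,2)]) (simp add: eq)
  then have 1: "dird v (\<lambda>z. ?F z \<bullet> b) (\<phi> x0) = dird (0, v) ((dird (1, 0) ^^ ?k) ?G) (0, \<phi> x0) / fact ?k"
    by (simp flip: frechet_derivative_at)
  have "dird (0, v) ((dird (1, 0) ^^ ?k) ?G) (0, \<phi> x0) = (dird (1, 0) ^^ ?k) (dird (0, v) ?G) (0, \<phi> x0)"
    by (rule dird_iterated_commute(2)[OF K_dom(1) smG dom_x0])
  also have "\<dots> = (tder ^^ ?k) (\<lambda>t. dird (0, v) ?G (t, \<phi> x0)) 0"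
    by (rule dird_iterated_tder[OF K_dom(1) C_inf_on_dird[OF smG] dom_x0])
  also have "(\<lambda>t. dird (0, v) ?G (t, \<phi> x0)) = (\<lambda>t. t ^ ?k *\<^sub>R (L (proj B v) \<bullet> b))"
    using dird_linear_comp[OF bounded_linear_L_inner C_inf_on_differentiable[OF K_dom(2) dom_x0]]
    by (simp add: L_D[OF b] flip: D_def)
  also have "(tder ^^ ?k) \<dots> 0 = fact ?k * (L (proj B v) \<bullet> b)"
    by (simp add: tder_power_0 del: real_scaleR_def) simp
  finally have "dird v (\<lambda>z. ?F z \<bullet> b) (\<phi> x0) = L (proj B v) \<bullet> b" using 1 by simp
  then show "dird v ?F (\<phi> x0) \<bullet> b = L (proj B v) \<bullet> b"
    using dird_linear_comp[OF bounded_linear_inner_left diff] by metis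
qed

text \<open>The inverse function theorem needs a map between open sets of the whole space. Adding
  \<open>z - proj B z\<close> makes the map the identity in the complementary directions; its
  derivative is \<open>L\<close> on \<open>span B\<close> and the identity on the complement, hence
  injective.\<close>

lemma Psi_local_inverse:
  obtains TW V1 \<Theta> where "open TW" "x0 \<in> TW" "M \<inter> TW \<subseteq> U" "\<And>q. q \<in> M \<Longrightarrow> q \<in> TW \<Longrightarrow> h 0 q \<in> U"
    "open V1" "\<And>q. q \<in> M \<Longrightarrow> q \<in> TW \<Longrightarrow> Psi q \<in> V1 \<and> \<Theta> (Psi q) = q"
    "\<And>y. y \<in> V1 \<Longrightarrow> y \<in> span B \<Longrightarrow> \<Theta> y \<in> M \<inter> TW \<and> Psi (\<Theta> y) = y \<and>
      smooth_at (span B) (euclidean_atlas (span B)) A \<Theta> y"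
proof -
  let ?F = "\<lambda>z. Psi (sec z) + (z - proj B z)"
  have blp: "bounded_linear (\<lambda>z. z - proj B z)"
    by (intro bounded_linear_sub bounded_linear_ident bounded_linear_dil)
  have smF: "C_inf_on slice ?F"
    by (rule C_inf_on_add[OF slice(1) C_inf_on_Psi_sec C_inf_on_bounded_linear[OF blp]])
  have "(?F has_derivative (\<lambda>v. dird v (\<lambda>z. Psi (sec z)) (\<phi> x0) + (v - proj B v))) (at (\<phi> x0))"
    by (intro Deriv.has_derivative_add bounded_linear_imp_has_derivative[OF blp]
        C_inf_on_has_derivative[OF C_inf_on_Psi_sec slice(2)])
  then have dF: "frechet_derivative ?F (at (\<phi> x0)) = (\<lambda>v. L (proj B v) + (v - proj B v))"
    by (simp add: dird_Psi_sec flip: frechet_derivative_at)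
  have proj_id: "proj B (v - proj B v) = 0" for v
    by (simp add: linear_diff[OF linear_dil] dil_dil[OF B])
  have "inj (frechet_derivative ?F (at (\<phi> x0)))"
  proof (subst linear_injective_0)
    show "linear (frechet_derivative ?F (at (\<phi> x0)))"
      using linear_frechet_derivative C_inf_on_differentiable[OF smF slice(2)] by blast
    show "\<forall>v. frechet_derivative ?F (at (\<phi> x0)) v = 0 \<longrightarrow> v = 0"
    proof (intro allI impI)
      fix v assume "frechet_derivative ?F (at (\<phi> x0)) v = 0"
      then have 0: "L (proj B v) + (v - proj B v) = 0" by (simp add: dF)
      have Ls: "L (proj B v) \<in> span B" using L_span dil_in_span by blast
      have "proj B (L (proj B v) + (v - proj B v)) = L (proj B v)"
        by (simp only: linear_add[OF linear_dil] proj_id dil_1[OF B Ls]) simp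
      then have "L (proj B v) = 0" using 0 by (simp add: linear_0[OF linear_dil])
      then have "L (proj B v) = L 0" using linear_0[OF linear_L] by simp
      then have "proj B v = 0" by (rule inj_onD[OF inj_L _ dil_in_span span_zero])
      then show "v = 0" using 0 \<open>L (proj B v) = 0\<close> by simp
    qed
  qed
  then obtain U1 V1 G where G: "open U1" "U1 \<subseteq> slice" "\<phi> x0 \<in> U1" "open V1" "homeomorphism U1 V1 ?F G" "C_inf_on V1 G"
    using C_inf_inverse_function[OF slice(1) smF slice(2)] by blast
  have GF: "G (?F z) = z" "?F z \<in> V1" if "z \<in> U1" for z using G(5) that by (auto simp: homeomorphism_def)
  have FG: "?F (G y) = y" "G y \<in> U1" if "y \<in> V1" for y using G(5) that by (auto simp: homeomorphism_def)
  have FPsi: "?F (\<phi> q) = Psi q" if "q \<in> U" for q using that by (simp add: sec_chart proj_chart)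
  obtain TU where TU: "open TU" "U = M \<inter> TU" using smooth_space_chart_open[OF space chart] .
  obtain T where T: "open T" "U \<inter> \<phi> -` U1 = U \<inter> T"
    using continuous_openin_preimage_gen[OF smooth_space_chart(4)[OF space chart] G(1)] by (auto simp: openin_open)
  have W: "q \<in> M \<inter> (TU \<inter> T) \<longleftrightarrow> q \<in> U \<and> \<phi> q \<in> U1" for q using TU(2) T(2) by blast
  \<comment> \<open>\<open>?F\<close> preserves the complementary component, so the inverse
    \<open>G\<close> sends points of \<open>span B\<close> back into \<open>span B\<close>.\<close>
  have Gs: "G y \<in> span B" "G y \<in> \<phi> ` U" if y: "y \<in> V1" "y \<in> span B" for y
  proof -
    have "y - proj B y = ?F (G y) - proj B (?F (G y))" using FG(1)[OF y(1)] by simp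
    also have "\<dots> = G y - proj B (G y)"
      by (simp only: linear_add[OF linear_dil] proj_id dil_1[OF B Psi_span]) simp
    finally have "G y = proj B (G y)" by (simp add: dil_1[OF B y(2)])
    moreover have "proj B (G y) \<in> \<phi> ` U" using FG(2)[OF y(1)] G(2) by (auto simp: slice_def K_dom_def)
    ultimately show "G y \<in> span B" "G y \<in> \<phi> ` U" using dil_in_span by metis+
  qed
  let ?\<Theta> = "\<lambda>y. inv_into U \<phi> (G y)"
  show ?thesis
  proof
    show "open (TU \<inter> T)" "open V1" using TU T G by auto
    show "x0 \<in> TU \<inter> T" using W[of x0] x0 G by simp
    show "M \<inter> (TU \<inter> T) \<subseteq> U" using W by blast
    fix q assume "q \<in> M" "q \<in> TU \<inter> T"
    then have q: "q \<in> U" "\<phi> q \<in> U1" using W by blast+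
    then show "h 0 q \<in> U" using slice(3)[of "\<phi> q"] G(2) sec_chart[of q] by auto
    show "Psi q \<in> V1 \<and> ?\<Theta> (Psi q) = q"
      using GF[OF q(2)] FPsi[OF q(1)] inv_into_f_f[OF inj q(1)] by simp
  next
    fix y assume y: "y \<in> V1" "y \<in> span B"
    have U: "?\<Theta> y \<in> U" "\<phi> (?\<Theta> y) = G y" using Gs[OF y] by (auto simp: inv_into_into f_inv_into_f)
    have "smooth_at (span B) (euclidean_atlas (span B)) (euclidean_atlas UNIV) G y"
      unfolding smooth_at_euclid_iff
      using y G(4,6) C_inf_on_smooth_on[OF G(4,6)]
      by (intro exI[of _ V1]) (auto intro: smooth_on_subset)
    then have "smooth_at (span B) (euclidean_atlas (span B)) (euclidean_atlas (span B)) G y"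
      by (rule smooth_at_euclid_target[OF smooth_space_euclid _ G(4) y(1)]) (use Gs in auto)
    from smooth_at_compose[OF smooth_space_euclid smooth_space_euclid space this smooth_at_chart_inv_span[OF Gs(2)[OF y]]]
    show "?\<Theta> y \<in> M \<inter> (TU \<inter> T) \<and> Psi (?\<Theta> y) = y \<and>
      smooth_at (span B) (euclidean_atlas (span B)) A ?\<Theta> y"
      using W[of "?\<Theta> y"] U FG[OF y(1)] FPsi[OF U(1)] by simp
  qed
qed

end

section \<open>From a neighbourhood of the fixed point to whole fibers\<close>

lemma smooth_on_dil: "smooth_on UNIV (\<lambda>t. dil B w t y)"
  unfolding dil_def
  by (intro smooth_on_sum smooth_on_scaleR smooth_on_mult smooth_on_power smooth_on_id smooth_on_const)

lemma open_real_pos: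
  assumes "open S" "(0::real) \<in> S" obtains t where "t > 0" "t \<in> S"
proof -
  obtain e where "e > 0" "ball 0 e \<subseteq> S" using assms open_contains_ball by blast
  then show ?thesis using that[of "e / 2"] by (auto simp: subset_iff)
qed

lemma dil_weight_0: "B \<subseteq> Basis \<Longrightarrow> y \<in> span {b \<in> B. w b = 0} \<Longrightarrow> dil B w t y = y"
proof (rule in_span_Basis_eqI)
  assume B: "B \<subseteq> Basis" and y: "y \<in> span {b \<in> B. w b = 0}"
  then show "B \<subseteq> Basis" "dil B w t y \<in> span B" "y \<in> span B"
    using span_mono[of "{b \<in> B. w b = 0}" B] dil_in_span by auto
  fix b assume b: "b \<in> B"
  have "{b \<in> B. w b = 0} \<subseteq> Basis" using B by auto
  then have "y \<bullet> b = 0" if "w b \<noteq> 0" using y b B that by (auto simp: span_substd_basis)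
  then show "dil B w t y \<bullet> b = y \<bullet> b" using b by (cases "w b = 0") (auto simp: dil_inner[OF B])
qed

lemma dil_0_in_span:
  assumes "B \<subseteq> Basis" shows "dil B w 0 y \<in> span {b \<in> B. w b = 0}"
proof -
  have "dil B w 0 y = (\<Sum>b\<in>{b \<in> B. w b = 0}. (y \<bullet> b) *\<^sub>R b)"
    unfolding dil_def using finite_subset_Basis[OF assms]
    by (intro sum.mono_neutral_cong_right) (auto simp: power_0_left)
  then show ?thesis using sum_Basis_in_span[of "\<lambda>b. y \<bullet> b"] by simp
qed

context homothety_action
begin

lemma smooth_at_orbit: "p \<in> M \<Longrightarrow> smooth_at UNIV (euclidean_atlas UNIV) A (\<lambda>t. h t p) t"
  by (rule smooth_at_comp[OF smooth_space_euclid smooth_at_id[OF smooth_space_euclid UNIV_I]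
        smooth_at_const[OF smooth_space_euclid UNIV_I space]])

text \<open>\<open>Psi\<close> is already defined over \<open>T\<close>. Its injectivity and the
  smoothness of its inverse are obtained by contracting with a small t > 0 into the domain of the
  local inverse and expanding again with \<open>h (1 / t)\<close>. The condition on
  \<open>dil B w 0 y\<close> restricts the part of weight 0 to the coordinates of base points in
  \<open>T\<close> and leaves the positive weights free.\<close>

lemma homogeneous_coordinates:
  assumes x0: "x0 \<in> M" "h 0 x0 = x0"
  obtains T w \<Theta> and B :: "'e set" and \<Psi> :: "'m \<Rightarrow> 'e" where "open T" "x0 \<in> T" "B \<subseteq> Basis"
    "\<And>p. p \<in> M \<Longrightarrow> h 0 p \<in> T \<Longrightarrow> smooth_at M A (euclidean_atlas (span B)) \<Psi> p"
    "\<And>p s. p \<in> M \<Longrightarrow> h 0 p \<in> T \<Longrightarrow> \<Psi> (h s p) = dil B w s (\<Psi> p)"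
    "\<And>p. p \<in> M \<Longrightarrow> h 0 p \<in> T \<Longrightarrow> \<Theta> (\<Psi> p) = p \<and> \<Psi> p \<in> span B"
    "\<And>y. y \<in> span B \<Longrightarrow> dil B w 0 y \<in> \<Psi> ` (h 0 ` M \<inter> T) \<Longrightarrow> \<Theta> y \<in> M \<and> h 0 (\<Theta> y) \<in> T \<and>
      \<Psi> (\<Theta> y) = y \<and> smooth_at (span B) (euclidean_atlas (span B)) A \<Theta> y"
    "openin (top_of_set (span {b \<in> B. w b = 0})) (\<Psi> ` (h 0 ` M \<inter> T))"
proof -
  obtain U \<phi> where U: "(U, \<phi>) \<in> A" "x0 \<in> U" using smooth_space_ex_chart[OF space x0(1)] .
  have "is_chart M (U, \<phi>)" using manifold U(1) by (auto simp: smooth_manifold_iff)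
  then obtain B where B: "B \<subseteq> Basis" "openin (top_of_set (span B)) (\<phi> ` U)" by (auto simp: is_chart_def)
  interpret fixed_point_chart M A h x0 U \<phi> B
    using U x0 B by unfold_locales auto
  obtain L w where L: "linear L" "inj_on L (span B)" "L ` span B \<subseteq> span B"
    "\<And>t v b. b \<in> B \<Longrightarrow> L (D t v) \<bullet> b = t ^ w b * (L (proj B v) \<bullet> b)"
    using D_diagonal by blast
  interpret diagonal_chart M A h x0 U \<phi> B L w
    by (intro diagonal_chart.intro fixed_point_chart_axioms diagonal_chart_axioms.intro L)
  obtain T V1 \<Theta> where T: "open T" "x0 \<in> T" "M \<inter> T \<subseteq> U" and TU: "\<And>q. q \<in> M \<Longrightarrow> q \<in> T \<Longrightarrow> h 0 q \<in> U"
    and V1: "open V1" "\<And>q. q \<in> M \<Longrightarrow> q \<in> T \<Longrightarrow> Psi q \<in> V1 \<and> \<Theta> (Psi q) = q"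
    and \<Theta>: "\<And>y. y \<in> V1 \<Longrightarrow> y \<in> span B \<Longrightarrow> \<Theta> y \<in> M \<inter> T \<and> Psi (\<Theta> y) = y \<and>
      smooth_at (span B) (euclidean_atlas (span B)) A \<Theta> y"
    by (rule Psi_local_inverse) (rule that)
  note E = smooth_space_euclid[of "span B"] and ER = smooth_space_euclid[of "UNIV :: real set"]
  define MT where "MT = {p \<in> M. h 0 p \<in> T}"
  have MT_U: "h 0 p \<in> U" if "p \<in> MT" for p
    using TU[of "h 0 p"] that by (simp add: MT_def in_M h_h)
  have MT_h: "h s p \<in> MT" if "p \<in> MT" for p s using that by (simp add: MT_def in_M h_h)
  have Psi_MT: "Psi (h s p) = dil B w s (Psi p)" if "p \<in> MT" for p s
    using Psi_h[OF _ MT_U[OF that]] that by (simp add: MT_def)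
  \<comment> \<open>A common small t > 0 moves both points into \<open>T\<close>, where
    \<open>\<Theta>\<close> inverts \<open>Psi\<close>; then \<open>h (1 / t)\<close> moves them
    back.\<close>
  have inj: "p = p'" if p: "p \<in> MT" "p' \<in> MT" "Psi p = Psi p'" for p p'
  proof -
    obtain S where S: "open S" "0 \<in> S" "\<And>t. t \<in> S \<Longrightarrow> h t p \<in> T"
      using smooth_at_nbhd[OF ER space smooth_at_orbit[of p 0] T(1)] p by (auto simp: MT_def)
    obtain S' where S': "open S'" "0 \<in> S'" "\<And>t. t \<in> S' \<Longrightarrow> h t p' \<in> T"
      using smooth_at_nbhd[OF ER space smooth_at_orbit[of p' 0] T(1)] p by (auto simp: MT_def)
    obtain t where t: "t > 0" "t \<in> S \<inter> S'" using open_real_pos[of "S \<inter> S'"] S S' by blast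
    have "Psi (h t p) = Psi (h t p')" using p by (simp add: Psi_MT)
    moreover have "\<Theta> (Psi (h t p)) = h t p" "\<Theta> (Psi (h t p')) = h t p'"
      using V1(2) S(3) S'(3) t p in_M unfolding MT_def by blast+
    ultimately have "h t p = h t p'" by metis
    then have "h (1 / t) (h t p) = h (1 / t) (h t p')" by simp
    then show ?thesis using p t by (simp add: MT_def h_h h_1)
  qed
  define Om where "Om = Psi ` (h 0 ` M \<inter> T)"
  have Om_MT: "dil B w 0 (Psi p) \<in> Om" if "p \<in> MT" for p
    using that Psi_MT[OF that, of 0] unfolding Om_def MT_def by (intro image_eqI[of _ _ "h 0 p"]) auto
  define \<Theta>' where "\<Theta>' = inv_into MT Psi"
  have inj_on: "inj_on Psi MT" using inj by (auto simp: inj_on_def)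
  \<comment> \<open>One t serves for a whole neighbourhood of y. This is what makes the expression
    \<open>h (1 / t) (\<Theta> (dil B w t y'))\<close> of the inverse smooth in y'.\<close>
  have small: "\<exists>t S. t > 0 \<and> open S \<and> y \<in> S \<and> (\<forall>y'\<in>span B \<inter> S. dil B w t y' \<in> V1 \<and>
      \<Theta> (dil B w t y') \<in> MT \<and> h (1 / t) (\<Theta> (dil B w t y')) \<in> MT \<and> Psi (h (1 / t) (\<Theta> (dil B w t y'))) = y')"
    if y: "y \<in> span B" "dil B w 0 y \<in> Om" for y
  proof -
    obtain x where x: "x \<in> M" "h 0 x = x" "x \<in> T" "dil B w 0 y = Psi x"
    proof -
      obtain q where "q \<in> M" "h 0 q \<in> T" "dil B w 0 y = Psi (h 0 q)" using y(2) by (auto simp: Om_def)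
      then show ?thesis by (intro that[of "h 0 q"]) (simp_all add: h_h in_M)
    qed
    have V: "dil B w 0 y \<in> V1" and Tx: "\<Theta> (dil B w 0 y) = x" using V1(2)[OF x(1,3)] x(4) by simp_all
    have sd: "smooth_at UNIV (euclidean_atlas UNIV) (euclidean_atlas (span B)) (\<lambda>t. dil B w t y) 0"
      by (intro smooth_at_euclidI smooth_on_dil) (auto simp: dil_in_span)
    have s\<Theta>: "smooth_at (span B) (euclidean_atlas (span B)) A (\<lambda>y. h 0 (\<Theta> y)) z" if "z \<in> V1" "z \<in> span B" for z
      using smooth_at_compose[OF E space space _ smooth_at_time] \<Theta>[OF that] by blast
    \<comment> \<open>At time 0 this curve is at x, which belongs to \<open>T\<close>. Hence for
      small t the point \<open>\<Theta> (dil B w t y)\<close> lies over \<open>T\<close>, as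
      membership in \<open>MT\<close> requires.\<close>
    have s2: "smooth_at UNIV (euclidean_atlas UNIV) A (\<lambda>t. h 0 (\<Theta> (dil B w t y))) 0"
      using smooth_at_compose[OF ER E space sd s\<Theta>[OF V dil_in_span]] .
    obtain S1 where S1: "open S1" "0 \<in> S1" "\<And>t. t \<in> S1 \<Longrightarrow> dil B w t y \<in> V1"
      using smooth_at_nbhd[OF ER E sd V1(1) V] by auto
    obtain S2 where S2: "open S2" "0 \<in> S2" "\<And>t. t \<in> S2 \<Longrightarrow> h 0 (\<Theta> (dil B w t y)) \<in> T"
      using smooth_at_nbhd[OF ER space s2 T(1)] x Tx by auto
    obtain t where t: "t > 0" "t \<in> S1 \<inter> S2" using open_real_pos[of "S1 \<inter> S2"] S1 S2 by blast
    have sdt: "smooth_at (span B) (euclidean_atlas (span B)) (euclidean_atlas (span B)) (dil B w t) y"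
      by (intro smooth_at_euclidI smooth_on_linear linear_dil) (auto simp: dil_in_span y)
    have Vt: "dil B w t y \<in> V1" using S1 t by simp
    obtain S3 where S3: "open S3" "y \<in> S3" "\<And>y'. y' \<in> span B \<Longrightarrow> y' \<in> S3 \<Longrightarrow> dil B w t y' \<in> V1"
      using smooth_at_nbhd[OF E E sdt V1(1) Vt] by auto
    have Tt: "h 0 (\<Theta> (dil B w t y)) \<in> T" using S2 t by simp
    obtain S4 where S4: "open S4" "y \<in> S4" "\<And>y'. y' \<in> span B \<Longrightarrow> y' \<in> S4 \<Longrightarrow> h 0 (\<Theta> (dil B w t y')) \<in> T"
      using smooth_at_nbhd[OF E space smooth_at_compose[OF E E space sdt s\<Theta>[OF Vt dil_in_span]] T(1) Tt] by auto
    have "dil B w t y' \<in> V1 \<and> \<Theta> (dil B w t y') \<in> MT \<and> h (1 / t) (\<Theta> (dil B w t y')) \<in> MT \<and>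
        Psi (h (1 / t) (\<Theta> (dil B w t y'))) = y'" if y': "y' \<in> span B" "y' \<in> S3" "y' \<in> S4" for y'
    proof -
      have V': "dil B w t y' \<in> V1" using S3 y' by blast
      then have m: "\<Theta> (dil B w t y') \<in> MT"
        using S4(3)[OF y'(1,3)] \<Theta>[OF V' dil_in_span] by (simp add: MT_def)
      then show ?thesis
        using V' MT_h[OF m] \<Theta>[OF V' dil_in_span] t dil_1[OF B(1) y'(1)]
        by (simp add: Psi_MT dil_dil[OF B(1)])
    qed
    then show ?thesis using t S3(1,2) S4(1,2) by (intro exI[of _ t] exI[of _ "S3 \<inter> S4"]) auto
  qed
  show ?thesis
  proof (rule that[OF T(1,2) B(1)])
    show "smooth_at M A (euclidean_atlas (span B)) Psi p" if "p \<in> M" "h 0 p \<in> T" for p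
      using smooth_at_Psi MT_U[of p] that by (simp add: MT_def)
    show "Psi (h s p) = dil B w s (Psi p)" if "p \<in> M" "h 0 p \<in> T" for p s
      using Psi_MT[of p] that by (simp add: MT_def)
    show "\<Theta>' (Psi p) = p \<and> Psi p \<in> span B" if "p \<in> M" "h 0 p \<in> T" for p
      using inv_into_f_f[OF inj_on, of p] that by (simp add: MT_def \<Theta>'_def Psi_span)
    show "\<Theta>' y \<in> M \<and> h 0 (\<Theta>' y) \<in> T \<and> Psi (\<Theta>' y) = y \<and> smooth_at (span B) (euclidean_atlas (span B)) A \<Theta>' y"
      if y: "y \<in> span B" "dil B w 0 y \<in> Psi ` (h 0 ` M \<inter> T)" for y
    proof -
      obtain t S where tS: "t > 0" "open S" "y \<in> S" "\<And>y'. y' \<in> span B \<Longrightarrow> y' \<in> S \<Longrightarrow> dil B w t y' \<in> V1 \<and>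
        \<Theta> (dil B w t y') \<in> MT \<and> h (1 / t) (\<Theta> (dil B w t y')) \<in> MT \<and> Psi (h (1 / t) (\<Theta> (dil B w t y'))) = y'"
        using small[OF y(1)] y(2) by (auto simp: Om_def)
      \<comment> \<open>The value of \<open>\<Theta>'\<close> is independent of t; near y it has a
        smooth expression with one fixed t.\<close>
      have eq: "\<Theta>' y' = h (1 / t) (\<Theta> (dil B w t y'))" if "y' \<in> span B" "y' \<in> S" for y'
        using tS(4)[OF that] inv_into_f_f[OF inj_on] unfolding \<Theta>'_def by metis
      have "smooth_at (span B) (euclidean_atlas (span B)) (euclidean_atlas (span B)) (dil B w t) y"
        by (intro smooth_at_euclidI smooth_on_linear linear_dil) (auto simp: dil_in_span y)
      from smooth_at_compose[OF E E space this]
      have "smooth_at (span B) (euclidean_atlas (span B)) A (\<lambda>y. \<Theta> (dil B w t y)) y"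
        using \<Theta>[OF _ dil_in_span] tS(4)[OF y(1) tS(3)] by blast
      then have "smooth_at (span B) (euclidean_atlas (span B)) A (\<lambda>y. h (1 / t) (\<Theta> (dil B w t y))) y"
        using tS(4)[OF y(1) tS(3)] by (intro smooth_at_compose[OF E space space _ smooth_at_time]) (auto simp: MT_def)
      then have "smooth_at (span B) (euclidean_atlas (span B)) A \<Theta>' y"
        by (rule smooth_at_cong[OF E _ tS(2,3)]) (simp add: eq)
      then show ?thesis using tS(4)[OF y(1) tS(3)] eq[OF y(1) tS(3)] by (simp add: MT_def)
    qed
    let ?B0 = "{b \<in> B. w b = 0}"
    have B0: "?B0 \<subseteq> Basis" "span ?B0 \<subseteq> span B" using B(1) span_mono[of ?B0 B] by auto
    show "openin (top_of_set (span ?B0)) (Psi ` (h 0 ` M \<inter> T))"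
    proof (subst openin_subopen, intro ballI)
      fix y assume "y \<in> Psi ` (h 0 ` M \<inter> T)"
      then obtain q where "q \<in> M" "h 0 q \<in> T" "y = Psi (h 0 q)" by auto
      then obtain x where x: "x \<in> M" "h 0 x = x" "x \<in> T" "y = Psi x"
        by (intro that[of "h 0 q"]) (simp_all add: h_h in_M)
      have xMT: "x \<in> MT" using x by (simp add: MT_def)
      have yB: "y \<in> span ?B0"
        using Psi_MT[OF xMT, of 0] x dil_0_in_span[OF B(1), of w "Psi x"] by simp
      have yO: "dil B w 0 y \<in> Om" using Om_MT[OF xMT] x by simp
      have ys: "y \<in> span B" using yB B0 by blast
      obtain t S where tS: "t > 0" "open S" "y \<in> S" "\<And>y'. y' \<in> span B \<Longrightarrow> y' \<in> S \<Longrightarrow>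
          h (1 / t) (\<Theta> (dil B w t y')) \<in> MT \<and> Psi (h (1 / t) (\<Theta> (dil B w t y'))) = y'"
        using small[OF ys yO] by auto
      have "span ?B0 \<inter> S \<subseteq> Psi ` (h 0 ` M \<inter> T)"
      proof
        fix y' assume y': "y' \<in> span ?B0 \<inter> S"
        then have q: "h (1 / t) (\<Theta> (dil B w t y')) \<in> MT" "Psi (h (1 / t) (\<Theta> (dil B w t y'))) = y'"
          using tS(4) B0 by blast+
        \<comment> \<open>A vector of weight 0 is not moved by \<open>dil B w 0\<close>, so it is
          also the coordinate of the projection to the base of the point just found.\<close>
        have "y' = dil B w 0 y'" using dil_weight_0[OF B(1), of y' w 0] y' by simp
        then show "y' \<in> Psi ` (h 0 ` M \<inter> T)" using Om_MT[OF q(1)] q(2) by (simp add: Om_def)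
      qed
      then show "\<exists>S. openin (top_of_set (span ?B0)) S \<and> y \<in> S \<and> S \<subseteq> Psi ` (h 0 ` M \<inter> T)"
        using tS(2,3) yB by (intro exI[of _ "span ?B0 \<inter> S"]) auto
    qed
  qed
qed

end

section \<open>The base and the bundle of homogeneous coordinates\<close>

lemma smooth_at_continuous_on:
  assumes M: "smooth_space M A" and N: "smooth_space N A'" and "S \<subseteq> M"
    and F: "\<And>p. p \<in> S \<Longrightarrow> smooth_at M A A' F p"
  shows "continuous_on S F"
  unfolding continuous_on_topological
proof (intro ballI allI impI)
  fix p T assume "p \<in> S" "open T" "F p \<in> T"
  then show "\<exists>V. open V \<and> p \<in> V \<and> (\<forall>q\<in>S. q \<in> V \<longrightarrow> F q \<in> T)"
    using smooth_at_nbhd[OF M N F[of p], of T] assms(3) by (metis subsetD)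
qed

context homothety_action
begin

text \<open>Bundles the conclusion of \<open>homogeneous_coordinates\<close> into one predicate, so
  that all such systems together can be used as an atlas. \<open>T\<close> matters only through the
  base points it contains.\<close>

definition coordinates ::
  "'m set \<Rightarrow> 'e set \<Rightarrow> ('e \<Rightarrow> nat) \<Rightarrow> ('m \<Rightarrow> 'e) \<Rightarrow> ('e \<Rightarrow> 'm) \<Rightarrow> bool" where
  "coordinates T B w \<Psi> \<Theta> \<longleftrightarrow> open T \<and> B \<subseteq> Basis \<and>
    (\<forall>p\<in>M. h 0 p \<in> T \<longrightarrow> smooth_at M A (euclidean_atlas (span B)) \<Psi> p \<and>
       (\<forall>s. \<Psi> (h s p) = dil B w s (\<Psi> p)) \<and> \<Theta> (\<Psi> p) = p \<and> \<Psi> p \<in> span B) \<and>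
    (\<forall>y\<in>span B. dil B w 0 y \<in> \<Psi> ` (h 0 ` M \<inter> T) \<longrightarrow> \<Theta> y \<in> M \<and> h 0 (\<Theta> y) \<in> T \<and>
      \<Psi> (\<Theta> y) = y \<and> smooth_at (span B) (euclidean_atlas (span B)) A \<Theta> y) \<and>
    openin (top_of_set (span {b \<in> B. w b = 0})) (\<Psi> ` (h 0 ` M \<inter> T))"

text \<open>The same function \<open>\<Psi>\<close>, restricted to fixed points, is the chart of the
  base: there it takes values in the span of the basis vectors of weight 0.\<close>

definition base_charts :: "('m, 'e) chart set" where
  "base_charts = {(h 0 ` M \<inter> T, \<Psi>) | T \<Psi>. \<exists>B w \<Theta>. coordinates T B w \<Psi> \<Theta>}"

definition base_atlas :: "('m, 'e) chart set" where
  "base_atlas = maximal_atlas (h 0 ` M) base_charts"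

lemma M0_iff: "x \<in> h 0 ` M \<longleftrightarrow> x \<in> M \<and> h 0 x = x"
  by (auto simp: in_M h_h) (metis imageI)

lemma ex_coordinates:
  assumes "x \<in> h 0 ` M" obtains T B w \<Psi> \<Theta> where "coordinates T B w \<Psi> \<Theta>" "x \<in> T"
proof -
  have x: "x \<in> M" "h 0 x = x" using assms M0_iff by auto
  show ?thesis
  proof (rule homogeneous_coordinates[OF x], goal_cases)
    case (1 T w \<Theta> B \<Psi>)
    have "coordinates T B w \<Psi> \<Theta>"
      unfolding coordinates_def by (intro conjI ballI impI allI) (simp_all add: 1)
    then show ?case using 1(2) by (rule that)
  qed
qed

lemma coordinatesD:
  assumes "coordinates T B w \<Psi> \<Theta>"
  shows "open T" "B \<subseteq> Basis"
    "p \<in> M \<Longrightarrow> h 0 p \<in> T \<Longrightarrow> smooth_at M A (euclidean_atlas (span B)) \<Psi> p"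
    "p \<in> M \<Longrightarrow> h 0 p \<in> T \<Longrightarrow> \<Psi> (h s p) = dil B w s (\<Psi> p)"
    "p \<in> M \<Longrightarrow> h 0 p \<in> T \<Longrightarrow> \<Theta> (\<Psi> p) = p"
    "p \<in> M \<Longrightarrow> h 0 p \<in> T \<Longrightarrow> \<Psi> p \<in> span B"
    "y \<in> span B \<Longrightarrow> dil B w 0 y \<in> \<Psi> ` (h 0 ` M \<inter> T) \<Longrightarrow> \<Theta> y \<in> M"
    "y \<in> span B \<Longrightarrow> dil B w 0 y \<in> \<Psi> ` (h 0 ` M \<inter> T) \<Longrightarrow> h 0 (\<Theta> y) \<in> T"
    "y \<in> span B \<Longrightarrow> dil B w 0 y \<in> \<Psi> ` (h 0 ` M \<inter> T) \<Longrightarrow> \<Psi> (\<Theta> y) = y"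
    "y \<in> span B \<Longrightarrow> dil B w 0 y \<in> \<Psi> ` (h 0 ` M \<inter> T) \<Longrightarrow>
      smooth_at (span B) (euclidean_atlas (span B)) A \<Theta> y"
    "openin (top_of_set (span {b \<in> B. w b = 0})) (\<Psi> ` (h 0 ` M \<inter> T))"
  using assms unfolding coordinates_def by blast+

lemma coordinates_base:
  assumes c: "coordinates T B w \<Psi> \<Theta>" and x: "x \<in> h 0 ` M \<inter> T"
  shows "\<Psi> x \<in> span B" "dil B w 0 (\<Psi> x) = \<Psi> x" "\<Theta> (\<Psi> x) = x" "dil B w 0 (\<Psi> x) \<in> \<Psi> ` (h 0 ` M \<inter> T)"
proof -
  have x': "x \<in> M" "h 0 x = x" "h 0 x \<in> T" using x M0_iff by auto
  show "\<Psi> x \<in> span B" by (rule coordinatesD(6)[OF c x'(1,3)])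
  show 1: "dil B w 0 (\<Psi> x) = \<Psi> x" using coordinatesD(4)[OF c x'(1,3), of 0] x'(2) by simp
  show "\<Theta> (\<Psi> x) = x" by (rule coordinatesD(5)[OF c x'(1,3)])
  show "dil B w 0 (\<Psi> x) \<in> \<Psi> ` (h 0 ` M \<inter> T)" using 1 x by simp
qed

lemma inj_on_base: "coordinates T B w \<Psi> \<Theta> \<Longrightarrow> inj_on \<Psi> (h 0 ` M \<inter> T)"
  by (rule inj_on_inverseI[of _ \<Theta>]) (rule coordinates_base(3))

lemma inv_into_base:
  assumes c: "coordinates T B w \<Psi> \<Theta>" and "y \<in> \<Psi> ` (h 0 ` M \<inter> T)"
  shows "inv_into (h 0 ` M \<inter> T) \<Psi> y = \<Theta> y"
proof -
  obtain x where "x \<in> h 0 ` M \<inter> T" "y = \<Psi> x" using assms(2) by blast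
  then show ?thesis using inv_into_f_f[OF inj_on_base[OF c]] coordinates_base(3)[OF c] by simp
qed

lemma coordinates_base_sub: "coordinates T B w \<Psi> \<Theta> \<Longrightarrow> \<Psi> ` (h 0 ` M \<inter> T) \<subseteq> span B"
  using coordinates_base(1) by blast

lemma base_smooth_Theta:
  assumes c: "coordinates T B w \<Psi> \<Theta>" and y: "y \<in> \<Psi> ` (h 0 ` M \<inter> T)"
  shows "smooth_at (span B) (euclidean_atlas (span B)) A \<Theta> y"
  using coordinatesD(10)[OF c] coordinates_base[OF c] y by auto

text \<open>A transition map is \<open>\<Theta>\<close> followed by another \<open>\<psi>\<close>.
  Both are smooth as maps to and from M near base points, so no separate calculus on the base is
  required.\<close>

lemma smooth_manifold_base: "smooth_manifold (h 0 ` M) base_charts"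
  unfolding smooth_manifold_iff
proof (intro conjI allI impI)
  fix U \<phi> assume "(U, \<phi>) \<in> base_charts"
  then obtain T B w \<Theta> where c: "coordinates T B w \<phi> \<Theta>" and U: "U = h 0 ` M \<inter> T"
    by (auto simp: base_charts_def)
  show "is_chart (h 0 ` M) (U, \<phi>)"
    unfolding is_chart_def prod.case
  proof (intro conjI)
    show "openin (top_of_set (h 0 ` M)) U" using coordinatesD(1)[OF c] U by auto
    show "\<exists>B\<subseteq>Basis. openin (top_of_set (span B)) (\<phi> ` U)"
      using coordinatesD(2,11)[OF c] U by (intro exI[of _ "{b \<in> B. w b = 0}"]) auto
    show "homeomorphism U (\<phi> ` U) \<phi> (inv_into U \<phi>)"
    proof (rule homeomorphismI)
      show "continuous_on U \<phi>"
        using M0_iff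
        by (intro smooth_at_continuous_on[OF space smooth_space_euclid _ coordinatesD(3)[OF c]]) (auto simp: U)
      have "continuous_on (\<phi> ` U) \<Theta>"
        using coordinates_base_sub[OF c]
        by (intro smooth_at_continuous_on[OF smooth_space_euclid space _ base_smooth_Theta[OF c]]) (auto simp: U)
      then show "continuous_on (\<phi> ` U) (inv_into U \<phi>)"
        by (rule continuous_on_eq) (simp add: U inv_into_base[OF c])
    qed (use inv_into_f_f[OF inj_on_base[OF c]] U in auto)
  qed
next
  show "(\<Union>(U, \<phi>)\<in>base_charts. U) = h 0 ` M"
  proof
    show "(\<Union>(U, \<phi>)\<in>base_charts. U) \<subseteq> h 0 ` M" by (auto simp: base_charts_def)
    show "h 0 ` M \<subseteq> (\<Union>(U, \<phi>)\<in>base_charts. U)"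
    proof
      fix x assume x: "x \<in> h 0 ` M"
      then obtain T B w \<Psi> \<Theta> where c: "coordinates T B w \<Psi> \<Theta>" "x \<in> T" using ex_coordinates by metis
      then have "(h 0 ` M \<inter> T, \<Psi>) \<in> base_charts" by (auto simp: base_charts_def)
      then show "x \<in> (\<Union>(U, \<phi>)\<in>base_charts. U)" using x c(2) by blast
    qed
  qed
next
  fix U \<phi> V \<psi> assume "(U, \<phi>) \<in> base_charts" "(V, \<psi>) \<in> base_charts"
  then obtain T B w \<Theta> T' B' w' \<Theta>' where c: "coordinates T B w \<phi> \<Theta>" "U = h 0 ` M \<inter> T"
    and c': "coordinates T' B' w' \<psi> \<Theta>'" "V = h 0 ` M \<inter> T'"
    by (auto simp: base_charts_def)
  have "smooth_on (\<phi> ` (U \<inter> V)) (\<lambda>y. \<psi> (\<Theta> y))"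
  proof (rule smooth_at_smooth_on)
    fix y assume y: "y \<in> \<phi> ` (U \<inter> V)"
    then obtain x where x: "x \<in> h 0 ` M \<inter> T" "x \<in> T'" "y = \<phi> x" using c c' by blast
    have "\<Theta> y = x" using coordinates_base(3)[OF c(1) x(1)] x by simp
    moreover have "x \<in> M" "h 0 x \<in> T'" using x M0_iff by auto
    ultimately have s: "smooth_at M A (euclidean_atlas (span B')) \<psi> (\<Theta> y)"
      using coordinatesD(3)[OF c'(1)] by simp
    have "y \<in> \<phi> ` (h 0 ` M \<inter> T)" using x by blast
    from smooth_at_compose[OF smooth_space_euclid space smooth_space_euclid base_smooth_Theta[OF c(1) this] s]
    have sm: "smooth_at (span B) (euclidean_atlas (span B)) (euclidean_atlas (span B')) (\<lambda>y. \<psi> (\<Theta> y)) y" .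
    have sub: "\<phi> ` (U \<inter> V) \<subseteq> span B" using coordinates_base_sub[OF c(1)] c(2) by blast
    show "smooth_at (\<phi> ` (U \<inter> V)) (euclidean_atlas (\<phi> ` (U \<inter> V))) (euclidean_atlas (span B')) (\<lambda>y. \<psi> (\<Theta> y)) y"
      by (rule smooth_at_euclid_source_subset[OF smooth_space_euclid sm sub y])
  qed
  then show "smooth_on (\<phi> ` (U \<inter> V)) (\<psi> \<circ> inv_into U \<phi>)"
    by (rule smooth_on_cong) (use c(2) in \<open>auto simp: inv_into_base[OF c(1)]\<close>)
qed

lemma smooth_structure_base: "smooth_structure (h 0 ` M) base_atlas"
  unfolding base_atlas_def by (rule smooth_structure_maximal_atlas[OF smooth_manifold_base])

lemma space_base: "smooth_space (h 0 ` M) base_atlas"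
  using smooth_structure_base smooth_manifold_space unfolding smooth_structure_def by blast

lemma base_chart:
  assumes "coordinates T B w \<Psi> \<Theta>" shows "(h 0 ` M \<inter> T, \<Psi>) \<in> base_atlas"
proof -
  have "(h 0 ` M \<inter> T, \<Psi>) \<in> base_charts" using assms by (auto simp: base_charts_def)
  then show ?thesis
    unfolding base_atlas_def using maximal_atlas_superset[OF smooth_manifold_base] by blast
qed

lemma smooth_at_projection:
  assumes p: "p \<in> M" shows "smooth_at M A base_atlas (h 0) p"
proof -
  have x: "h 0 p \<in> h 0 ` M" using p by simp
  obtain T B w \<Psi> \<Theta> where c: "coordinates T B w \<Psi> \<Theta>" "h 0 p \<in> T" using ex_coordinates[OF x] .
  let ?O = "\<Psi> ` (h 0 ` M \<inter> T)"
  obtain S where S: "open S" "p \<in> S" "\<And>q. q \<in> M \<Longrightarrow> q \<in> S \<Longrightarrow> h 0 q \<in> T"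
    using smooth_at_nbhd[OF space space smooth_at_time[OF p] coordinatesD(1)[OF c(1)] c(2)] by blast
  have "smooth_at M A (euclidean_atlas (span B)) \<Psi> (h 0 p)"
    using coordinatesD(3)[OF c(1)] in_M[OF p] h_h[OF p] c(2) by simp
  from smooth_at_compose[OF space space smooth_space_euclid smooth_at_time[OF p] this]
  have "smooth_at M A (euclidean_atlas ?O) (\<lambda>q. \<Psi> (h 0 q)) p"
    by (rule smooth_at_euclid_target[OF space _ S(1,2)]) (use S(3) in auto)
  from smooth_at_compose[OF space smooth_space_euclid space_base this smooth_at_chart_inv[OF space_base base_chart[OF c(1)]]]
  have "smooth_at M A base_atlas (\<lambda>q. inv_into (h 0 ` M \<inter> T) \<Psi> (\<Psi> (h 0 q))) p"
    using x c(2) by blast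
  then show ?thesis
    by (rule smooth_at_cong[OF space _ S(1,2)]) (use S(3) inv_into_f_f[OF inj_on_base[OF c(1)]] in auto)
qed

lemma smooth_map_projection: "smooth_map M A (h 0 ` M) base_atlas (h 0)"
  using smooth_map_iff[OF space space_base] smooth_at_projection by auto

text \<open>The components of positive weight. Those of weight 0 are constant along the fibers and
  equal to \<open>\<Psi> (h 0 p)\<close>, the base coordinates.\<close>

definition fiber_coords :: "'e set \<Rightarrow> ('e \<Rightarrow> nat) \<Rightarrow> ('m \<Rightarrow> 'e) \<Rightarrow> 'm \<Rightarrow> 'e" where
  "fiber_coords B w \<Psi> p = proj {b \<in> B. w b > 0} (\<Psi> p)"

lemma dil_0_plus_proj:
  assumes "B \<subseteq> Basis" "v \<in> span B" shows "dil B w 0 v + proj {b \<in> B. w b > 0} v = v"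
proof (rule in_span_Basis_eqI[OF assms(1) _ assms(2)])
  let ?B = "{b \<in> B. w b > 0}"
  have B: "?B \<subseteq> Basis" using assms(1) by auto
  have "proj ?B v \<in> span B" using dil_in_span[of ?B] span_mono[of ?B B] by auto
  then show "dil B w 0 v + proj ?B v \<in> span B" by (intro span_add dil_in_span)
  fix b assume b: "b \<in> B"
  have "proj ?B v \<bullet> b = (if w b > 0 then v \<bullet> b else 0)"
    unfolding dil_def using b assms(1) by (subst inner_sum_Basis_subset[OF B]) auto
  then show "(dil B w 0 v + proj ?B v) \<bullet> b = v \<bullet> b"
    using b by (auto simp: inner_add_left dil_inner[OF assms(1)] power_0_left)
qed

lemma dil_0_pos:
  assumes "B \<subseteq> Basis" "\<eta> \<in> span {b \<in> B. w b > 0}" shows "dil B w 0 \<eta> = 0"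
proof -
  let ?B = "{b \<in> B. w b > 0}"
  have B: "?B \<subseteq> Basis" using assms(1) by auto
  have "\<eta> \<in> span B" using assms(2) span_mono[of ?B B] by auto
  from dil_0_plus_proj[OF assms(1) this, of w] show ?thesis using dil_1[OF B assms(2)] by simp
qed

text \<open>The components of weight 0 and of positive weight add up to \<open>\<Psi> p\<close>, so
  the inverse of the trivialization is (x, \<eta>) \<mapsto>
  \<open>\<Theta> (\<Psi> x + \<eta>)\<close>.\<close>

lemma graded_trivialization_coordinates:
  assumes c: "coordinates T B w \<Psi> \<Theta>"
  shows "is_graded_trivialization M A (h 0 ` M) base_atlas (h 0)
    (h 0 ` M \<inter> T, {b \<in> B. w b > 0}, w, fiber_coords B w \<Psi>)"
proof -
  let ?U = "h 0 ` M \<inter> T" and ?B = "{b \<in> B. w b > 0}" and ?y = "fiber_coords B w \<Psi>"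
  let ?MT = "M \<inter> h 0 -` ?U" and ?F = "\<lambda>p. (h 0 p, ?y p)" and ?G = "\<lambda>(x, \<eta>). \<Theta> (\<Psi> x + \<eta>)"
  note B = coordinatesD(2)[OF c] and T = coordinatesD(1)[OF c]
  have B': "?B \<subseteq> Basis" "span ?B \<subseteq> span B" using B span_mono[of ?B B] by auto
  have MT: "p \<in> ?MT \<longleftrightarrow> p \<in> M \<and> h 0 p \<in> T" for p by auto
  have "continuous_on M (h 0)"
    by (rule smooth_at_continuous_on[OF space space order_refl smooth_at_time])
  from continuous_openin_preimage_gen[OF this T]
  obtain S where "open S" "M \<inter> h 0 -` T = M \<inter> S" by (auto simp: openin_open)
  then have S: "open S" "?MT = M \<inter> S" by auto
  have spMT: "smooth_space ?MT (restrict_atlas A ?MT)" by (rule smooth_space_restrict[OF space]) auto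
  have spU: "smooth_space ?U (restrict_atlas base_atlas ?U)" by (rule smooth_space_restrict[OF space_base]) auto
  note spE = smooth_space_euclid[of "span ?B"]
  note spP = smooth_space_prod[OF spU spE]
  have Psi_split: "\<Psi> (h 0 p) + ?y p = \<Psi> p" if "p \<in> ?MT" for p
    using that MT dil_0_plus_proj[OF B coordinatesD(6)[OF c], of p w] coordinatesD(4)[OF c, of p 0]
    by (simp add: fiber_coords_def)
  have y_span: "?y p \<in> span ?B" for p by (simp add: fiber_coords_def dil_in_span)
  have G: "\<Psi> x + \<eta> \<in> span B" "dil B w 0 (\<Psi> x + \<eta>) \<in> \<Psi> ` ?U" "\<Theta> (\<Psi> x + \<eta>) \<in> ?MT"
    "h 0 (\<Theta> (\<Psi> x + \<eta>)) = x" "?y (\<Theta> (\<Psi> x + \<eta>)) = \<eta>" if x: "x \<in> ?U" and \<eta>: "\<eta> \<in> span ?B" for x \<eta>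
  proof -
    show v: "\<Psi> x + \<eta> \<in> span B" using coordinates_base(1)[OF c x] \<eta> B' by (intro span_add) auto
    have d: "dil B w 0 (\<Psi> x + \<eta>) = \<Psi> x"
      by (simp add: linear_add[OF linear_dil] coordinates_base(2)[OF c x] dil_0_pos[OF B \<eta>])
    then show dd: "dil B w 0 (\<Psi> x + \<eta>) \<in> \<Psi> ` ?U" using x by simp
    let ?p = "\<Theta> (\<Psi> x + \<eta>)"
    show p: "?p \<in> ?MT" using MT coordinatesD(7,8)[OF c v dd] by blast
    then have p': "?p \<in> M" "h 0 ?p \<in> T" by auto
    have P: "\<Psi> ?p = \<Psi> x + \<eta>" by (rule coordinatesD(9)[OF c v dd])
    have "\<Psi> (h 0 ?p) = \<Psi> x" using coordinatesD(4)[OF c p', of 0] P d by simp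
    then show hp: "h 0 ?p = x" using inj_onD[OF inj_on_base[OF c] _ _ x] p by blast
    show "?y ?p = \<eta>" using Psi_split[OF p] hp P by simp
  qed
  have GF: "?G (?F p) = p" if "p \<in> ?MT" for p
    using Psi_split[OF that] coordinatesD(5)[OF c] that MT by auto
  have bij: "bij_betw ?F ?MT (?U \<times> span ?B)"
    by (rule bij_betwI[of _ _ _ ?G]) (use y_span G GF in auto)
  have inv: "inv_into ?MT ?F z = ?G z" if z: "z \<in> ?U \<times> span ?B" for z
  proof -
    obtain x \<eta> where x: "z = (x, \<eta>)" "x \<in> ?U" "\<eta> \<in> span ?B" using z by auto
    show ?thesis
      unfolding x(1) prod.case
      by (rule inv_into_f_eq[OF bij_betw_imp_inj_on[OF bij] G(3)[OF x(2,3)]]) (simp add: G[OF x(2,3)])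
  qed
  have fwd: "smooth_at ?MT (restrict_atlas A ?MT) (prod_atlas (restrict_atlas base_atlas ?U) (euclidean_atlas (span ?B))) ?F p"
    if p: "p \<in> ?MT" for p
  proof (rule smooth_at_Pair[OF spMT spU spE])
    have i: "smooth_at ?MT (restrict_atlas A ?MT) A (\<lambda>x. x) p"
      by (rule smooth_at_restrict_incl[OF space _ p]) auto
    have p': "p \<in> M" "h 0 p \<in> h 0 ` M \<inter> T" using p by auto
    from smooth_at_compose[OF spMT space_base spU smooth_at_compose[OF spMT space space_base i smooth_at_projection[OF p'(1)]]
        smooth_at_restrict_into[OF space_base T p'(2)]]
    show "smooth_at ?MT (restrict_atlas A ?MT) (restrict_atlas base_atlas ?U) (h 0) p" .
    have "smooth_at M A (euclidean_atlas (span B)) \<Psi> p" using coordinatesD(3)[OF c] p' by auto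
    from smooth_at_smooth_on_comp[OF spMT smooth_at_compose[OF spMT space smooth_space_euclid i this]
        smooth_on_linear[OF linear_dil]]
    show "smooth_at ?MT (restrict_atlas A ?MT) (euclidean_atlas (span ?B)) ?y p"
      unfolding fiber_coords_def[abs_def] using dil_in_span by blast
  qed
  have bwd: "smooth_at (?U \<times> span ?B) (prod_atlas (restrict_atlas base_atlas ?U) (euclidean_atlas (span ?B)))
      (restrict_atlas A ?MT) (inv_into ?MT ?F) z" if z: "z \<in> ?U \<times> span ?B" for z
  proof -
    obtain x \<eta> where x: "z = (x, \<eta>)" "x \<in> ?U" "\<eta> \<in> span ?B" using z by auto
    let ?P = "prod_atlas (restrict_atlas base_atlas ?U) (euclidean_atlas (span ?B))"
    have f: "smooth_at (?U \<times> span ?B) ?P (restrict_atlas base_atlas ?U) fst z" by (rule smooth_at_fst[OF spU spE z])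
    have s: "smooth_at (?U \<times> span ?B) ?P (euclidean_atlas UNIV) snd z"
      by (rule smooth_at_euclid_target_mono[OF spP smooth_at_snd[OF spU spE z]]) simp
    have i: "smooth_at ?U (restrict_atlas base_atlas ?U) base_atlas (\<lambda>x. x) (fst z)"
      using x by (intro smooth_at_restrict_incl[OF space_base]) auto
    have ch: "smooth_at (h 0 ` M) base_atlas (euclidean_atlas UNIV) \<Psi> (fst z)"
      using x by (intro smooth_at_chart[OF space_base base_chart[OF c]]) auto
    have "smooth_at (?U \<times> span ?B) ?P (euclidean_atlas UNIV) (\<lambda>z. \<Psi> (fst z)) z"
      by (rule smooth_at_compose[OF spP space_base smooth_space_euclid smooth_at_compose[OF spP spU space_base f i] ch])
    from smooth_at_add[OF spP this s]
    have "smooth_at (?U \<times> span ?B) ?P (euclidean_atlas (span B)) (\<lambda>z. \<Psi> (fst z) + snd z) z"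
      by (rule smooth_at_euclid_target[OF spP _ open_UNIV]) (use G(1) in auto)
    from smooth_at_compose[OF spP smooth_space_euclid space this]
    have sm: "smooth_at (?U \<times> span ?B) ?P A (\<lambda>z. \<Theta> (\<Psi> (fst z) + snd z)) z"
      using coordinatesD(10)[OF c G(1,2)[OF x(2,3)]] x(1) by simp
    have "smooth_at M A (restrict_atlas A ?MT) (\<lambda>x. x) (\<Theta> (\<Psi> (fst z) + snd z))"
      using smooth_at_restrict_into[OF space S(1), folded S(2)] G(3)[OF x(2,3)] x(1) by simp
    from smooth_at_compose[OF spP space spMT sm this]
    have "smooth_at (?U \<times> span ?B) ?P (restrict_atlas A ?MT) (\<lambda>z. \<Theta> (\<Psi> (fst z) + snd z)) z" .
    then show ?thesis
      by (rule smooth_at_cong[OF spP _ open_UNIV UNIV_I]) (simp only: inv case_prod_unfold)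
  qed
  have "diffeomorphism ?MT (restrict_atlas A ?MT) (?U \<times> span ?B)
      (prod_atlas (restrict_atlas base_atlas ?U) (euclidean_atlas (span ?B))) ?F"
    unfolding diffeomorphism_def smooth_map_iff[OF spMT spP] smooth_map_iff[OF spP spMT]
    using bij bij_betw_imp_surj_on[OF bij] bij_betw_imp_surj_on[OF bij_betw_inv_into[OF bij]] fwd bwd
    by auto
  then show ?thesis
    unfolding is_graded_trivialization_def prod.case using T B' by auto
qed

lemma fiber_coords_h:
  assumes c: "coordinates T B w \<Psi> \<Theta>" and p: "p \<in> M" "h 0 p \<in> T" and b: "b \<in> {b \<in> B. w b > 0}"
  shows "fiber_coords B w \<Psi> (h t p) \<bullet> b = t ^ w b * (fiber_coords B w \<Psi> p \<bullet> b)"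
proof -
  have B: "{b \<in> B. w b > 0} \<subseteq> Basis" using coordinatesD(2)[OF c] by auto
  show ?thesis
    using b coordinatesD(4)[OF c p, of t]
    by (simp add: fiber_coords_def dil_inner[OF B] dil_inner[OF coordinatesD(2)[OF c]])
qed

end

section \<open>Transition maps, maximality and uniqueness\<close>

context homothety_action
begin

text \<open>Rephrases a trivialization without restricted atlases on M. The structure
  \<open>N\<close> of the base is arbitrary, because uniqueness has to handle a competitor of
  \<open>base_atlas\<close>.\<close>

lemma trivialization_inverse:
  fixes N :: "('m, 'd::euclidean_space) chart set" and B :: "'f::euclidean_space set"
  assumes N: "smooth_space (h 0 ` M) N"
    and triv: "is_graded_trivialization M A (h 0 ` M) N (h 0) (U, B, w, y)"
  obtains J where
    "\<And>x \<eta>. x \<in> U \<Longrightarrow> \<eta> \<in> span B \<Longrightarrow> J (x, \<eta>) \<in> M \<and> h 0 (J (x, \<eta>)) = x \<and> y (J (x, \<eta>)) = \<eta>"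
    "\<And>p. p \<in> M \<Longrightarrow> h 0 p \<in> U \<Longrightarrow> J (h 0 p, y p) = p \<and> y p \<in> span B \<and> smooth_at M A (euclidean_atlas (span B)) y p"
    "\<And>z. z \<in> U \<times> span B \<Longrightarrow>
      smooth_at (U \<times> span B) (prod_atlas (restrict_atlas N U) (euclidean_atlas (span B))) A J z"
proof -
  let ?MT = "M \<inter> h 0 -` U" and ?F = "\<lambda>p. (h 0 p, y p)"
  let ?P = "prod_atlas (restrict_atlas N U) (euclidean_atlas (span B))"
  have U: "openin (top_of_set (h 0 ` M)) U"
    and diffeo: "diffeomorphism ?MT (restrict_atlas A ?MT) (U \<times> span B) ?P ?F"
    using triv by (auto simp: is_graded_trivialization_def)
  obtain Q where Q: "open Q" "U = h 0 ` M \<inter> Q" using U by (auto simp: openin_open)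
  have "continuous_on M (h 0)"
    by (rule smooth_at_continuous_on[OF space space order_refl smooth_at_time])
  from continuous_openin_preimage_gen[OF this Q(1)]
  obtain S where "open S" "M \<inter> h 0 -` Q = M \<inter> S" by (auto simp: openin_open)
  then have S: "open S" "?MT = M \<inter> S" using Q(2) by auto
  have spMT: "smooth_space ?MT (restrict_atlas A ?MT)" by (rule smooth_space_restrict[OF space]) auto
  have spU: "smooth_space U (restrict_atlas N U)" by (rule smooth_space_restrict[OF N]) (use Q in auto)
  note spE = smooth_space_euclid[of "span B"]
  note spP = smooth_space_prod[OF spU spE]
  have bij: "bij_betw ?F ?MT (U \<times> span B)" and
    F: "p \<in> ?MT \<Longrightarrow> smooth_at ?MT (restrict_atlas A ?MT) ?P ?F p" and
    J: "z \<in> U \<times> span B \<Longrightarrow> smooth_at (U \<times> span B) ?P (restrict_atlas A ?MT) (inv_into ?MT ?F) z" for p z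
    using diffeo unfolding diffeomorphism_def smooth_map_iff[OF spMT spP] smooth_map_iff[OF spP spMT] by blast+
  have MT: "p \<in> ?MT \<longleftrightarrow> p \<in> M \<and> h 0 p \<in> U" for p by auto
  have FJ: "inv_into ?MT ?F z \<in> ?MT" "?F (inv_into ?MT ?F z) = z" if "z \<in> U \<times> span B" for z
  proof -
    have "z \<in> ?F ` ?MT" using that bij_betw_imp_surj_on[OF bij] by blast
    then show "inv_into ?MT ?F z \<in> ?MT" "?F (inv_into ?MT ?F z) = z" by (rule inv_into_into, rule f_inv_into_f)
  qed
  show ?thesis
  proof
    fix x \<eta> assume x: "x \<in> U" "\<eta> \<in> span B"
    then have "(x, \<eta>) \<in> U \<times> span B" by simp
    from FJ[OF this] show "inv_into ?MT ?F (x, \<eta>) \<in> M \<and> h 0 (inv_into ?MT ?F (x, \<eta>)) = x \<and>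
        y (inv_into ?MT ?F (x, \<eta>)) = \<eta>" by simp
  next
    fix p assume p: "p \<in> M" "h 0 p \<in> U"
    then have p': "p \<in> ?MT" by simp
    then have "?F p \<in> U \<times> span B" using bij_betwE[OF bij] by blast
    moreover have "smooth_at M A (euclidean_atlas (span B)) (\<lambda>q. snd (?F q)) p"
    proof -
      have "p \<in> M \<inter> S" using p' S(2) by simp
      from smooth_at_compose[OF space spMT spP smooth_at_restrict_into[OF space S(1) this, folded S(2)] F[OF p']]
      have "smooth_at M A ?P ?F p" .
      from smooth_at_compose[OF space spP spE this smooth_at_snd[OF spU spE]]
      show ?thesis using \<open>?F p \<in> U \<times> span B\<close> by blast
    qed
    ultimately show "inv_into ?MT ?F (h 0 p, y p) = p \<and> y p \<in> span B \<and> smooth_at M A (euclidean_atlas (span B)) y p"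
      using inv_into_f_f[OF bij_betw_imp_inj_on[OF bij] p'] by simp
  next
    fix z assume z: "z \<in> U \<times> span B"
    show "smooth_at (U \<times> span B) ?P A (inv_into ?MT ?F) z"
      by (rule smooth_at_compose[OF spP spMT space J[OF z] smooth_at_restrict_incl[OF space _ FJ(1)[OF z]]]) simp
  qed
qed

text \<open>Over \<open>U\<close> the zero section u \<mapsto> \<open>J (u, 0)\<close> is smooth
  from \<open>N1\<close> to M, and \<open>h 0\<close> is smooth from M to \<open>N2\<close>. Their
  composition is the identity.\<close>

lemma base_structure_mono:
  fixes N1 :: "('m, 'd::euclidean_space) chart set" and N2 :: "('m, 'f::euclidean_space) chart set"
    and \<T> :: "('m, 'm, 'g::euclidean_space) trivialization set"
  assumes N1: "smooth_space (h 0 ` M) N1" and N2: "smooth_space (h 0 ` M) N2"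
    and gb: "graded_bundle_atlas M A (h 0 ` M) N1 (h 0) \<T>"
    and proj: "smooth_map M A (h 0 ` M) N2 (h 0)" and x: "x \<in> h 0 ` M"
  shows "smooth_at (h 0 ` M) N1 N2 (\<lambda>x. x) x"
proof -
  have "h 0 ` M = (\<Union>(U, B, w, y)\<in>\<T>. U)" using gb by (auto simp: graded_bundle_atlas_def)
  then obtain U B w y where T: "(U, B, w, y) \<in> \<T>" "x \<in> U" using x by auto
  then have triv: "is_graded_trivialization M A (h 0 ` M) N1 (h 0) (U, B, w, y)"
    using gb by (auto simp: graded_bundle_atlas_def)
  obtain J where J: "\<And>x \<eta>. x \<in> U \<Longrightarrow> \<eta> \<in> span B \<Longrightarrow> J (x, \<eta>) \<in> M \<and> h 0 (J (x, \<eta>)) = x \<and> y (J (x, \<eta>)) = \<eta>"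
    "\<And>z. z \<in> U \<times> span B \<Longrightarrow>
      smooth_at (U \<times> span B) (prod_atlas (restrict_atlas N1 U) (euclidean_atlas (span B))) A J z"
    using trivialization_inverse[OF N1 triv] by metis
  obtain Q where Q: "open Q" "U = h 0 ` M \<inter> Q"
    using triv by (auto simp: is_graded_trivialization_def openin_open)
  have spU: "smooth_space U (restrict_atlas N1 U)" by (rule smooth_space_restrict[OF N1]) (use Q in auto)
  note spE = smooth_space_euclid[of "span B"]
  note spP = smooth_space_prod[OF spU spE]
  have x0: "(x, 0) \<in> U \<times> span B" using T(2) span_zero by auto
  have xO: "x \<in> h 0 ` M \<inter> Q" using T(2) Q(2) by simp
  have 1: "smooth_at (h 0 ` M) N1 (prod_atlas (restrict_atlas N1 U) (euclidean_atlas (span B))) (\<lambda>u. (u, 0)) x"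
    by (rule smooth_at_Pair[OF N1 spU spE smooth_at_restrict_into[OF N1 Q(1) xO, folded Q(2)]
          smooth_at_const[OF N1 x spE span_zero]])
  have 2: "smooth_at (h 0 ` M) N1 A (\<lambda>u. J (u, 0)) x"
    by (rule smooth_at_compose[OF N1 spP space 1 J(2)[OF x0]])
  have "smooth_at M A N2 (h 0) (J (x, 0))"
    using proj smooth_map_iff[OF space N2] J(1)[OF T(2) span_zero] by blast
  from smooth_at_compose[OF N1 space N2 2 this]
  have "smooth_at (h 0 ` M) N1 N2 (\<lambda>u. h 0 (J (u, 0))) x" .
  then show ?thesis
    by (rule smooth_at_cong[OF N1 _ Q(1)]) (use xO Q(2) J(1) span_zero in auto)
qed

definition homogeneous :: "('m, 'm, 'f::euclidean_space) trivialization \<Rightarrow> bool" where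
  "homogeneous = (\<lambda>(U, B, w, y). \<forall>p\<in>M \<inter> h 0 -` U. \<forall>t.
        h t p \<in> M \<and> h 0 (h t p) = h 0 p \<and> (\<forall>b\<in>B. y (h t p) \<bullet> b = t ^ w b * (y p \<bullet> b)))"

lemma has_homotheties_iff: "has_homotheties M (h 0) \<T> h \<longleftrightarrow> (\<forall>T\<in>\<T>. homogeneous T)"
  unfolding has_homotheties_def homogeneous_def by auto

lemma fiber_bij:
  fixes N :: "('m, 'd::euclidean_space) chart set" and B :: "'f::euclidean_space set"
  assumes N: "smooth_space (h 0 ` M) N"
    and triv: "is_graded_trivialization M A (h 0 ` M) N (h 0) (U, B, w, y)" and x: "x \<in> U"
  shows "bij_betw y (M \<inter> h 0 -` {x}) (span B)"
proof -
  obtain J where "\<And>x \<eta>. x \<in> U \<Longrightarrow> \<eta> \<in> span B \<Longrightarrow> J (x, \<eta>) \<in> M \<and> h 0 (J (x, \<eta>)) = x \<and> y (J (x, \<eta>)) = \<eta>"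
    "\<And>p. p \<in> M \<Longrightarrow> h 0 p \<in> U \<Longrightarrow> J (h 0 p, y p) = p \<and> y p \<in> span B"
    using trivialization_inverse[OF N triv] by metis
  then show ?thesis using x by (intro bij_betwI[of _ _ _ "\<lambda>\<eta>. J (x, \<eta>)"]) auto
qed

lemma homogeneous_dil:
  fixes B :: "'f::euclidean_space set"
  assumes triv: "is_graded_trivialization M A (h 0 ` M) N (h 0) (U, B, w, y)"
    and N: "smooth_space (h 0 ` M) N"
    and hom: "homogeneous (U, B, w, y)" and p: "p \<in> M" "h 0 p \<in> U"
  shows "y (h t p) = dil B w t (y p)"
proof -
  have B: "B \<subseteq> Basis" using triv by (simp add: is_graded_trivialization_def)
  have ht: "h 0 (h t p) = h 0 p" "h t p \<in> M" using p by (simp_all add: h_h in_M)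
  then have "y (h t p) \<in> span B"
    using fiber_bij[OF N triv p(2)] by (auto simp: bij_betw_def)
  then show ?thesis
    using hom p by (intro in_span_Basis_eqI[OF B _ dil_in_span]) (auto simp: homogeneous_def dil_inner[OF B])
qed

text \<open>On the fiber over x the transition map is smooth, and it commutes with the dilations
  since both coordinate systems turn the same \<open>h t\<close> into \<open>dil\<close>. Smooth and
  homogeneous functions are polynomial.\<close>

lemma transition_weighted_polynomial:
  fixes N :: "('m, 'd::euclidean_space) chart set" and B :: "'f::euclidean_space set" and B' :: "'g::euclidean_space set"
  assumes N: "smooth_space (h 0 ` M) N"
    and triv: "is_graded_trivialization M A (h 0 ` M) N (h 0) (U, B, w, y)" "homogeneous (U, B, w, y)"
    and triv': "is_graded_trivialization M A (h 0 ` M) N (h 0) (U', B', w', y')" "homogeneous (U', B', w', y')"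
    and x: "x \<in> U" "x \<in> U'" and b': "b' \<in> B'"
  shows "weighted_polynomial B w (w' b') (\<lambda>\<eta>. y' (inv_into (M \<inter> h 0 -` {x}) y \<eta>) \<bullet> b')"
proof -
  let ?fx = "M \<inter> h 0 -` {x}"
  let ?I = "inv_into ?fx y"
  have B: "B \<subseteq> Basis" "\<And>b. b \<in> B \<Longrightarrow> w b > 0" and B': "B' \<subseteq> Basis"
    using triv triv' by (auto simp: is_graded_trivialization_def)
  note bij = fiber_bij[OF N triv(1) x(1)]
  obtain J where J: "\<And>x \<eta>. x \<in> U \<Longrightarrow> \<eta> \<in> span B \<Longrightarrow> J (x, \<eta>) \<in> M \<and> h 0 (J (x, \<eta>)) = x \<and> y (J (x, \<eta>)) = \<eta>"
    "\<And>z. z \<in> U \<times> span B \<Longrightarrow>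
      smooth_at (U \<times> span B) (prod_atlas (restrict_atlas N U) (euclidean_atlas (span B))) A J z"
    using trivialization_inverse[OF N triv(1)] by metis
  have y': "smooth_at M A (euclidean_atlas (span B')) y' p" if "p \<in> M" "h 0 p \<in> U'" for p
    using trivialization_inverse[OF N triv'(1)] that by metis
  have I: "?I \<eta> = J (x, \<eta>)" if "\<eta> \<in> span B" for \<eta>
    using J(1)[OF x(1) that] by (intro inv_into_f_eq bij_betw_imp_inj_on[OF bij]) auto
  obtain Q where Q: "U = h 0 ` M \<inter> Q"
    using triv by (auto simp: is_graded_trivialization_def openin_open)
  have spU: "smooth_space U (restrict_atlas N U)" by (rule smooth_space_restrict[OF N]) (use Q in auto)
  note spE = smooth_space_euclid[of "span B"]
  note spP = smooth_space_prod[OF spU spE]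
  have "smooth_on (span B) (\<lambda>\<eta>. y' (J (x, \<eta>)))"
  proof (rule smooth_at_smooth_on)
    fix \<eta> assume \<eta>: "\<eta> \<in> span B"
    have 1: "smooth_at (span B) (euclidean_atlas (span B)) (prod_atlas (restrict_atlas N U) (euclidean_atlas (span B))) (\<lambda>\<eta>. (x, \<eta>)) \<eta>"
      by (rule smooth_at_Pair[OF spE spU spE smooth_at_const[OF spE \<eta> spU x(1)] smooth_at_id[OF spE \<eta>]])
    have 2: "smooth_at (span B) (euclidean_atlas (span B)) A (\<lambda>\<eta>. J (x, \<eta>)) \<eta>"
      by (rule smooth_at_compose[OF spE spP space 1 J(2)]) (use x \<eta> in auto)
    show "smooth_at (span B) (euclidean_atlas (span B)) (euclidean_atlas (span B')) (\<lambda>\<eta>. y' (J (x, \<eta>))) \<eta>"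
      by (rule smooth_at_compose[OF spE space smooth_space_euclid 2 y']) (use J(1)[OF x(1) \<eta>] x(2) in auto)
  qed
  then have sm: "smooth_on (span B) (\<lambda>\<eta>. y' (J (x, \<eta>)) \<bullet> b')"
    by (rule smooth_on_linear_comp[OF bounded_linear_inner_left])
  have hom: "y' (J (x, dil B w t \<eta>)) \<bullet> b' = t ^ w' b' * (y' (J (x, \<eta>)) \<bullet> b')" if \<eta>: "\<eta> \<in> span B" for t \<eta>
  proof -
    let ?p = "J (x, \<eta>)"
    have p: "?p \<in> M" "h 0 ?p = x" "y ?p = \<eta>" using J(1)[OF x(1) \<eta>] by auto
    have "y (h t ?p) = dil B w t \<eta>" using homogeneous_dil[OF triv(1) N triv(2) p(1)] p x by simp
    moreover have "h t ?p \<in> ?fx" using p by (simp add: in_M h_h)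
    ultimately have "J (x, dil B w t \<eta>) = h t ?p"
      using I[OF dil_in_span] inv_into_f_f[OF bij_betw_imp_inj_on[OF bij]] by metis
    then show ?thesis
      using homogeneous_dil[OF triv'(1) N triv'(2) p(1), of t] p(2) x(2) b' by (simp add: dil_inner[OF B'])
  qed
  have "weighted_polynomial B w (w' b') (\<lambda>\<eta>. y' (J (x, \<eta>)) \<bullet> b')"
    using B(2) by (intro homogeneous_weighted_polynomial[OF B(1) _ sm hom])
  then show ?thesis by (rule weighted_polynomial_cong) (simp add: I)
qed

lemma transition_graded_iso:
  fixes N :: "('m, 'd::euclidean_space) chart set" and B B' :: "'f::euclidean_space set"
  assumes N: "smooth_space (h 0 ` M) N"
    and triv: "is_graded_trivialization M A (h 0 ` M) N (h 0) (U, B, w, y)" "homogeneous (U, B, w, y)"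
    and triv': "is_graded_trivialization M A (h 0 ` M) N (h 0) (U', B', w', y')" "homogeneous (U', B', w', y')"
    and x: "x \<in> U" "x \<in> U'"
  shows "graded_space_iso B w B' w' (y' \<circ> inv_into (M \<inter> h 0 -` {x}) y)"
proof -
  let ?fx = "M \<inter> h 0 -` {x}"
  let ?F = "y' \<circ> inv_into ?fx y"
  note bij = fiber_bij[OF N triv(1) x(1)] and bij' = fiber_bij[OF N triv'(1) x(2)]
  have bF: "bij_betw ?F (span B) (span B')"
    by (rule bij_betw_trans[OF bij_betw_inv_into[OF bij] bij'])
  have inv: "inv_into (span B) ?F \<eta> = y (inv_into ?fx y' \<eta>)" if \<eta>: "\<eta> \<in> span B'" for \<eta>
  proof (rule inv_into_f_eq[OF bij_betw_imp_inj_on[OF bF]])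
    have p: "inv_into ?fx y' \<eta> \<in> ?fx" "y' (inv_into ?fx y' \<eta>) = \<eta>"
    proof -
      have "\<eta> \<in> y' ` ?fx" using \<eta> bij_betw_imp_surj_on[OF bij'] by blast
      then show "inv_into ?fx y' \<eta> \<in> ?fx" "y' (inv_into ?fx y' \<eta>) = \<eta>" by (rule inv_into_into, rule f_inv_into_f)
    qed
    show "y (inv_into ?fx y' \<eta>) \<in> span B" using bij_betwE[OF bij] p(1) by blast
    show "?F (y (inv_into ?fx y' \<eta>)) = \<eta>"
      using inv_into_f_f[OF bij_betw_imp_inj_on[OF bij] p(1)] p(2) by simp
  qed
  have "weighted_polynomial B' w' (w b) (\<lambda>y'. inv_into (span B) ?F y' \<bullet> b)" if "b \<in> B" for b
    by (rule weighted_polynomial_cong[OF transition_weighted_polynomial[OF N triv' triv x(2,1) that]]) (simp add: inv)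
  moreover have "weighted_polynomial B w (w' b') (\<lambda>\<eta>. ?F \<eta> \<bullet> b')" if "b' \<in> B'" for b'
    using transition_weighted_polynomial[OF N triv triv' x that] by simp
  ultimately show ?thesis unfolding graded_space_iso_def using bF by blast
qed

text \<open>All homogeneous trivializations and not only those from \<open>coordinates\<close>: this
  is the largest candidate, so maximality reduces to showing that compatible trivializations are
  homogeneous.\<close>

definition homogeneous_trivializations :: "('m, 'm, 'e) trivialization set" where
  "homogeneous_trivializations =
    {T. is_graded_trivialization M A (h 0 ` M) base_atlas (h 0) T \<and> homogeneous T}"

lemma graded_bundle_atlas_homogeneous:
  "graded_bundle_atlas M A (h 0 ` M) base_atlas (h 0) homogeneous_trivializations"
  unfolding graded_bundle_atlas_def
proof (intro conjI)
  show "smooth_map M A (h 0 ` M) base_atlas (h 0)" by (rule smooth_map_projection)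
  show "h 0 ` M = h 0 ` M" ..
  show "\<forall>T\<in>homogeneous_trivializations. is_graded_trivialization M A (h 0 ` M) base_atlas (h 0) T"
    by (simp add: homogeneous_trivializations_def)
  show "(\<Union>(U, B, w, y)\<in>homogeneous_trivializations. U) = h 0 ` M"
  proof
    show "(\<Union>(U, B, w, y)\<in>homogeneous_trivializations. U) \<subseteq> h 0 ` M"
      by (auto simp: homogeneous_trivializations_def is_graded_trivialization_def dest: openin_imp_subset)
    show "h 0 ` M \<subseteq> (\<Union>(U, B, w, y)\<in>homogeneous_trivializations. U)"
    proof
      fix x assume x: "x \<in> h 0 ` M"
      then obtain T B w \<Psi> \<Theta> where c: "coordinates T B w \<Psi> \<Theta>" "x \<in> T" using ex_coordinates by metis
      let ?T = "(h 0 ` M \<inter> T, {b \<in> B. w b > 0}, w, fiber_coords B w \<Psi>)"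
      have "homogeneous ?T"
        unfolding homogeneous_def prod.case
        using fiber_coords_h[OF c(1)] by (auto simp: in_M h_h)
      then have "?T \<in> homogeneous_trivializations"
        using graded_trivialization_coordinates[OF c(1)] by (simp add: homogeneous_trivializations_def)
      then show "x \<in> (\<Union>(U, B, w, y)\<in>homogeneous_trivializations. U)" using x c(2) by blast
    qed
  qed
  show "\<forall>(U, B, w, y)\<in>homogeneous_trivializations. \<forall>(U', B', w', y')\<in>homogeneous_trivializations.
      \<forall>x\<in>U \<inter> U'. graded_space_iso B w B' w' (y' \<circ> inv_into (M \<inter> h 0 -` {x}) y)"
    using transition_graded_iso[OF space_base] by (auto simp: homogeneous_trivializations_def)
qed

text \<open>A trivialization compatible with a homogeneous one differs from it by weighted
  polynomials on fibers. These commute with dilations, so the trivialization is homogeneous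
  itself.\<close>

lemma graded_bundle_homogeneous:
  "graded_bundle M A (h 0 ` M) base_atlas (h 0) homogeneous_trivializations"
  unfolding graded_bundle_def
proof (intro conjI allI impI graded_bundle_atlas_homogeneous)
  fix \<T>' assume \<T>': "graded_bundle_atlas M A (h 0 ` M) base_atlas (h 0) \<T>' \<and> homogeneous_trivializations \<subseteq> \<T>'"
  have "homogeneous T" if T: "T \<in> \<T>'" for T
  proof -
    obtain U B w y where Te: "T = (U, B, w, y)" by (cases T)
    have hom: "y (h t p) \<bullet> b = t ^ w b * (y p \<bullet> b)" if p: "p \<in> M" "h 0 p \<in> U" and b: "b \<in> B" for p t b
    proof -
      have "h 0 p \<in> (\<Union>(U, B, w, y)\<in>homogeneous_trivializations. U)"
        using graded_bundle_atlas_homogeneous p(1) by (auto simp: graded_bundle_atlas_def)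
      then obtain U1 B1 w1 y1 where T1: "(U1, B1, w1, y1) \<in> homogeneous_trivializations" "h 0 p \<in> U1" by auto
      then have triv1: "is_graded_trivialization M A (h 0 ` M) base_atlas (h 0) (U1, B1, w1, y1)"
        "homogeneous (U1, B1, w1, y1)" by (auto simp: homogeneous_trivializations_def)
      have B1: "B1 \<subseteq> Basis" using triv1 by (simp add: is_graded_trivialization_def)
      let ?fx = "M \<inter> h 0 -` {h 0 p}"
      let ?F = "y \<circ> inv_into ?fx y1"
      have "graded_space_iso B1 w1 B w ?F"
        using \<T>' T Te T1 p(2) unfolding graded_bundle_atlas_def by fast
      then have wp: "weighted_polynomial B1 w1 (w b) (\<lambda>\<eta>. ?F \<eta> \<bullet> b)" using b by (simp add: graded_space_iso_def)
      note bij = fiber_bij[OF space_base triv1(1) T1(2)]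
      have inv: "?F (y1 q) = y q" if "q \<in> ?fx" for q
        using inv_into_f_f[OF bij_betw_imp_inj_on[OF bij] that] by simp
      have q: "p \<in> ?fx" "h t p \<in> ?fx" using p by (simp_all add: in_M h_h)
      have "y1 p \<in> span B1" using bij_betwE[OF bij] q by blast
      from weighted_polynomial_dil[OF B1 wp this, of t]
      show ?thesis
        using inv[OF q(1)] inv[OF q(2)] homogeneous_dil[OF triv1(1) space_base triv1(2) p(1) T1(2), of t] by simp
    qed
    show ?thesis unfolding Te homogeneous_def prod.case using hom by (auto simp: in_M h_h)
  qed
  then have "\<T>' \<subseteq> homogeneous_trivializations"
    using \<T>' by (auto simp: homogeneous_trivializations_def graded_bundle_atlas_def)
  then show "\<T>' = homogeneous_trivializations" using \<T>' by blast
qed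

text \<open>For uniqueness the base structure is identified first, since trivializations over
  different structures cannot be compared. Then any solution is contained in the set of all
  homogeneous trivializations, and its maximality gives equality.\<close>

theorem ex1_graded_bundle:
  "\<exists>!S :: ('m, 'e) chart set \<times> ('m, 'm, 'e) trivialization set.
     case S of (A\<^sub>0, \<T>) \<Rightarrow>
       smooth_structure (h 0 ` M) A\<^sub>0 \<and> graded_bundle M A (h 0 ` M) A\<^sub>0 (h 0) \<T> \<and>
       has_homotheties M (h 0) \<T> h"
proof (rule ex1I[of _ "(base_atlas, homogeneous_trivializations)"])
  show "case (base_atlas, homogeneous_trivializations) of (A\<^sub>0, \<T>) \<Rightarrow>
       smooth_structure (h 0 ` M) A\<^sub>0 \<and> graded_bundle M A (h 0 ` M) A\<^sub>0 (h 0) \<T> \<and>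
       has_homotheties M (h 0) \<T> h"
    using smooth_structure_base graded_bundle_homogeneous
    by (simp add: has_homotheties_iff) (simp add: homogeneous_trivializations_def)
  fix S :: "('m, 'e) chart set \<times> ('m, 'm, 'e) trivialization set"
  assume S: "case S of (A\<^sub>0, \<T>) \<Rightarrow>
       smooth_structure (h 0 ` M) A\<^sub>0 \<and> graded_bundle M A (h 0 ` M) A\<^sub>0 (h 0) \<T> \<and>
       has_homotheties M (h 0) \<T> h"
  obtain N \<T> where Se: "S = (N, \<T>)" by (cases S)
  then have N: "smooth_structure (h 0 ` M) N" and gb: "graded_bundle M A (h 0 ` M) N (h 0) \<T>"
    and hom: "\<And>T. T \<in> \<T> \<Longrightarrow> homogeneous T"
    using S by (auto simp: has_homotheties_iff)
  have atlas: "graded_bundle_atlas M A (h 0 ` M) N (h 0) \<T>" using gb by (simp add: graded_bundle_def)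
  have spN: "smooth_space (h 0 ` M) N"
    using N smooth_manifold_space unfolding smooth_structure_def by blast
  have proj: "smooth_map M A (h 0 ` M) N (h 0)" using atlas by (simp add: graded_bundle_atlas_def)
  have Neq: "N = base_atlas"
    by (rule smooth_structure_unique[OF N smooth_structure_base
          base_structure_mono[OF spN space_base atlas smooth_map_projection]
          base_structure_mono[OF space_base spN graded_bundle_atlas_homogeneous proj]])
  have "\<T> \<subseteq> homogeneous_trivializations"
    using atlas hom unfolding Neq by (auto simp: homogeneous_trivializations_def graded_bundle_atlas_def)
  then have "homogeneous_trivializations = \<T>"
    using gb graded_bundle_atlas_homogeneous unfolding Neq graded_bundle_def by blast
  then show "S = (base_atlas, homogeneous_trivializations)" using Se Neq by simp
qed

end

section \<open>The vector fields of an action\<close>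

lemma smooth_functions_iff:
  "smooth_space M A \<Longrightarrow> f \<in> smooth_functions M A \<longleftrightarrow> (\<forall>p\<in>M. smooth_at M A (euclidean_atlas UNIV) f p)"
  unfolding smooth_functions_def by (simp add: smooth_map_iff smooth_space_euclid)

context smooth_time_dependent
begin

lemma smooth_at_function:
  assumes f: "f \<in> smooth_functions M A" and z: "z \<in> UNIV \<times> M"
  shows "smooth_at (UNIV \<times> M) (prod_atlas (euclidean_atlas UNIV) A) (euclidean_atlas UNIV)
    (\<lambda>(s, p). f (\<Phi> s p)) z"
proof -
  obtain s p where p: "z = (s, p)" "p \<in> M" using z by auto
  have "smooth_at M A (euclidean_atlas UNIV) f ((\<lambda>(s, p). \<Phi> s p) (s, p))"
    using f smooth_functions_iff[OF space] in_M[OF p(2)] by auto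
  from smooth_at_compose[OF space_RM space smooth_space_euclid smooth_at_flow[OF p(2)] this]
  show ?thesis by (simp add: p(1) case_prod_unfold)
qed

lemma function_deriv:
  assumes f: "f \<in> smooth_functions M A" and p: "p \<in> M"
  shows "((\<lambda>s. f (\<Phi> s p)) has_real_derivative deriv (\<lambda>s. f (\<Phi> s p)) s) (at s)"
proof -
  have z: "(s, p) \<in> UNIV \<times> M" using p by simp
  obtain N where N: "open N" "s \<in> N" "C_inf_on N (\<lambda>s. (\<lambda>(s, p). f (\<Phi> s p)) (s, p))"
    by (rule smooth_at_curve[OF space smooth_at_function[OF f z]])
  have "((\<lambda>s. f (\<Phi> s p)) has_real_derivative tder (\<lambda>s. f (\<Phi> s p)) s) (at s)"
    using tder_has_vector_derivative[OF N(3,2)] by (simp add: has_real_derivative_iff_has_vector_derivative)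
  then show ?thesis using DERIV_imp_deriv by metis
qed

lemma smooth_functions_comp:
  assumes f: "f \<in> smooth_functions M A" shows "f \<circ> \<Phi> s \<in> smooth_functions M A"
  unfolding smooth_functions_iff[OF space] o_def
proof
  fix p assume p: "p \<in> M"
  have "smooth_at M A (euclidean_atlas UNIV) f (\<Phi> s p)"
    using f smooth_functions_iff[OF space] in_M[OF p] by auto
  from smooth_at_compose[OF space space smooth_space_euclid smooth_at_time[OF p] this]
  show "smooth_at M A (euclidean_atlas UNIV) (\<lambda>x. f (\<Phi> s x)) p" .
qed

lemma smooth_map_orbit:
  fixes \<tau> :: "real \<Rightarrow> real"
  assumes p: "p \<in> M" and \<tau>: "smooth_on UNIV \<tau>"
  shows "smooth_map UNIV (euclidean_atlas UNIV) M A (\<lambda>s. \<Phi> (\<tau> s) p)"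
  unfolding smooth_map_iff[OF smooth_space_euclid space]
proof (intro conjI ballI)
  show "range (\<lambda>s. \<Phi> (\<tau> s) p) \<subseteq> M" using in_M[OF p] by auto
  fix s :: real
  note E = smooth_space_euclid[of "UNIV :: real set"]
  have "smooth_at UNIV (euclidean_atlas UNIV) (prod_atlas (euclidean_atlas UNIV) A) (\<lambda>s. (\<tau> s, p)) s"
    by (intro smooth_at_Pair[OF E smooth_space_euclid space] smooth_at_euclidI[OF \<tau>]
        smooth_at_const[OF E UNIV_I space p]) auto
  from smooth_at_compose[OF E space_RM space this smooth_at_flow[OF p]]
  show "smooth_at UNIV (euclidean_atlas UNIV) A (\<lambda>s. \<Phi> (\<tau> s) p) s" by simp
qed

text \<open>The time s is one at which the map is the identity: 0 for the flow and 1 for the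
  homotheties. The product rule then evaluates the factors at p itself.\<close>

lemma vector_field_velocity:
  assumes id: "\<And>p. p \<in> M \<Longrightarrow> \<Phi> s p = p"
  shows "vector_field M A (\<lambda>p. if p \<in> M then velocity M A (\<lambda>s. \<Phi> s p) s else (\<lambda>f. 0))"
    (is "vector_field M A ?X")
  unfolding vector_field_def
proof (intro conjI ballI allI impI)
  show "?X p = (\<lambda>f. 0)" if "p \<notin> M" for p using that by simp
  show "?X p \<in> tangent_space M A p" if p: "p \<in> M" for p
  proof -
    have val: "?X p f = deriv (\<lambda>s. f (\<Phi> s p)) s" if "f \<in> smooth_functions M A" for f
      using p that by (simp add: velocity_def o_def)
    note der = function_deriv[OF _ p, of _ s]
    show ?thesis
      unfolding tangent_space_def mem_Collect_eq
    proof (intro conjI ballI allI impI)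
      fix f g assume f: "f \<in> smooth_functions M A" and g: "g \<in> smooth_functions M A"
      note sm = f[unfolded smooth_functions_iff[OF space], rule_format]
        g[unfolded smooth_functions_iff[OF space], rule_format]
      have fg: "(\<lambda>x. f x + g x) \<in> smooth_functions M A"
        unfolding smooth_functions_iff[OF space] using smooth_at_add[OF space sm] by blast
      have sm_mult: "smooth_on UNIV (\<lambda>(x, y). x * y :: real)"
        unfolding case_prod_unfold
        by (intro smooth_on_mult smooth_on_bounded_linear bounded_linear_fst bounded_linear_snd)
      have fg': "(\<lambda>x. f x * g x) \<in> smooth_functions M A"
        unfolding smooth_functions_iff[OF space] using smooth_at_binop[OF space sm sm_mult] by blast
      show "?X p (\<lambda>x. f x + g x) = ?X p f + ?X p g"
        unfolding val[OF f] val[OF g] val[OF fg] by (rule DERIV_imp_deriv[OF DERIV_add[OF der[OF f] der[OF g]]])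
      show "?X p (\<lambda>x. f x * g x) = f p * ?X p g + g p * ?X p f"
        unfolding val[OF f] val[OF g] val[OF fg']
        using DERIV_imp_deriv[OF DERIV_mult[OF der[OF f] der[OF g]]] id[OF p] by (simp add: mult.commute)
    next
      fix c f assume f: "f \<in> smooth_functions M A"
      have cf: "(\<lambda>x. c * f x) \<in> smooth_functions M A"
        unfolding smooth_functions_iff[OF space]
        using smooth_at_smooth_on_comp[OF space f[unfolded smooth_functions_iff[OF space], rule_format]
            smooth_on_bounded_linear[OF bounded_linear_mult_right[of c]]] by blast
      show "?X p (\<lambda>x. c * f x) = c * ?X p f"
        unfolding val[OF f] val[OF cf] by (rule DERIV_imp_deriv[OF DERIV_cmult[OF der[OF f]]])
    next
      fix f assume "f \<notin> smooth_functions M A"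
      then show "?X p f = 0" by (simp add: velocity_def)
    qed
  qed
  fix f assume f: "f \<in> smooth_functions M A"
  show "(\<lambda>p. ?X p f) \<in> smooth_functions M A"
    unfolding smooth_functions_iff[OF space]
  proof
    fix p assume p: "p \<in> M"
    have 1: "smooth_at (UNIV \<times> M) (prod_atlas (euclidean_atlas UNIV) A) (euclidean_atlas UNIV)
        (\<lambda>(t, p). deriv (\<lambda>s. (\<lambda>(s, p). f (\<Phi> s p)) (s, p)) t) (s, p)"
      by (rule smooth_at_deriv[OF space open_UNIV _ smooth_at_function[OF f]]) (use p in auto)
    from smooth_at_compose[OF space space_RM smooth_space_euclid smooth_at_slice[OF p] this]
    have "smooth_at M A (euclidean_atlas UNIV) (\<lambda>p. deriv (\<lambda>t. f (\<Phi> t p)) s) p" by simp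
    then show "smooth_at M A (euclidean_atlas UNIV) (\<lambda>p. ?X p f) p"
      by (rule smooth_at_cong[OF space _ open_UNIV UNIV_I]) (simp add: f velocity_def o_def)
  qed
qed

end

section \<open>Calculus in the plane of the parameters (a, b)\<close>

lemma dird_Pair_linear:
  fixes G :: "real \<times> real \<Rightarrow> real"
  assumes "G differentiable (at z)"
  shows "dird (a, b) G z = a * dird (1, 0) G z + b * dird (0, 1) G z"
proof -
  note l = linear_frechet_derivative[OF assms]
  have "frechet_derivative G (at z) (a *\<^sub>R (1, 0) + b *\<^sub>R (0, 1)) = a * dird (1, 0) G z + b * dird (0, 1) G z"
    by (simp only: linear_add[OF l] linear_scale[OF l] real_scaleR_def)
  then show ?thesis by simp
qed

lemma DERIV_along_curve:
  fixes G :: "real \<times> real \<Rightarrow> real"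
  assumes "C_inf_on UNIV G" "(x has_real_derivative a) (at t)" "(y has_real_derivative b) (at t)"
  shows "((\<lambda>t. G (x t, y t)) has_real_derivative
    a * dird (1, 0) G (x t, y t) + b * dird (0, 1) G (x t, y t)) (at t)"
proof -
  have "((\<lambda>t. (x t, y t)) has_derivative (\<lambda>s. (a * s, b * s))) (at t)"
    using assms(2,3) unfolding has_field_derivative_def by (intro has_derivative_Pair)
  note d = has_derivative_compose[OF this C_inf_on_has_derivative[OF assms(1) UNIV_I]]
  have "dird (a * s, b * s) G z = (a * dird (1, 0) G z + b * dird (0, 1) G z) * s" for s z
    unfolding dird_Pair_linear[OF C_inf_on_differentiable[OF assms(1) UNIV_I], where a = "a * s" and b = "b * s"]
    by (simp add: algebra_simps)
  then show ?thesis using d unfolding has_field_derivative_def by simp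
qed

text \<open>The multiples of \<open>exp\<close> are closed under differentiation, hence the
  induction over all c. The result reparametrizes the homotheties additively.\<close>

lemma smooth_on_exp: "smooth_on UNIV (exp :: real \<Rightarrow> real)"
proof -
  have d: "((exp :: real \<Rightarrow> real) has_derivative (\<lambda>v. exp x * v)) (at x)" for x
    using DERIV_exp[of x] by (simp add: has_field_derivative_def)
  have "C_k_on k UNIV (\<lambda>x::real. c * exp x)" for k c
  proof (induction k arbitrary: c)
    case (Suc k)
    have d': "((\<lambda>x::real. c * exp x) has_derivative (\<lambda>v. c * (exp x * v))) (at x)" for x
      by (rule has_derivative_mult_right[OF d])
    have "dird v (\<lambda>x::real. c * exp x) = (\<lambda>x. (c * v) * exp x)" for v
      by (simp flip: frechet_derivative_at[OF d'] add: mult_ac)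
    then show ?case using d' Suc by (auto simp: differentiable_def)
  qed (auto intro!: continuous_intros)
  from this[of _ 1] show ?thesis by (simp add: smooth_on_def) (metis open_UNIV UNIV_I)
qed

text \<open>The exponents record in which order the group elements are multiplied: (1, s) (t, 0) =
  (t, s t^2) and (t, 0) (1, s) = (t, s t). A right action multiplies in the order of application,
  which gives m = 2 and n = 1; a left action reverses it and gives m = 1 and n = 2.\<close>

locale G2_flow =
  fixes M :: "'m::{t2_space,second_countable_topology} set"
    and A :: "('m, 'e::euclidean_space) chart set" and act :: "real \<times> real \<Rightarrow> 'm \<Rightarrow> 'm" and m n :: nat
  assumes manifold: "smooth_manifold M A"
    and smooth_act: "smooth_map (UNIV \<times> M) (prod_atlas (euclidean_atlas UNIV) A) M A (\<lambda>(g, p). act g p)"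
    and act_one: "p \<in> M \<Longrightarrow> act (1, 0) p = p"
    and act_h_h: "p \<in> M \<Longrightarrow> act (s, 0) (act (t, 0) p) = act (s * t, 0) p"
    and act_flow: "p \<in> M \<Longrightarrow> act (1, s) (act (1, t) p) = act (1, s + t) p"
    and act_h_flow: "p \<in> M \<Longrightarrow> act (t, 0) (act (1, s) p) = act (t, s * t ^ m) p"
    and act_flow_h: "p \<in> M \<Longrightarrow> act (1, s) (act (t, 0) p) = act (t, s * t ^ n) p"
begin

lemma space: "smooth_space M A"
  by (rule smooth_manifold_space[OF manifold])

lemma act_in: "p \<in> M \<Longrightarrow> act g p \<in> M"
  using smooth_act unfolding smooth_map_def by (cases g) auto

lemma smooth_act_curve:
  assumes \<tau>: "smooth_on UNIV \<tau>"
  shows "smooth_map (UNIV \<times> M) (prod_atlas (euclidean_atlas UNIV) A) M A (\<lambda>(t, p). act (\<tau> (t::real)) p)"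
proof -
  note spR = smooth_space_prod[OF smooth_space_euclid space, of "UNIV :: real set"]
  note spG = smooth_space_prod[OF smooth_space_euclid space, of "UNIV :: (real \<times> real) set"]
  have "smooth_at (UNIV \<times> M) (prod_atlas (euclidean_atlas (UNIV::real set)) A) A (\<lambda>(t, p). act (\<tau> t) p) z"
    if z: "z \<in> UNIV \<times> M" for z
  proof -
    have 1: "smooth_at (UNIV \<times> M) (prod_atlas (euclidean_atlas (UNIV::real set)) A) (euclidean_atlas UNIV) (\<lambda>z. \<tau> (fst z)) z"
      by (rule smooth_at_smooth_on_comp[OF spR smooth_at_fst[OF smooth_space_euclid space z] \<tau>]) simp
    have 2: "smooth_at (UNIV \<times> M) (prod_atlas (euclidean_atlas UNIV) A) A (\<lambda>(g, p). act g p) (\<tau> (fst z), snd z)"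
    proof -
      have "(\<tau> (fst z), snd z) \<in> UNIV \<times> M" using z by auto
      then show ?thesis using smooth_act smooth_map_iff[OF spG space] by blast
    qed
    from smooth_at_compose[OF spR spG space smooth_at_Pair[OF spR smooth_space_euclid space 1 smooth_at_snd[OF smooth_space_euclid space z]] 2]
    show ?thesis by (simp add: case_prod_unfold)
  qed
  then show ?thesis unfolding smooth_map_iff[OF spR space] by (auto intro: act_in)
qed

abbreviation h where "h \<equiv> \<lambda>t p. act (t, 0) p"
abbreviation \<Phi> where "\<Phi> \<equiv> \<lambda>s p. act (1, s) p"

sublocale hom: smooth_time_dependent M A h
  by unfold_locales (rule space, rule smooth_act_curve[OF smooth_on_Pair[OF smooth_on_id smooth_on_const]])

sublocale flow: smooth_time_dependent M A \<Phi>
  by unfold_locales (rule space, rule smooth_act_curve[OF smooth_on_Pair[OF smooth_on_const smooth_on_id]])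

sublocale homothety_action M A h
  by unfold_locales (rule manifold, rule act_one, assumption, rule act_h_h, assumption)

definition X where "X = infinitesimal_generator M A \<Phi>"
definition \<Delta> where "\<Delta> = weight_vector_field M A h"

lemma X_apply: "p \<in> M \<Longrightarrow> f \<in> smooth_functions M A \<Longrightarrow> X p f = deriv (\<lambda>s. f (act (1, s) p)) 0"
  by (simp add: X_def infinitesimal_generator_def velocity_def o_def)

lemma \<Delta>_apply: "p \<in> M \<Longrightarrow> f \<in> smooth_functions M A \<Longrightarrow> \<Delta> p f = deriv (\<lambda>t. f (act (t, 0) p)) 1"
  by (simp add: \<Delta>_def weight_vector_field_def velocity_def o_def)

lemma zero_off: "p \<notin> M \<or> f \<notin> smooth_functions M A \<Longrightarrow> X p f = 0 \<and> \<Delta> p f = 0"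
  by (auto simp: X_def infinitesimal_generator_def \<Delta>_def weight_vector_field_def velocity_def)

lemma vector_field_X: "vector_field M A X"
  unfolding X_def infinitesimal_generator_def by (rule flow.vector_field_velocity) (rule act_one)

lemma vector_field_\<Delta>: "vector_field M A \<Delta>"
  unfolding \<Delta>_def weight_vector_field_def by (rule hom.vector_field_velocity) (rule act_one)

lemma global_flow: "global_flow M A \<Phi>"
  unfolding global_flow_def using flow.smooth act_one act_flow by auto

lemma complete_X: "complete_vector_field M A X"
  unfolding complete_vector_field_def
proof (intro conjI ballI vector_field_X)
  fix p assume p: "p \<in> M"
  have "velocity M A (\<lambda>s. act (1, s) p) t = X (act (1, t) p)" for t
  proof
    fix f
    show "velocity M A (\<lambda>s. act (1, s) p) t f = X (act (1, t) p) f"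
    proof (cases "f \<in> smooth_functions M A")
      case True
      have "((\<lambda>s. f (act (1, s + t) p)) has_real_derivative deriv (\<lambda>s. f (act (1, s) p)) t) (at 0)"
        using flow.function_deriv[OF True p, of "0 + t"] by (subst (asm) DERIV_shift) simp
      from DERIV_imp_deriv[OF this] show ?thesis
        using True
        by (simp add: X_apply[OF flow.in_M[OF p] True] velocity_def o_def act_flow[OF p])
    qed (use zero_off in \<open>simp add: velocity_def\<close>)
  qed
  then show "\<exists>\<gamma>. integral_curve M A X \<gamma> \<and> \<gamma> 0 = p"
    using flow.smooth_map_orbit[OF p smooth_on_id] act_one[OF p]
    by (intro exI[of _ "\<lambda>s. act (1, s) p"]) (simp add: integral_curve_def)
qed

text \<open>The integral curves are t \<mapsto> \<open>h (exp t) p\<close>. Their velocity is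
  computed twice by the chain rule, once directly and once from
  \<open>h s (h (exp t) p) = h (s * exp t) p\<close> at s = 1.\<close>

lemma complete_\<Delta>: "complete_vector_field M A \<Delta>"
  unfolding complete_vector_field_def
proof (intro conjI ballI vector_field_\<Delta>)
  fix p assume p: "p \<in> M"
  have "velocity M A (\<lambda>s. act (exp s, 0) p) t = \<Delta> (act (exp t, 0) p)" for t
  proof
    fix f
    show "velocity M A (\<lambda>s. act (exp s, 0) p) t f = \<Delta> (act (exp t, 0) p) f"
    proof (cases "f \<in> smooth_functions M A")
      case True
      let ?g = "\<lambda>t. f (act (t, 0) p)"
      have "((\<lambda>s. ?g (exp s)) has_real_derivative deriv ?g (exp t) * exp t) (at t)"
        by (rule DERIV_chain2[OF hom.function_deriv[OF True p] DERIV_exp])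
      moreover have "((\<lambda>s. ?g (s * exp t)) has_real_derivative deriv ?g (1 * exp t) * exp t) (at 1)"
        by (rule DERIV_chain2[OF hom.function_deriv[OF True p]]) (auto intro!: derivative_eq_intros)
      ultimately show ?thesis
        using True
        by (simp add: \<Delta>_apply[OF hom.in_M[OF p] True] velocity_def o_def act_h_h[OF p] DERIV_imp_deriv)
    qed (use zero_off in \<open>simp add: velocity_def\<close>)
  qed
  then show "\<exists>\<gamma>. integral_curve M A \<Delta> \<gamma> \<and> \<gamma> 0 = p"
    using hom.smooth_map_orbit[OF p smooth_on_exp] act_one[OF p]
    by (intro exI[of _ "\<lambda>s. act (exp s, 0) p"]) (simp add: integral_curve_def)
qed

text \<open>Reduces the weight and the bracket to calculus of one function on the plane of pairs (a,
  b).\<close>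

lemma C_inf_on_orbit:
  assumes f: "f \<in> smooth_functions M A" and p: "p \<in> M"
  shows "C_inf_on UNIV (\<lambda>g. f (act g p))"
proof (rule smooth_on_C_inf_on[OF open_UNIV smooth_at_smooth_on])
  fix g :: "real \<times> real"
  note E = smooth_space_euclid[of "UNIV :: (real \<times> real) set"]
  note spG = smooth_space_prod[OF E space]
  have "act g p \<in> M" by (rule act_in[OF p])
  then have f': "smooth_at M A (euclidean_atlas UNIV) f (act g p)"
    using f smooth_functions_iff[OF space] by blast
  have "smooth_at (UNIV \<times> M) (prod_atlas (euclidean_atlas UNIV) A) A (\<lambda>(g, p). act g p) (g, p)"
  proof -
    have "(g, p) \<in> UNIV \<times> M" using p by auto
    then show ?thesis using smooth_act smooth_map_iff[OF spG space] by blast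
  qed
  from smooth_at_compose[OF E spG space smooth_at_Pair[OF E E space smooth_at_id[OF E UNIV_I] smooth_at_const[OF E UNIV_I space p]] this]
  have "smooth_at UNIV (euclidean_atlas UNIV) A (\<lambda>g. act g p) g" by simp
  from smooth_at_compose[OF E space smooth_space_euclid this f']
  show "smooth_at UNIV (euclidean_atlas UNIV) (euclidean_atlas UNIV) (\<lambda>g. f (act g p)) g" .
qed

lemma flow_derivative:
  assumes f: "f \<in> smooth_functions M A" and p: "p \<in> M"
  shows "deriv (\<lambda>s. f (act (t, s * c) p)) 0 = c * dird (0, 1) (\<lambda>g. f (act g p)) (t, 0)"
proof -
  have "((\<lambda>s. (\<lambda>g. f (act g p)) (t, s * c)) has_real_derivative
      0 * dird (1, 0) (\<lambda>g. f (act g p)) (t, 0 * c) + c * dird (0, 1) (\<lambda>g. f (act g p)) (t, 0 * c)) (at 0)"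
    by (rule DERIV_along_curve[OF C_inf_on_orbit[OF f p]]) (auto intro!: derivative_eq_intros)
  then show ?thesis using DERIV_imp_deriv by fastforce
qed

lemma X_homothety:
  assumes f: "f \<in> smooth_functions M A" and p: "p \<in> M"
  shows "X (act (t, 0) p) f = t ^ n * dird (0, 1) (\<lambda>g. f (act g p)) (t, 0)"
  using X_apply[OF hom.in_M[OF p] f] flow_derivative[OF f p] by (simp add: act_flow_h[OF p])

lemma X_dird:
  assumes "f \<in> smooth_functions M A" "p \<in> M"
  shows "X p f = dird (0, 1) (\<lambda>g. f (act g p)) (1, 0)"
  using X_homothety[OF assms, of 1] by (simp add: act_one[OF assms(2)])

text \<open>Both sides are multiples of the derivative of the orbit function at (t, 0) along (0, 1).
  Pushing \<open>X\<close> forward applies the flow first and contributes \<open>t ^ m\<close>;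
  evaluating \<open>X\<close> at \<open>h t p\<close> applies the homothety first and contributes
  \<open>t ^ n\<close>.\<close>

lemma has_weight_X: "has_weight M A h X (int n - int m)"
  unfolding has_weight_def
proof (intro ballI allI impI)
  fix p and t :: real assume p: "p \<in> M" and t: "t > 0"
  show "pushforward M A (h t) (X p) = (\<lambda>f. t powi (- (int n - int m)) * X (h t p) f)"
  proof
    fix f
    show "pushforward M A (h t) (X p) f = t powi (- (int n - int m)) * X (h t p) f"
    proof (cases "f \<in> smooth_functions M A")
      case True
      have "X p (f \<circ> h t) = t ^ m * dird (0, 1) (\<lambda>g. f (act g p)) (t, 0)"
        using X_apply[OF p hom.smooth_functions_comp[OF True]] flow_derivative[OF True p]
        by (simp add: o_def act_h_flow[OF p])
      moreover have "t powi (- (int n - int m)) * t ^ n = t ^ m"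
        using t by (simp add: power_int_diff)
      ultimately show ?thesis
        using True by (simp add: pushforward_def X_homothety[OF True p] flip: mult.assoc)
    qed (use zero_off in \<open>simp add: pushforward_def\<close>)
  qed
qed

text \<open>For the orbit function G(a, b), with derivatives at (1, 0), applying \<Delta> to X f
  gives n G_b plus a mixed derivative, and applying X to \<Delta> f gives m G_b plus the mixed
  derivative in the other order. The mixed terms cancel.\<close>

lemma lie_bracket_\<Delta>_X: "lie_bracket \<Delta> X = (\<lambda>p f. (real n - real m) * X p f)"
proof (intro ext)
  fix p f
  show "lie_bracket \<Delta> X p f = (real n - real m) * X p f"
  proof (cases "p \<in> M \<and> f \<in> smooth_functions M A")
    case True
    then have p: "p \<in> M" and f: "f \<in> smooth_functions M A" by auto
    define G where "G = (\<lambda>g. f (act g p))"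
    have G: "C_inf_on UNIV G" unfolding G_def by (rule C_inf_on_orbit[OF f p])
    have Xf: "(\<lambda>q. X q f) \<in> smooth_functions M A" and \<Delta>f: "(\<lambda>q. \<Delta> q f) \<in> smooth_functions M A"
      using vector_field_X vector_field_\<Delta> f unfolding vector_field_def by auto
    have "\<Delta> p (\<lambda>q. X q f) = deriv (\<lambda>t. t ^ n * dird (0, 1) G (t, 0)) 1"
      using \<Delta>_apply[OF p Xf] by (simp add: X_homothety[OF f p] G_def)
    also have "\<dots> = real n * dird (0, 1) G (1, 0) + dird (1, 0) (dird (0, 1) G) (1, 0)"
    proof (rule DERIV_imp_deriv)
      have "((\<lambda>t. dird (0, 1) G (t, 0)) has_real_derivative
          1 * dird (1, 0) (dird (0, 1) G) (1, 0) + 0 * dird (0, 1) (dird (0, 1) G) (1, 0)) (at 1)"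
        by (rule DERIV_along_curve[OF C_inf_on_dird[OF G]]) (auto intro!: derivative_eq_intros)
      then show "((\<lambda>t. t ^ n * dird (0, 1) G (t, 0)) has_real_derivative
          real n * dird (0, 1) G (1, 0) + dird (1, 0) (dird (0, 1) G) (1, 0)) (at 1)"
        by (auto intro!: derivative_eq_intros)
    qed
    finally have 1: "\<Delta> p (\<lambda>q. X q f) = real n * dird (0, 1) G (1, 0) + dird (1, 0) (dird (0, 1) G) (1, 0)" .
    \<comment> \<open>The homothety applied after the flow traces the curve t \<mapsto> (t, s t^m),
      so \<Delta> also has a component along the second parameter.\<close>
    have \<Delta>s: "\<Delta> (act (1, s) p) f = dird (1, 0) G (1, s) + s * (real m * dird (0, 1) G (1, s))" for s
    proof -
      have "\<Delta> (act (1, s) p) f = deriv (\<lambda>t. G (t, s * t ^ m)) 1"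
        using \<Delta>_apply[OF flow.in_M[OF p] f] by (simp add: act_h_flow[OF p] G_def)
      also have "\<dots> = 1 * dird (1, 0) G (1, s * 1 ^ m) + (s * real m) * dird (0, 1) G (1, s * 1 ^ m)"
        by (rule DERIV_imp_deriv[OF DERIV_along_curve[OF G]]) (auto intro!: derivative_eq_intros)
      finally show ?thesis by simp
    qed
    have "X p (\<lambda>q. \<Delta> q f) = deriv (\<lambda>s. dird (1, 0) G (1, s) + s * (real m * dird (0, 1) G (1, s))) 0"
      using X_apply[OF p \<Delta>f] by (simp add: \<Delta>s)
    also have "\<dots> = dird (0, 1) (dird (1, 0) G) (1, 0) + real m * dird (0, 1) G (1, 0)"
    proof (rule DERIV_imp_deriv)
      have d: "((\<lambda>s. dird v G (1, s)) has_real_derivative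
          0 * dird (1, 0) (dird v G) (1, 0) + 1 * dird (0, 1) (dird v G) (1, 0)) (at 0)" for v
        by (rule DERIV_along_curve[OF C_inf_on_dird[OF G]]) (auto intro!: derivative_eq_intros)
      show "((\<lambda>s. dird (1, 0) G (1, s) + s * (real m * dird (0, 1) G (1, s))) has_real_derivative
          dird (0, 1) (dird (1, 0) G) (1, 0) + real m * dird (0, 1) G (1, 0)) (at 0)"
        using d[of "(1, 0)"] d[of "(0, 1)"] by (auto intro!: derivative_eq_intros)
    qed
    finally have 2: "X p (\<lambda>q. \<Delta> q f) = dird (0, 1) (dird (1, 0) G) (1, 0) + real m * dird (0, 1) G (1, 0)" .
    have "dird (1, 0) (dird (0, 1) G) (1, 0) = dird (0, 1) (dird (1, 0) G) (1, 0)"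
      by (rule dird_commute[OF open_UNIV G UNIV_I])
    then show ?thesis
      using 1 2 X_dird[OF f p] by (simp add: lie_bracket_def G_def algebra_simps)
  next
    case False
    \<comment> \<open>For f that is not smooth the inner functions are identically 0 by convention,
      and the outer field must be evaluated at the zero function.\<close>
    have const: "X p (\<lambda>q. 0) = 0" "\<Delta> p (\<lambda>q. 0) = 0" if "p \<in> M"
      using X_apply[OF that, of "\<lambda>q. 0"] \<Delta>_apply[OF that, of "\<lambda>q. 0"] zero_off[of p "\<lambda>q. 0"] by auto
    show ?thesis
    proof (cases "p \<in> M")
      case True
      then have "f \<notin> smooth_functions M A" using False by simp
      then have "X q f = 0" "\<Delta> q f = 0" for q using zero_off by auto
      then show ?thesis using const[OF True] by (simp add: lie_bracket_def)
    qed (use zero_off in \<open>simp add: lie_bracket_def\<close>)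
  qed
qed

lemmas G2_flow_structure =
  ex1_graded_bundle global_flow complete_X[unfolded X_def] has_weight_X[unfolded X_def]
  complete_\<Delta>[unfolded \<Delta>_def] lie_bracket_\<Delta>_X[unfolded X_def \<Delta>_def]

end

section \<open>Right and left actions as instances\<close>

lemma G2_flow_right:
  assumes M: "smooth_manifold M A" and H: "smooth_right_G2_action M A H"
  shows "G2_flow M A (\<lambda>g p. H (p, g)) 2 1"
proof
  note sp = smooth_manifold_space[OF M]
  note spG = smooth_space_prod[OF smooth_space_euclid sp, of "UNIV :: (real \<times> real) set"]
  note spG' = smooth_space_prod[OF sp smooth_space_euclid, of "UNIV :: (real \<times> real) set"]
  have sm: "smooth_map (M \<times> UNIV) (prod_atlas A (euclidean_atlas UNIV)) M A H"
    using H by (simp add: smooth_right_G2_action_def)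
  show "smooth_manifold M A" by (rule M)
  have "smooth_at (UNIV \<times> M) (prod_atlas (euclidean_atlas UNIV) A) A (\<lambda>(g, p). H (p, g)) z"
    if z: "z \<in> UNIV \<times> M" for z
  proof -
    have "smooth_at (M \<times> UNIV) (prod_atlas A (euclidean_atlas UNIV)) A H (snd z, fst z)"
    proof -
      have "(snd z, fst z) \<in> M \<times> UNIV" using z by auto
      then show ?thesis using sm smooth_map_iff[OF spG' sp] by blast
    qed
    from smooth_at_compose[OF spG spG' sp smooth_at_Pair[OF spG sp smooth_space_euclid
          smooth_at_snd[OF smooth_space_euclid sp z] smooth_at_fst[OF smooth_space_euclid sp z]] this]
    show ?thesis by (simp add: case_prod_unfold)
  qed
  moreover have "H (p, g) \<in> M" if "p \<in> M" for p g using sm that unfolding smooth_map_def by (cases g) auto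
  ultimately show "smooth_map (UNIV \<times> M) (prod_atlas (euclidean_atlas UNIV) A) M A (\<lambda>(g, p). H (p, g))"
    unfolding smooth_map_iff[OF spG sp] by auto
qed (use H in \<open>auto simp: smooth_right_G2_action_def G2_one_def G2_mult_def mult.commute add.commute power2_eq_square\<close>)

lemma G2_flow_left:
  assumes M: "smooth_manifold M A" and H: "smooth_left_G2_action M A H"
  shows "G2_flow M A (\<lambda>g p. H (g, p)) 1 2"
proof
  show "smooth_manifold M A" by (rule M)
  have "(\<lambda>(g, p). H (g, p)) = H" by auto
  then show "smooth_map (UNIV \<times> M) (prod_atlas (euclidean_atlas UNIV) A) M A (\<lambda>(g, p). H (g, p))"
    using H by (simp add: smooth_left_G2_action_def)
qed (use H in \<open>auto simp: smooth_left_G2_action_def G2_one_def G2_mult_def mult.commute add.commute\<close>)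

theorem lemma4p1:
  fixes M :: "'m::{t2_space,second_countable_topology} set"
    and A :: "('m, 'e::euclidean_space) chart set"
  assumes "smooth_manifold M A"
  shows "(\<forall>H. smooth_right_G2_action M A H \<longrightarrow>
      (let h = (\<lambda>a p. H (p, (a, 0)));
           \<pi> = (\<lambda>p. H (p, (0, 0)));
           M\<^sub>0 = \<pi> ` M;
           \<Phi> = (\<lambda>s p. H (p, (1, s)));
           X = infinitesimal_generator M A \<Phi>;
           \<Delta> = weight_vector_field M A h
       in (\<exists>!S :: ('m, 'e) chart set \<times> ('m, 'm, 'e) trivialization set.
             case S of (A\<^sub>0, \<T>) \<Rightarrow>
               smooth_structure M\<^sub>0 A\<^sub>0 \<and> graded_bundle M A M\<^sub>0 A\<^sub>0 \<pi> \<T> \<and>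
               has_homotheties M \<pi> \<T> h) \<and>
          global_flow M A \<Phi> \<and> complete_vector_field M A X \<and> has_weight M A h X (- 1) \<and>
          complete_vector_field M A \<Delta> \<and>
          lie_bracket \<Delta> X = (\<lambda>p f. - X p f)))
    \<and>
    (\<forall>H. smooth_left_G2_action M A H \<longrightarrow>
      (let h = (\<lambda>a p. H ((a, 0), p));
           \<pi> = (\<lambda>p. H ((0, 0), p));
           M\<^sub>0 = \<pi> ` M;
           \<Phi> = (\<lambda>s p. H ((1, s), p));
           Y = infinitesimal_generator M A \<Phi>;
           \<Delta> = weight_vector_field M A h
       in (\<exists>!S :: ('m, 'e) chart set \<times> ('m, 'm, 'e) trivialization set.
             case S of (A\<^sub>0, \<T>) \<Rightarrow>
               smooth_structure M\<^sub>0 A\<^sub>0 \<and> graded_bundle M A M\<^sub>0 A\<^sub>0 \<pi> \<T> \<and>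
               has_homotheties M \<pi> \<T> h) \<and>
          global_flow M A \<Phi> \<and> complete_vector_field M A Y \<and> has_weight M A h Y 1 \<and>
          complete_vector_field M A \<Delta> \<and>
          lie_bracket \<Delta> Y = Y))"
  unfolding Let_def
proof (intro conjI allI impI)
  fix H assume "smooth_right_G2_action M A H"
  then interpret G2_flow M A "\<lambda>g p. H (p, g)" 2 1 by (rule G2_flow_right[OF assms])
  note * = G2_flow_structure
  show "\<exists>!S :: ('m, 'e) chart set \<times> ('m, 'm, 'e) trivialization set.
      case S of (A\<^sub>0, \<T>) \<Rightarrow>
        smooth_structure ((\<lambda>p. H (p, (0, 0))) ` M) A\<^sub>0 \<and>
        graded_bundle M A ((\<lambda>p. H (p, (0, 0))) ` M) A\<^sub>0 (\<lambda>p. H (p, (0, 0))) \<T> \<and>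
        has_homotheties M (\<lambda>p. H (p, (0, 0))) \<T> (\<lambda>a p. H (p, (a, 0)))"
    by (rule *(1))
  show "has_weight M A (\<lambda>a p. H (p, (a, 0))) (infinitesimal_generator M A (\<lambda>s p. H (p, (1, s)))) (- 1)"
    using *(4) by simp
  show "lie_bracket (weight_vector_field M A (\<lambda>a p. H (p, (a, 0)))) (infinitesimal_generator M A (\<lambda>s p. H (p, (1, s))))
      = (\<lambda>p f. - infinitesimal_generator M A (\<lambda>s p. H (p, (1, s))) p f)"
    using *(6) by simp
qed (use G2_flow.G2_flow_structure[OF G2_flow_left[OF assms]]
    G2_flow.G2_flow_structure[OF G2_flow_right[OF assms]] in simp_all)

end
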